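(* Let $\Lambda$ be a Dedekind domain and let $M$ be a finitely-generated projective $\Lambda$-module of rank $n$. Then the map $(P,Q) \mapsto Q$, regarded as a map of posets $S_M \to T_M^{\mathrm{op}}$, induces a surjective homomorphism $$\widetilde{St}(M) = \widetilde H_{n-2}(|S_M|) \longrightarrow \widetilde H_{n-2}(|T_M^{\mathrm{op}}|) = \widetilde H_{n-2}(|T_M|) = St(M).$$
   Context: Let $\Lambda$ be a Dedekind domain and $M$ a finitely-generated projective $\Lambda$-module of rank $n$. A summand of $M$ is a submodule $P \subseteq M$ for which there is a submodule $Q \subseteq M$ with $M = P \oplus Q$ (internal direct sum); it is proper if $P \neq M$. $T_M$ is the poset of proper nonzero summands of $M$ ordered by inclusion. The Tits building is $T(M) = |T_M|$, the geometric realization of the poset (i.e. of its order complex), and the Steinberg module is $St(M) = \widetilde H_{n-2}(T(M))$ (reduced integral homology). $S_M$ is the poset of pairs $(P,Q)$ of proper submodules of $M$ with $P \oplus Q = M$ (internal direct sum, so $P$ and $Q$ are both nonzero), with $(P,Q) < (P',Q')$ if $P \subsetneq P'$ and $Q \supsetneq Q'$. The split Tits building (Charney building) is $\widetilde T(M) = |S_M|$, and the split Steinberg module is $\widetilde{St}(M) = \widetilde H_{n-2}(\widetilde T(M))$. $T_M^{\mathrm{op}}$ denotes the opposite poset; its geometric realization is canonically identified with $|T_M|$. Convention: the reduced homology of the empty space is $\mathbb{Z}$ in degree $-1$ and zero in all other degrees. *)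

theory Defs
  imports "HOL-Homology.Homology" "HOL-Computational_Algebra.Computational_Algebra"
begin

section \<open>Dedekind domains\<close>

text \<open>A ring is a type of class \<open>comm_ring_1\<close>. Its ideals are the submodules of the ring regarded as a
  module over itself, so that the vocabulary of \<open>HOL.Modules\<close> applies to them.\<close>

abbreviation is_ideal :: "'a::comm_ring_1 set \<Rightarrow> bool" where
  "is_ideal \<equiv> Modules.module.subspace (*)"

definition prime_ideal :: "'a::comm_ring_1 set \<Rightarrow> bool" where
  "prime_ideal I \<longleftrightarrow> is_ideal I \<and> I \<noteq> UNIV \<and> (\<forall>a b. a * b \<in> I \<longrightarrow> a \<in> I \<or> b \<in> I)"

definition maximal_ideal :: "'a::comm_ring_1 set \<Rightarrow> bool" where
  "maximal_ideal I \<longleftrightarrow> is_ideal I \<and> I \<noteq> UNIV \<and> (\<forall>J. is_ideal J \<and> I \<subseteq> J \<longrightarrow> J = I \<or> J = UNIV)"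

definition finitely_generated :: "('a::comm_ring_1 \<Rightarrow> 'm::ab_group_add \<Rightarrow> 'm) \<Rightarrow> 'm set \<Rightarrow> bool" where
  "finitely_generated scl N \<longleftrightarrow> (\<exists>B. finite B \<and> Modules.module.span scl B = N)"

definition noetherian :: "'a::comm_ring_1 itself \<Rightarrow> bool" where
  "noetherian _ \<longleftrightarrow> (\<forall>I::'a set. is_ideal I \<longrightarrow> finitely_generated (*) I)"

definition integrally_closed :: "'a::idom itself \<Rightarrow> bool" where
  "integrally_closed _ \<longleftrightarrow>
     (\<forall>(x::'a fract) p::'a poly. lead_coeff p = 1 \<and> poly (map_poly to_fract p) x = 0 \<longrightarrow>
        x \<in> range to_fract)"

text \<open>The last condition says that the Krull dimension is at most 1; as in Bourbaki, fields are
  Dedekind domains.\<close>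

definition dedekind_domain :: "'a::idom itself \<Rightarrow> bool" where
  "dedekind_domain R \<longleftrightarrow> noetherian R \<and> integrally_closed R \<and>
     (\<forall>I::'a set. prime_ideal I \<and> I \<noteq> {0} \<longrightarrow> maximal_ideal I)"

section \<open>Projective modules and rank\<close>

text \<open>A module over \<open>'a\<close> is the whole type \<open>'m\<close>, with scalar multiplication \<open>scl\<close>.
  The free module on the set \<open>'x\<close> is the type of finitely supported functions from \<open>'x\<close> to \<open>'a\<close>.\<close>

abbreviation free_scale :: "'a::comm_ring_1 \<Rightarrow> ('x \<Rightarrow>\<^sub>0 'a) \<Rightarrow> ('x \<Rightarrow>\<^sub>0 'a)" where
  "free_scale c \<equiv> Poly_Mapping.map ((*) c)"

text \<open>Projective: a direct summand of a free module. There is no loss of generality in taking the free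
  module on the underlying set of the module itself: a direct summand of any free module is a
  retract of this one, since its canonical surjection onto the module splits.\<close>

definition projective_module :: "('a::comm_ring_1 \<Rightarrow> 'm::ab_group_add \<Rightarrow> 'm) \<Rightarrow> bool" where
  "projective_module scl \<longleftrightarrow>
     (\<exists>(\<iota> :: 'm \<Rightarrow> 'm \<Rightarrow>\<^sub>0 'a) \<pi>. module_hom scl free_scale \<iota> \<and> module_hom free_scale scl \<pi> \<and>
        (\<forall>x. \<pi> (\<iota> x) = x))"

text \<open>The rank of a module over an integral domain (its dimension over the fraction field after
  extension of scalars) is the maximal size of a linearly independent subset.\<close>

definition has_rank :: "('a::idom \<Rightarrow> 'm::ab_group_add \<Rightarrow> 'm) \<Rightarrow> nat \<Rightarrow> bool" where
  "has_rank scl n \<longleftrightarrow>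
     (\<exists>B. \<not> Modules.module.dependent scl B \<and> finite B \<and> card B = n) \<and>
     (\<forall>B. \<not> Modules.module.dependent scl B \<longrightarrow> finite B \<and> card B \<le> n)"

section \<open>Geometric realization of a poset\<close>

text \<open>A poset is a carrier set \<open>A\<close> together with a non-strict order \<open>leq\<close>. The simplices of its order
  complex are the nonempty finite chains. Points of the realization are given by their barycentric
  coordinates, and the topology is the weak one: a set is open iff its trace on each closed
  simplex is open for the Euclidean topology of that simplex.\<close>

definition realization_points :: "'x set \<Rightarrow> ('x \<Rightarrow> 'x \<Rightarrow> bool) \<Rightarrow> ('x \<Rightarrow> real) set" where
  "realization_points A leq =
     {t. (\<forall>x. 0 \<le> t x) \<and> finite {x. t x \<noteq> 0} \<and> {x. t x \<noteq> 0} \<subseteq> A \<and>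
         Complete_Partial_Order.chain leq {x. t x \<noteq> 0} \<and> (\<Sum>x | t x \<noteq> 0. t x) = 1}"

definition closed_simplex :: "'x set \<Rightarrow> ('x \<Rightarrow> real) set" where
  "closed_simplex \<sigma> = {t. (\<forall>x. 0 \<le> t x) \<and> {x. t x \<noteq> 0} \<subseteq> \<sigma> \<and> (\<Sum>x\<in>\<sigma>. t x) = 1}"

definition order_complex :: "'x set \<Rightarrow> ('x \<Rightarrow> 'x \<Rightarrow> bool) \<Rightarrow> 'x set set" where
  "order_complex A leq = {\<sigma>. \<sigma> \<noteq> {} \<and> finite \<sigma> \<and> \<sigma> \<subseteq> A \<and> Complete_Partial_Order.chain leq \<sigma>}"

definition geometric_realization :: "'x set \<Rightarrow> ('x \<Rightarrow> 'x \<Rightarrow> bool) \<Rightarrow> ('x \<Rightarrow> real) topology" where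
  "geometric_realization A leq =
     topology (\<lambda>U. U \<subseteq> realization_points A leq \<and>
       (\<forall>\<sigma>\<in>order_complex A leq.
          openin (subtopology (powertop_real UNIV) (closed_simplex \<sigma>)) (U \<inter> closed_simplex \<sigma>)))"

definition realization_map :: "('x \<Rightarrow> 'y) \<Rightarrow> ('x \<Rightarrow> real) \<Rightarrow> ('y \<Rightarrow> real)" where
  "realization_map f t = (\<lambda>y. \<Sum>x | t x \<noteq> 0 \<and> f x = y. t x)"

lemma realization_points_eq_Union:
  "realization_points A leq = \<Union> (closed_simplex ` order_complex A leq)"
proof (intro equalityI subsetI)
  fix t assume t: "t \<in> realization_points A leq"
  let ?\<sigma> = "{x. t x \<noteq> 0}"
  have "?\<sigma> \<noteq> {}"
  proof
    assume "?\<sigma> = {}"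
    then have "(\<Sum>x\<in>?\<sigma>. t x) = 0" by (simp only: sum.empty)
    with t show False by (simp add: realization_points_def)
  qed
  with t have "?\<sigma> \<in> order_complex A leq" "t \<in> closed_simplex ?\<sigma>"
    by (auto simp: realization_points_def order_complex_def closed_simplex_def)
  then show "t \<in> \<Union> (closed_simplex ` order_complex A leq)" by blast
next
  fix t assume "t \<in> \<Union> (closed_simplex ` order_complex A leq)"
  then obtain \<sigma> where \<sigma>: "\<sigma> \<in> order_complex A leq" and t: "t \<in> closed_simplex \<sigma>" by blast
  then have fin: "finite \<sigma>" and sub: "{x. t x \<noteq> 0} \<subseteq> \<sigma>"
    by (auto simp: order_complex_def closed_simplex_def)
  have "(\<Sum>x | t x \<noteq> 0. t x) = (\<Sum>x\<in>\<sigma>. t x)"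
    using fin sub by (intro sum.mono_neutral_left) auto
  moreover have "finite {x. t x \<noteq> 0}" "{x. t x \<noteq> 0} \<subseteq> A"
    using fin sub \<sigma> by (auto simp: order_complex_def intro: finite_subset)
  moreover have "Complete_Partial_Order.chain leq {x. t x \<noteq> 0}"
    using \<sigma> sub unfolding order_complex_def Complete_Partial_Order.chain_def by blast
  ultimately show "t \<in> realization_points A leq"
    using t by (simp add: realization_points_def closed_simplex_def)
qed

lemma openin_geometric_realization:
  "openin (geometric_realization A leq) U \<longleftrightarrow>
     U \<subseteq> realization_points A leq \<and>
     (\<forall>\<sigma>\<in>order_complex A leq.
        openin (subtopology (powertop_real UNIV) (closed_simplex \<sigma>)) (U \<inter> closed_simplex \<sigma>))"
proof -
  let ?O = "\<lambda>U. U \<subseteq> realization_points A leq \<and>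
       (\<forall>\<sigma>\<in>order_complex A leq.
          openin (subtopology (powertop_real UNIV) (closed_simplex \<sigma>)) (U \<inter> closed_simplex \<sigma>))"
  have "istopology ?O"
    unfolding istopology_def
  proof (intro conjI allI impI)
    fix S T assume S: "?O S" and T: "?O T"
    show "S \<inter> T \<subseteq> realization_points A leq" using S by blast
    show "\<forall>\<sigma>\<in>order_complex A leq. openin (subtopology (powertop_real UNIV) (closed_simplex \<sigma>))
        (S \<inter> T \<inter> closed_simplex \<sigma>)"
    proof
      fix \<sigma> assume "\<sigma> \<in> order_complex A leq"
      then have "openin (subtopology (powertop_real UNIV) (closed_simplex \<sigma>)) (S \<inter> closed_simplex \<sigma>)"
        "openin (subtopology (powertop_real UNIV) (closed_simplex \<sigma>)) (T \<inter> closed_simplex \<sigma>)"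
        using S T by blast+
      then have "openin (subtopology (powertop_real UNIV) (closed_simplex \<sigma>))
          ((S \<inter> closed_simplex \<sigma>) \<inter> (T \<inter> closed_simplex \<sigma>))"
        by (rule openin_Int)
      moreover have "(S \<inter> closed_simplex \<sigma>) \<inter> (T \<inter> closed_simplex \<sigma>) = S \<inter> T \<inter> closed_simplex \<sigma>"
        by blast
      ultimately show "openin (subtopology (powertop_real UNIV) (closed_simplex \<sigma>))
          (S \<inter> T \<inter> closed_simplex \<sigma>)"
        by simp
    qed
  next
    fix \<K> assume K: "\<forall>K\<in>\<K>. ?O K"
    show "\<Union>\<K> \<subseteq> realization_points A leq" using K by blast
    show "\<forall>\<sigma>\<in>order_complex A leq. openin (subtopology (powertop_real UNIV) (closed_simplex \<sigma>))
        (\<Union>\<K> \<inter> closed_simplex \<sigma>)"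
    proof
      fix \<sigma> assume "\<sigma> \<in> order_complex A leq"
      then have "openin (subtopology (powertop_real UNIV) (closed_simplex \<sigma>))
          (\<Union>K\<in>\<K>. K \<inter> closed_simplex \<sigma>)"
        using K by (intro openin_Union) blast
      then show "openin (subtopology (powertop_real UNIV) (closed_simplex \<sigma>))
          (\<Union>\<K> \<inter> closed_simplex \<sigma>)"
        by (simp only: Int_Union2)
    qed
  qed
  then show ?thesis
    by (simp add: geometric_realization_def topology_inverse')
qed

lemma topspace_geometric_realization:
  "topspace (geometric_realization A leq) = realization_points A leq"
proof
  show "topspace (geometric_realization A leq) \<subseteq> realization_points A leq"
    using openin_geometric_realization openin_topspace by blast
  have "openin (subtopology (powertop_real UNIV) (closed_simplex \<sigma>))
      (realization_points A leq \<inter> closed_simplex \<sigma>)" if "\<sigma> \<in> order_complex A leq" for \<sigma>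
  proof -
    have "realization_points A leq \<inter> closed_simplex \<sigma> = closed_simplex \<sigma>"
      using that by (auto simp: realization_points_eq_Union)
    then show ?thesis by (simp add: openin_subtopology_refl)
  qed
  then have "openin (geometric_realization A leq) (realization_points A leq)"
    by (simp add: openin_geometric_realization)
  then show "realization_points A leq \<subseteq> topspace (geometric_realization A leq)"
    by (rule openin_subset)
qed

lemma geometric_realization_dual:
  "geometric_realization A (\<lambda>x y. leq y x) = geometric_realization A leq"
  by (simp add: geometric_realization_def realization_points_def order_complex_def
      Complete_Partial_Order.chain_def disj_commute)

lemma realization_map_eq_sum:
  assumes "finite \<sigma>" "{x. t x \<noteq> 0} \<subseteq> \<sigma>"
  shows "realization_map f t y = (\<Sum>x\<in>{x \<in> \<sigma>. f x = y}. t x)"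
  unfolding realization_map_def using assms by (intro sum.mono_neutral_left) auto

lemma realization_map_closed_simplex:
  assumes fin: "finite \<sigma>" and t: "t \<in> closed_simplex \<sigma>"
  shows "realization_map f t \<in> closed_simplex (f ` \<sigma>)"
proof -
  have sub: "{x. t x \<noteq> 0} \<subseteq> \<sigma>" and pos: "\<And>x. 0 \<le> t x" and one: "(\<Sum>x\<in>\<sigma>. t x) = 1"
    using t by (auto simp: closed_simplex_def)
  have eq: "realization_map f t y = (\<Sum>x\<in>{x \<in> \<sigma>. f x = y}. t x)" for y
    by (rule realization_map_eq_sum[OF fin sub])
  have "(\<Sum>y\<in>f ` \<sigma>. realization_map f t y) = 1"
    unfolding eq using sum.image_gen[OF fin, of t f] one by simp
  moreover have "y \<in> f ` \<sigma>" if "realization_map f t y \<noteq> 0" for y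
  proof (rule ccontr)
    assume "y \<notin> f ` \<sigma>"
    then have "{x \<in> \<sigma>. f x = y} = {}" by auto
    with that show False unfolding eq by (simp only: sum.empty)
  qed
  ultimately show ?thesis
    by (auto simp: closed_simplex_def eq intro!: sum_nonneg pos)
qed

lemma continuous_map_realization_map:
  assumes mono: "monotone_on A leq leq' f" and f: "f ` A \<subseteq> B"
  shows "continuous_map (geometric_realization A leq) (geometric_realization B leq') (realization_map f)"
proof -
  have im: "f ` \<sigma> \<in> order_complex B leq'" if \<sigma>: "\<sigma> \<in> order_complex A leq" for \<sigma>
  proof -
    have "leq' (f x) (f y) \<or> leq' (f y) (f x)" if "x \<in> \<sigma>" "y \<in> \<sigma>" for x y
    proof -
      have "x \<in> A" "y \<in> A" "leq x y \<or> leq y x"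
        using \<sigma> that by (auto simp: order_complex_def Complete_Partial_Order.chain_def)
      then show ?thesis using monotone_onD[OF mono] by blast
    qed
    then have "Complete_Partial_Order.chain leq' (f ` \<sigma>)"
      by (auto simp: Complete_Partial_Order.chain_def)
    moreover have "f ` \<sigma> \<noteq> {}" "finite (f ` \<sigma>)" "f ` \<sigma> \<subseteq> B"
      using \<sigma> f by (auto simp: order_complex_def)
    ultimately show ?thesis by (simp add: order_complex_def)
  qed
  have fin: "finite \<sigma>" if "\<sigma> \<in> order_complex A leq" for \<sigma>
    using that by (simp add: order_complex_def)
  have pts: "realization_map f t \<in> realization_points B leq'" if "t \<in> realization_points A leq" for t
    using that im fin realization_map_closed_simplex
    unfolding realization_points_eq_Union by blast
  have cont: "continuous_map (subtopology (powertop_real UNIV) (closed_simplex \<sigma>))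
      (subtopology (powertop_real UNIV) (closed_simplex (f ` \<sigma>))) (realization_map f)"
    if "\<sigma> \<in> order_complex A leq" for \<sigma>
  proof -
    let ?X = "subtopology (powertop_real UNIV) (closed_simplex \<sigma>)"
    have "continuous_map ?X euclideanreal (\<lambda>t. realization_map f t y)" for y
    proof (rule continuous_map_eq)
      show "continuous_map ?X euclideanreal (\<lambda>t. \<Sum>x\<in>{x \<in> \<sigma>. f x = y}. t x)"
        using fin[OF that]
        by (intro continuous_map_sum continuous_map_from_subtopology
            continuous_map_product_projection) auto
      show "(\<Sum>x\<in>{x \<in> \<sigma>. f x = y}. t x) = realization_map f t y" if "t \<in> topspace ?X" for t
        using that realization_map_eq_sum[OF fin[OF \<open>\<sigma> \<in> order_complex A leq\<close>], of t f y]
        by (auto simp: closed_simplex_def)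
    qed
    then have "continuous_map ?X (powertop_real UNIV) (realization_map f)"
      by (simp add: continuous_map_componentwise_UNIV)
    then show ?thesis
      using realization_map_closed_simplex[OF fin[OF that]]
      by (auto simp: continuous_map_in_subtopology)
  qed
  show ?thesis
    unfolding continuous_map_alt topspace_geometric_realization
  proof (intro conjI allI impI)
    show "realization_map f \<in> realization_points A leq \<rightarrow> realization_points B leq'"
      using pts by blast
    fix V assume V: "openin (geometric_realization B leq') V"
    let ?U = "realization_map f -` V \<inter> realization_points A leq"
    have "openin (subtopology (powertop_real UNIV) (closed_simplex \<sigma>)) (?U \<inter> closed_simplex \<sigma>)"
      if \<sigma>: "\<sigma> \<in> order_complex A leq" for \<sigma>
    proof -
      have "openin (subtopology (powertop_real UNIV) (closed_simplex (f ` \<sigma>)))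
          (V \<inter> closed_simplex (f ` \<sigma>))"
        using V im[OF \<sigma>] by (simp add: openin_geometric_realization)
      from openin_continuous_map_preimage[OF cont[OF \<sigma>] this]
      have "openin (subtopology (powertop_real UNIV) (closed_simplex \<sigma>))
          {t \<in> closed_simplex \<sigma>. realization_map f t \<in> V \<inter> closed_simplex (f ` \<sigma>)}"
        by simp
      moreover have "{t \<in> closed_simplex \<sigma>. realization_map f t \<in> V \<inter> closed_simplex (f ` \<sigma>)} =
          ?U \<inter> closed_simplex \<sigma>"
        using \<sigma> realization_map_closed_simplex[OF fin[OF \<sigma>], of _ f]
        by (auto simp: realization_points_eq_Union)
      ultimately show ?thesis by simp
    qed
    then show "openin (geometric_realization A leq) ?U"
      by (simp add: openin_geometric_realization)
  qed
qed

section \<open>Reduced homology with the convention for the empty space\<close>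

text \<open>In the library the reduced singular homology groups of the empty space are all trivial. The
  second factor below supplies the missing group of integers in degree \<open>-1\<close> and is trivial in all
  other cases; the induced map is the identity on it if both spaces are empty.\<close>

definition empty_correction :: "int \<Rightarrow> 'x topology \<Rightarrow> int monoid" where
  "empty_correction p X = (if topspace X = {} \<and> p = -1 then integer_group else singleton_group 0)"

definition reduced_homology :: "int \<Rightarrow> 'x topology \<Rightarrow> ('x chain set \<times> int) monoid" where
  "reduced_homology p X = reduced_homology_group p X \<times>\<times> empty_correction p X"

definition reduced_homology_map ::
  "int \<Rightarrow> 'x topology \<Rightarrow> 'y topology \<Rightarrow> ('x \<Rightarrow> 'y) \<Rightarrow> 'x chain set \<times> int \<Rightarrow> 'y chain set \<times> int" where
  "reduced_homology_map p X Y f =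
     (\<lambda>(c, k). (hom_induced p X {} Y {} f c, if topspace Y = {} \<and> p = -1 then k else 0))"

lemma reduced_homology_map_hom:
  assumes "continuous_map X Y f"
  shows "reduced_homology_map p X Y f \<in> hom (reduced_homology p X) (reduced_homology p Y)"
proof (rule homI)
  have X: "topspace X = {}" if "topspace Y = {}"
    using continuous_map_image_subset_topspace[OF assms] that by blast
  have h: "hom_induced p X {} Y {} f \<in> hom (reduced_homology_group p X) (reduced_homology_group p Y)"
    by (rule hom_induced_reduced_hom)
  show "reduced_homology_map p X Y f x \<in> carrier (reduced_homology p Y)"
    if "x \<in> carrier (reduced_homology p X)" for x
    using that hom_in_carrier[OF h]
    by (auto simp: reduced_homology_map_def reduced_homology_def empty_correction_def
        DirProd_def singleton_group_def)
  show "reduced_homology_map p X Y f (x \<otimes>\<^bsub>reduced_homology p X\<^esub> y) =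
      reduced_homology_map p X Y f x \<otimes>\<^bsub>reduced_homology p Y\<^esub> reduced_homology_map p X Y f y"
    if "x \<in> carrier (reduced_homology p X)" "y \<in> carrier (reduced_homology p X)" for x y
    using that hom_mult[OF h] X
    by (auto simp: reduced_homology_map_def reduced_homology_def empty_correction_def
        DirProd_def singleton_group_def)
qed

section \<open>Tits buildings and Steinberg modules\<close>

definition internal_direct_sum ::
  "('a::comm_ring_1 \<Rightarrow> 'm::ab_group_add \<Rightarrow> 'm) \<Rightarrow> 'm set \<Rightarrow> 'm set \<Rightarrow> bool" where
  "internal_direct_sum scl P Q \<longleftrightarrow>
     Modules.module.subspace scl P \<and> Modules.module.subspace scl Q \<and>
     P \<inter> Q = {0} \<and> {p + q | p q. p \<in> P \<and> q \<in> Q} = UNIV"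

definition is_summand :: "('a::comm_ring_1 \<Rightarrow> 'm::ab_group_add \<Rightarrow> 'm) \<Rightarrow> 'm set \<Rightarrow> bool" where
  "is_summand scl P \<longleftrightarrow> (\<exists>Q. internal_direct_sum scl P Q)"

definition summand_poset :: "('a::comm_ring_1 \<Rightarrow> 'm::ab_group_add \<Rightarrow> 'm) \<Rightarrow> 'm set set" where
  "summand_poset scl = {P. is_summand scl P \<and> P \<noteq> {0} \<and> P \<noteq> UNIV}"

definition split_poset :: "('a::comm_ring_1 \<Rightarrow> 'm::ab_group_add \<Rightarrow> 'm) \<Rightarrow> ('m set \<times> 'm set) set" where
  "split_poset scl = {(P, Q). internal_direct_sum scl P Q \<and> P \<noteq> UNIV \<and> Q \<noteq> UNIV}"

definition split_less :: "'m set \<times> 'm set \<Rightarrow> 'm set \<times> 'm set \<Rightarrow> bool" where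
  "split_less = (\<lambda>(P, Q) (P', Q'). P \<subset> P' \<and> Q' \<subset> Q)"

definition split_le :: "'m set \<times> 'm set \<Rightarrow> 'm set \<times> 'm set \<Rightarrow> bool" where
  "split_le x y \<longleftrightarrow> x = y \<or> split_less x y"

definition tits_building ::
  "('a::comm_ring_1 \<Rightarrow> 'm::ab_group_add \<Rightarrow> 'm) \<Rightarrow> ('m set \<Rightarrow> real) topology" where
  "tits_building scl = geometric_realization (summand_poset scl) (\<subseteq>)"

definition split_tits_building ::
  "('a::comm_ring_1 \<Rightarrow> 'm::ab_group_add \<Rightarrow> 'm) \<Rightarrow> ('m set \<times> 'm set \<Rightarrow> real) topology" where
  "split_tits_building scl = geometric_realization (split_poset scl) split_le"

definition op_tits_building ::
  "('a::comm_ring_1 \<Rightarrow> 'm::ab_group_add \<Rightarrow> 'm) \<Rightarrow> ('m set \<Rightarrow> real) topology" where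
  "op_tits_building scl = geometric_realization (summand_poset scl) (\<lambda>P Q. Q \<subseteq> P)"

text \<open>The rank \<open>n\<close> is an argument; the degree \<open>n - 2\<close> is an integer, possibly negative.\<close>

definition steinberg_module ::
  "('a::comm_ring_1 \<Rightarrow> 'm::ab_group_add \<Rightarrow> 'm) \<Rightarrow> nat \<Rightarrow> (('m set \<Rightarrow> real) chain set \<times> int) monoid" where
  "steinberg_module scl n = reduced_homology (int n - 2) (tits_building scl)"

definition split_steinberg_module ::
  "('a::comm_ring_1 \<Rightarrow> 'm::ab_group_add \<Rightarrow> 'm) \<Rightarrow> nat \<Rightarrow>
     (('m set \<times> 'm set \<Rightarrow> real) chain set \<times> int) monoid" where
  "split_steinberg_module scl n = reduced_homology (int n - 2) (split_tits_building scl)"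

lemma op_tits_building_eq: "op_tits_building scl = tits_building scl"
  unfolding op_tits_building_def tits_building_def by (rule geometric_realization_dual)

lemma snd_split_poset: "snd ` split_poset scl \<subseteq> summand_poset scl"
proof clarsimp
  fix P Q assume "(P, Q) \<in> split_poset scl"
  then have d: "internal_direct_sum scl P Q" and P: "P \<noteq> UNIV" and Q: "Q \<noteq> UNIV"
    by (auto simp: split_poset_def)
  have "{q + p | q p. q \<in> Q \<and> p \<in> P} = {p + q | p q. p \<in> P \<and> q \<in> Q}"
  proof (intro equalityI subsetI)
    fix x assume "x \<in> {q + p | q p. q \<in> Q \<and> p \<in> P}"
    then obtain q p where "x = q + p" "q \<in> Q" "p \<in> P" by blast
    then have "x = p + q" by (simp add: add.commute)
    with \<open>q \<in> Q\<close> \<open>p \<in> P\<close> show "x \<in> {p + q | p q. p \<in> P \<and> q \<in> Q}" by blast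
  next
    fix x assume "x \<in> {p + q | p q. p \<in> P \<and> q \<in> Q}"
    then obtain q p where "x = p + q" "q \<in> Q" "p \<in> P" by blast
    then have "x = q + p" by (simp add: add.commute)
    with \<open>q \<in> Q\<close> \<open>p \<in> P\<close> show "x \<in> {q + p | q p. q \<in> Q \<and> p \<in> P}" by blast
  qed
  with d have "internal_direct_sum scl Q P"
    by (simp add: internal_direct_sum_def Int_commute)
  moreover have "Q \<noteq> {0}"
    using d P by (auto simp: internal_direct_sum_def)
  ultimately show "Q \<in> summand_poset scl"
    using Q by (auto simp: summand_poset_def is_summand_def)
qed

end

theory Submission
  imports Defs
begin

text \<open>The fibre of \<open>(P, Q) \<mapsto> Q\<close> over the elements \<open>\<supseteq> W\<close> is the poset of splittings \<open>M = P \<oplus> Q\<close> with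
  \<open>W \<subseteq> Q\<close>. By induction on the rank, its reduced homology vanishes in all degrees below
  \<open>rk M - rk W - 1\<close>: mapping a splitting to \<open>P\<close> compares it with the poset of nonzero summands \<open>P\<close> that
  meet \<open>W\<close> trivially and for which \<open>P + W\<close> is a summand; that poset is highly acyclic, and the fibres of
  this second map are, by duality, posets of splittings in smaller rank. As the acyclicity of the fibres
  grows along the order of the target, acyclic carriers lift every simplicial cycle of \<open>T\<^sub>M\<close> to \<open>S\<^sub>M\<close>, up to
  homology. To pass to singular homology, a cycle of \<open>|T\<^sub>M|\<close> is subdivided until every singular
  simplex has its corners in open stars with a common point; a prism then joins it to an affine cycle.
  The map is thus surjective on homology in every degree.\<close>

section \<open>Chains of lists\<close>

text \<open>A list of length \<open>l\<close> is a simplex of dimension \<open>l - 1\<close> and the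
  empty list spans degree -1, so nonemptiness, connectedness and higher vanishing are instances of
  the one predicate \<open>fills\<close>, and all ranges are counted by list length. The ranges
  match by a count of ranks: a strict chain of proper summands that descends to W has at most rk M -
  rk W members, and the fibre over W is acyclic for cycles of every length below that number, so a
  lift can be built simplex by simplex without running out of acyclicity. The homotopy from the
  lifted and projected chain back to the original lives over T_M, inside sets of lists that are
  cones. What shapes the algebra is that the sum of two summands need not be a summand; this is
  recorded by the relation \<open>good\<close>. The second map has fibres that are splitting posets
  for the reversed order, so the induction runs over abstract lattices with self-dual axioms instead
  of over modules. Dedekind domains enter where a saturated submodule (one with torsion-free
  quotient) is split off, by means of the invertibility of ideals.\<close>

abbreviation frag_map :: "('a \<Rightarrow> 'b) \<Rightarrow> ('a \<Rightarrow>\<^sub>0 int) \<Rightarrow> 'b \<Rightarrow>\<^sub>0 int" where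
  "frag_map f \<equiv> frag_extend (\<lambda>x. frag_of (f x))"

text \<open>The boundary is augmented: a list of length \<open>l\<close> is a simplex of dimension \<open>l - 1\<close>, and the
  boundary of a vertex is the empty list.\<close>

primrec list_boundary :: "'x list \<Rightarrow> 'x list \<Rightarrow>\<^sub>0 int" where
  "list_boundary [] = 0"
| "list_boundary (a # l) = frag_of l - frag_map ((#) a) (list_boundary l)"

abbreviation boundary :: "('x list \<Rightarrow>\<^sub>0 int) \<Rightarrow> ('x list \<Rightarrow>\<^sub>0 int)" where
  "boundary \<equiv> frag_extend list_boundary"

lemma frag_extend_extend:
  "frag_extend f (frag_extend g c) = frag_extend (\<lambda>x. frag_extend f (g x)) c"
  by (rule frag_induction[OF subset_UNIV]) (auto simp: frag_extend_diff)

lemma frag_extend_fun_diff: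
  "frag_extend (\<lambda>x. f x - g x) c = frag_extend f c - frag_extend g c"
  by (rule frag_induction[OF subset_UNIV]) (auto simp: frag_extend_diff)

lemma frag_extend_fun_add:
  "frag_extend (\<lambda>x. f x + g x) c = frag_extend f c + frag_extend g c"
  by (rule frag_induction[OF subset_UNIV]) (auto simp: frag_extend_diff)

lemma frag_extend_fun_cmul:
  "frag_extend (\<lambda>x. frag_cmul k (f x)) c = frag_cmul k (frag_extend f c)"
  by (simp add: frag_extend_def frag_cmul_sum mult.commute)

lemma frag_extend_fun_sum:
  "finite I \<Longrightarrow> frag_extend (\<lambda>x. \<Sum>i\<in>I. f i x) c = (\<Sum>i\<in>I. frag_extend (f i) c)"
  by (induction I rule: finite_induct) (auto simp: frag_extend_fun_add frag_extend_eq_0)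

lemma frag_map_id: "frag_map (\<lambda>x. x) c = c"
  using frag_expansion[of c] by simp

lemma frag_map_cong_id: "(\<And>x. x \<in> Poly_Mapping.keys c \<Longrightarrow> f x = x) \<Longrightarrow> frag_map f c = c"
  using frag_extend_eq[of c "\<lambda>x. frag_of (f x)" frag_of] frag_map_id[of c] by simp

text \<open>Prepending \<open>a\<close> is the cone with apex \<open>a\<close>. The augmentation
  makes the formula hold in the lowest degree too, so cones give fillings without a case
  distinction.\<close>

lemma boundary_Cons: "boundary (frag_map ((#) a) c) = c - frag_map ((#) a) (boundary c)"
  by (simp add: frag_extend_extend frag_extend_fun_diff frag_map_id)

lemma boundary_list_boundary: "boundary (list_boundary l) = 0"
proof (induction l)
  case (Cons a l)
  then show ?case
    by (simp only: list_boundary.simps frag_extend_diff frag_extend_of boundary_Cons) simp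
qed simp

lemma boundary_boundary: "boundary (boundary c) = 0"
  by (simp add: frag_extend_extend boundary_list_boundary frag_extend_eq_0)

lemma list_boundary_map: "list_boundary (map f l) = frag_map (map f) (list_boundary l)"
  by (induction l) (auto simp: frag_extend_diff frag_extend_extend)

lemma boundary_map: "boundary (frag_map (map f) c) = frag_map (map f) (boundary c)"
  by (simp add: frag_extend_extend list_boundary_map)

lemma list_boundary_snoc:
  "list_boundary (l @ [a]) =
    frag_map (\<lambda>m. m @ [a]) (list_boundary l) + frag_cmul ((-1) ^ length l) (frag_of l)"
  by (induction l)
    (auto simp: frag_extend_diff frag_extend_add frag_extend_extend frag_extend_cmul)

text \<open>The recursive boundary suits cones and prisms; this closed form is the one that matches
  the boundary of singular chains face by face.\<close>

lemma list_boundary_altdef: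
  "list_boundary l = (\<Sum>i<length l. frag_cmul ((-1) ^ i) (frag_of (take i l @ drop (Suc i) l)))"
proof (induction l)
  case (Cons a l)
  show ?case
    by (simp add: Cons sum.lessThan_Suc_shift frag_extend_sum frag_extend_cmul o_def del: sum.lessThan_Suc
        flip: sum_negf)
qed simp

lemma keys_list_boundary:
  assumes "m \<in> Poly_Mapping.keys (list_boundary l)"
  obtains xs x ys where "l = xs @ x # ys" "m = xs @ ys"
proof -
  have "\<exists>xs x ys. l = xs @ x # ys \<and> m = xs @ ys"
    using assms
  proof (induction l arbitrary: m)
    case (Cons a l)
    have "Poly_Mapping.keys (list_boundary (a # l)) \<subseteq> insert l ((#) a ` Poly_Mapping.keys (list_boundary l))"
      using keys_diff[of "frag_of l" "frag_map ((#) a) (list_boundary l)"]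
        keys_frag_extend[of "\<lambda>x. frag_of (a # x)" "list_boundary l"] by auto
    with Cons.prems consider "m = l" | m' where "m' \<in> Poly_Mapping.keys (list_boundary l)" "m = a # m'"
      by blast
    then show ?case
    proof cases
      case 1
      then show ?thesis by (intro exI[of _ "[]"]) auto
    next
      case 2
      then obtain xs x ys where "l = xs @ x # ys" "m' = xs @ ys" using Cons.IH by blast
      with 2 show ?thesis by (intro exI[of _ "a # xs"]) auto
    qed
  qed simp
  with that show thesis by blast
qed

section \<open>Chains supported in a set of lists, and vanishing of their homology\<close>

definition chains_in :: "'x list set \<Rightarrow> nat \<Rightarrow> ('x list \<Rightarrow>\<^sub>0 int) set" where
  "chains_in K l = {c. Poly_Mapping.keys c \<subseteq> {xs \<in> K. length xs = l}}"

definition face_closed :: "'x list set \<Rightarrow> bool" where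
  "face_closed K \<longleftrightarrow> (\<forall>xs x ys. xs @ x # ys \<in> K \<longrightarrow> xs @ ys \<in> K)"

text \<open>Vanishing of the reduced homology of \<open>K\<close> in degree \<open>l - 1\<close>.
  For \<open>l = 0\<close> and \<open>K\<close> containing the empty list it says that
  \<open>K\<close> has a vertex.\<close>

definition fills :: "'x list set \<Rightarrow> nat \<Rightarrow> bool" where
  "fills K l \<longleftrightarrow> (\<forall>c \<in> chains_in K l. boundary c = 0 \<longrightarrow> (\<exists>e \<in> chains_in K (Suc l). boundary e = c))"

lemma chains_in_0 [simp]: "0 \<in> chains_in K l"
  by (simp add: chains_in_def)

lemma chains_in_of [simp]: "frag_of xs \<in> chains_in K l \<longleftrightarrow> xs \<in> K \<and> length xs = l"
  by (simp add: chains_in_def)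

lemma chains_in_add: "c \<in> chains_in K l \<Longrightarrow> d \<in> chains_in K l \<Longrightarrow> c + d \<in> chains_in K l"
  unfolding chains_in_def using keys_add[of c d] by blast

lemma chains_in_diff: "c \<in> chains_in K l \<Longrightarrow> d \<in> chains_in K l \<Longrightarrow> c - d \<in> chains_in K l"
  unfolding chains_in_def using keys_diff[of c d] by blast

lemma chains_in_minus: "c \<in> chains_in K l \<Longrightarrow> - c \<in> chains_in K l"
  by (simp add: chains_in_def)

lemma chains_in_cmul: "c \<in> chains_in K l \<Longrightarrow> frag_cmul k c \<in> chains_in K l"
  unfolding chains_in_def using keys_cmul[of k c] by blast

lemma chains_in_sum: "(\<And>i. i \<in> I \<Longrightarrow> c i \<in> chains_in K l) \<Longrightarrow> sum c I \<in> chains_in K l"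
  by (induction I rule: infinite_finite_induct) (auto intro: chains_in_add)

lemma chains_in_mono: "c \<in> chains_in K l \<Longrightarrow> K \<subseteq> K' \<Longrightarrow> c \<in> chains_in K' l"
  by (auto simp: chains_in_def)

lemma chains_in_extend:
  assumes "c \<in> chains_in K l" "\<And>xs. xs \<in> K \<Longrightarrow> length xs = l \<Longrightarrow> f xs \<in> chains_in K' l'"
  shows "frag_extend f c \<in> chains_in K' l'"
  using assms keys_frag_extend[of f c] unfolding chains_in_def by blast

lemma chains_in_map:
  assumes "c \<in> chains_in K l" "\<And>xs. xs \<in> K \<Longrightarrow> map f xs \<in> K'"
  shows "frag_map (map f) c \<in> chains_in K' l"
  by (rule chains_in_extend[OF assms(1)]) (simp add: assms(2))

lemma frag_extend_eq_chains_in: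
  assumes "c \<in> chains_in K l" "\<And>xs. xs \<in> K \<Longrightarrow> length xs = l \<Longrightarrow> f xs = g xs"
  shows "frag_extend f c = frag_extend g c"
  using assms by (intro frag_extend_eq) (auto simp: chains_in_def)

lemma list_boundary_chains_in:
  assumes "face_closed K" "xs \<in> K"
  shows "list_boundary xs \<in> chains_in K (length xs - 1)"
  unfolding chains_in_def
proof clarsimp
  fix m assume "m \<in> Poly_Mapping.keys (list_boundary xs)"
  then obtain us x vs where "xs = us @ x # vs" "m = us @ vs" by (rule keys_list_boundary)
  with assms show "m \<in> K \<and> length m = length xs - Suc 0"
    by (auto simp: face_closed_def)
qed

lemma boundary_chains_in:
  assumes "face_closed K" "c \<in> chains_in K l"
  shows "boundary c \<in> chains_in K (l - 1)"
  by (rule chains_in_extend[OF assms(2)]) (use list_boundary_chains_in[OF assms(1)] in auto)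

section \<open>Acyclic carriers\<close>

text \<open>The construction of a chain map is the case \<open>e = 0\<close>, \<open>s = -1\<close>, \<open>R = 0\<close>; that of a chain homotopy
  between \<open>G\<close> and \<open>H\<close> is the case \<open>e = 1\<close>, \<open>s = 1\<close>, \<open>R = G - H\<close>.\<close>

lemma carrier_recursion:
  fixes R :: "'x list \<Rightarrow> 'y list \<Rightarrow>\<^sub>0 int"
  assumes K: "face_closed K"
    and mono: "\<And>xs x ys. xs @ x # ys \<in> K \<Longrightarrow> \<Phi> (xs @ ys) \<subseteq> \<Phi> (xs @ x # ys)"
    and t0: "t0 \<in> chains_in (\<Phi> []) e" "boundary t0 = R []"
    and fills: "\<And>xs. xs \<in> K \<Longrightarrow> xs \<noteq> [] \<Longrightarrow> fills (\<Phi> xs) (length xs - 1 + e)"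
    and R: "\<And>xs. xs \<in> K \<Longrightarrow> xs \<noteq> [] \<Longrightarrow> R xs \<in> chains_in (\<Phi> xs) (length xs - 1 + e)"
    and bdR: "\<And>xs. xs \<in> K \<Longrightarrow> xs \<noteq> [] \<Longrightarrow> boundary (R xs) = frag_cmul s (frag_extend R (list_boundary xs))"
  obtains T where "T [] = t0"
    "\<And>xs. xs \<in> K \<Longrightarrow> T xs \<in> chains_in (\<Phi> xs) (length xs + e)"
    "\<And>xs. xs \<in> K \<Longrightarrow> boundary (T xs) = R xs - frag_cmul s (frag_extend T (list_boundary xs))"
proof -
  \<comment> \<open>Stage \<open>n\<close> is meaningful only on lists of length \<open>n\<close>;
    it is built by choice from the stage below, which is all that the faces of such a list involve.
    \<open>T\<close> reads off the stage that belongs to the length.\<close>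
  define F where "F = rec_nat (\<lambda>_. t0) (\<lambda>n f xs. SOME c. c \<in> chains_in (\<Phi> xs) (Suc n + e) \<and>
      boundary c = R xs - frag_cmul s (frag_extend f (list_boundary xs)))"
  have F0: "F 0 = (\<lambda>_. t0)" by (simp add: F_def)
  have FS: "F (Suc n) xs = (SOME c. c \<in> chains_in (\<Phi> xs) (Suc n + e) \<and>
      boundary c = R xs - frag_cmul s (frag_extend (F n) (list_boundary xs)))" for n xs
    by (simp add: F_def)
  define T where "T xs = F (length xs) xs" for xs
  have ext: "frag_extend (F n) (list_boundary xs) = frag_extend T (list_boundary xs)"
    if "length xs = Suc n" for xs n
  proof (rule frag_extend_eq)
    fix m assume "m \<in> Poly_Mapping.keys (list_boundary xs)"
    then have "length m = n" using that by (auto elim!: keys_list_boundary)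
    then show "F n m = T m" by (simp add: T_def)
  qed
  have main: "T xs \<in> chains_in (\<Phi> xs) (length xs + e) \<and>
      boundary (T xs) = R xs - frag_cmul s (frag_extend T (list_boundary xs))" if "xs \<in> K" for xs
    using that
  proof (induction "length xs" arbitrary: xs)
    case 0
    then show ?case using t0 by (simp add: T_def F0)
  next
    case (Suc n xs)
    have ne: "xs \<noteq> []" and len: "length xs = Suc n" using Suc by auto
    let ?O = "R xs - frag_cmul s (frag_extend T (list_boundary xs))"
    have lb: "list_boundary xs \<in> chains_in K n"
      using list_boundary_chains_in[OF K Suc.prems] len by simp
    have face: "T m \<in> chains_in (\<Phi> xs) (n + e) \<and> boundary (T m) = R m - frag_cmul s (frag_extend T (list_boundary m))"
      if m: "m \<in> Poly_Mapping.keys (list_boundary xs)" for m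
    proof -
      from m obtain us x vs where xs: "xs = us @ x # vs" and mm: "m = us @ vs" by (rule keys_list_boundary)
      have "m \<in> K" "length m = n" using m lb by (auto simp: chains_in_def)
      moreover have "\<Phi> m \<subseteq> \<Phi> xs" using mono[of us x vs] Suc.prems xs mm by simp
      ultimately show ?thesis using Suc.hyps(1)[of m] by (auto intro: chains_in_mono)
    qed
    have O: "?O \<in> chains_in (\<Phi> xs) (n + e)"
    proof (intro chains_in_diff chains_in_cmul)
      show "R xs \<in> chains_in (\<Phi> xs) (n + e)" using R[OF Suc.prems ne] len by simp
      show "frag_extend T (list_boundary xs) \<in> chains_in (\<Phi> xs) (n + e)"
        using face keys_frag_extend[of T "list_boundary xs"] unfolding chains_in_def by blast
    qed
    \<comment> \<open>The obstruction \<open>?O\<close> is a cycle: by induction \<open>T\<close> of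
      the faces has boundary \<open>R\<close> of the faces, up to a term with a double boundary, and
      \<open>bdR\<close> says that \<open>R xs\<close> has the same boundary up to the factor
      \<open>s\<close>.\<close>
    have "boundary (frag_extend T (list_boundary xs)) = frag_extend R (list_boundary xs)"
    proof -
      have "boundary (frag_extend T (list_boundary xs)) =
          frag_extend (\<lambda>m. R m - frag_cmul s (frag_extend T (list_boundary m))) (list_boundary xs)"
        unfolding frag_extend_extend using face by (intro frag_extend_eq) blast
      also have "\<dots> = frag_extend R (list_boundary xs) - frag_cmul s (frag_extend T (boundary (list_boundary xs)))"
        by (simp add: frag_extend_fun_diff frag_extend_fun_cmul frag_extend_extend)
      finally show ?thesis by (simp add: boundary_list_boundary)
    qed
    then have "boundary ?O = 0"
      by (simp add: frag_extend_diff frag_extend_cmul bdR[OF Suc.prems ne])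
    with O fills[OF Suc.prems ne] len
    have ex: "\<exists>c. c \<in> chains_in (\<Phi> xs) (Suc n + e) \<and> boundary c = ?O"
      unfolding fills_def by auto
    have "F (Suc n) xs \<in> chains_in (\<Phi> xs) (Suc n + e) \<and> boundary (F (Suc n) xs) = ?O"
      unfolding FS ext[OF len] by (rule someI_ex[OF ex])
    then show ?case by (simp add: T_def len)
  qed
  show thesis
    by (rule that[of T]) (use main in \<open>auto simp: T_def F0\<close>)
qed

text \<open>A chain map needs acyclicity of the carrier at length \<open>length xs - 1\<close>, a
  homotopy needs it at \<open>length xs\<close>. This gap of one degree decides below when the
  fibres are acyclic enough.\<close>

corollary carrier_chain_map:
  fixes K :: "'x list set" and \<Phi> :: "'x list \<Rightarrow> 'y list set"
  assumes K: "face_closed K"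
    and mono: "\<And>xs x ys. xs @ x # ys \<in> K \<Longrightarrow> \<Phi> (xs @ ys) \<subseteq> \<Phi> (xs @ x # ys)"
    and Nil: "[] \<in> \<Phi> []"
    and fills: "\<And>xs. xs \<in> K \<Longrightarrow> xs \<noteq> [] \<Longrightarrow> fills (\<Phi> xs) (length xs - 1)"
  obtains G where "G [] = frag_of []"
    "\<And>xs. xs \<in> K \<Longrightarrow> G xs \<in> chains_in (\<Phi> xs) (length xs)"
    "\<And>xs. xs \<in> K \<Longrightarrow> boundary (G xs) = frag_extend G (list_boundary xs)"
proof -
  obtain G where "G [] = frag_of []"
    "\<And>xs. xs \<in> K \<Longrightarrow> G xs \<in> chains_in (\<Phi> xs) (length xs + 0)"
    "\<And>xs. xs \<in> K \<Longrightarrow> boundary (G xs) = 0 - frag_cmul (-1) (frag_extend G (list_boundary xs))"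
    using carrier_recursion[of K \<Phi> "frag_of []" 0 "\<lambda>_. 0" "-1"] assms
    by (auto simp: frag_extend_eq_0)
  then show thesis using that by simp
qed

corollary carrier_homotopy:
  fixes K :: "'x list set" and \<Phi> :: "'x list \<Rightarrow> 'y list set"
  assumes K: "face_closed K"
    and mono: "\<And>xs x ys. xs @ x # ys \<in> K \<Longrightarrow> \<Phi> (xs @ ys) \<subseteq> \<Phi> (xs @ x # ys)"
    and fills: "\<And>xs. xs \<in> K \<Longrightarrow> xs \<noteq> [] \<Longrightarrow> fills (\<Phi> xs) (length xs)"
    and GH: "G [] = H []"
    and G: "\<And>xs. xs \<in> K \<Longrightarrow> G xs \<in> chains_in (\<Phi> xs) (length xs)"
    "\<And>xs. xs \<in> K \<Longrightarrow> boundary (G xs) = frag_extend G (list_boundary xs)"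
    and H: "\<And>xs. xs \<in> K \<Longrightarrow> H xs \<in> chains_in (\<Phi> xs) (length xs)"
    "\<And>xs. xs \<in> K \<Longrightarrow> boundary (H xs) = frag_extend H (list_boundary xs)"
  obtains h where "h [] = 0"
    "\<And>xs. xs \<in> K \<Longrightarrow> h xs \<in> chains_in (\<Phi> xs) (Suc (length xs))"
    "\<And>xs. xs \<in> K \<Longrightarrow> boundary (h xs) = G xs - H xs - frag_extend h (list_boundary xs)"
proof -
  obtain h where "h [] = 0"
    "\<And>xs. xs \<in> K \<Longrightarrow> h xs \<in> chains_in (\<Phi> xs) (length xs + 1)"
    "\<And>xs. xs \<in> K \<Longrightarrow> boundary (h xs) = (G xs - H xs) - frag_cmul 1 (frag_extend h (list_boundary xs))"
  proof (rule carrier_recursion[of K \<Phi> 0 1 "\<lambda>xs. G xs - H xs" 1])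
    show "fills (\<Phi> xs) (length xs - 1 + 1)" if "xs \<in> K" "xs \<noteq> []" for xs
      using fills[OF that] that by simp
    show "G xs - H xs \<in> chains_in (\<Phi> xs) (length xs - 1 + 1)" if "xs \<in> K" "xs \<noteq> []" for xs
      using chains_in_diff[OF G(1) H(1)] that by simp
  qed (use assms in \<open>auto simp: frag_extend_diff frag_extend_fun_diff\<close>)
  then show thesis using that by simp
qed

lemma boundary_extend:
  assumes "\<And>xs. xs \<in> K \<Longrightarrow> boundary (G xs) = frag_extend G (list_boundary xs)" "c \<in> chains_in K l"
  shows "boundary (frag_extend G c) = frag_extend G (boundary c)"
  unfolding frag_extend_extend using assms by (intro frag_extend_eq_chains_in) auto

lemma boundary_homotopy:
  assumes "\<And>xs. xs \<in> K \<Longrightarrow> boundary (h xs) = G xs - H xs - frag_extend h (list_boundary xs)"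
    "c \<in> chains_in K l"
  shows "boundary (frag_extend h c) = frag_extend G c - frag_extend H c - frag_extend h (boundary c)"
proof -
  have "boundary (frag_extend h c) = frag_extend (\<lambda>xs. G xs - H xs - frag_extend h (list_boundary xs)) c"
    unfolding frag_extend_extend using assms by (intro frag_extend_eq_chains_in) auto
  then show ?thesis by (simp add: frag_extend_fun_diff frag_extend_extend)
qed

section \<open>Acyclicity of posets\<close>

text \<open>For a strict order every simplex of the order complex occurs as exactly one list, so the
  chains on these lists form its augmented simplicial chain complex.\<close>

definition inc_lists :: "('x \<Rightarrow> 'x \<Rightarrow> bool) \<Rightarrow> 'x set \<Rightarrow> 'x list set" where
  "inc_lists lt A = {xs. sorted_wrt lt xs \<and> set xs \<subseteq> A}"

text \<open>The reduced homology of the order complex vanishes in all degrees below \<open>k - 1\<close>.\<close>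

definition acyclic_below :: "('x \<Rightarrow> 'x \<Rightarrow> bool) \<Rightarrow> 'x set \<Rightarrow> nat \<Rightarrow> bool" where
  "acyclic_below lt A k \<longleftrightarrow> (\<forall>l<k. fills (inc_lists lt A) l)"

lemma face_closed_inc_lists: "face_closed (inc_lists lt A)"
  by (auto simp: face_closed_def inc_lists_def sorted_wrt_append)

lemma inc_lists_mono: "A \<subseteq> B \<Longrightarrow> inc_lists lt A \<subseteq> inc_lists lt B"
  by (auto simp: inc_lists_def)

lemma inc_lists_map:
  assumes "xs \<in> inc_lists lt A" "\<And>x. x \<in> A \<Longrightarrow> f x \<in> B"
    "\<And>x y. x \<in> A \<Longrightarrow> y \<in> A \<Longrightarrow> lt x y \<Longrightarrow> lt' (f x) (f y)"
  shows "map f xs \<in> inc_lists lt' B"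
proof -
  have "sorted_wrt (\<lambda>x y. lt' (f x) (f y)) xs"
    by (rule sorted_wrt_mono_rel[of _ lt]) (use assms in \<open>auto simp: inc_lists_def\<close>)
  then show ?thesis using assms by (auto simp: inc_lists_def sorted_wrt_map)
qed

text \<open>A greatest element \<open>a\<close> makes the order complex a cone. The apex has to be
  appended, since lists are increasing, and lists that already end in \<open>a\<close> need separate
  treatment.\<close>

lemma fills_top:
  assumes a: "a \<in> A" and top: "\<And>x. x \<in> A \<Longrightarrow> x \<noteq> a \<Longrightarrow> lt x a" and max: "\<And>x. x \<in> A \<Longrightarrow> \<not> lt a x"
  shows "fills (inc_lists lt A) l"
  unfolding fills_def
proof (intro ballI impI)
  fix c assume c: "c \<in> chains_in (inc_lists lt A) l" and bd: "boundary c = 0"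
  \<comment> \<open>The contraction: append the apex with the sign that compensates
    \<open>list_boundary_snoc\<close>, and kill the lists through \<open>a\<close>.\<close>
  define s where "s xs = (if a \<in> set xs then 0 else frag_cmul ((-1) ^ length xs) (frag_of (xs @ [a])))" for xs
  have s_in: "s xs \<in> chains_in (inc_lists lt A) (Suc l)" if "xs \<in> inc_lists lt A" "length xs = l" for xs
  proof (cases "a \<in> set xs")
    case False
    have "lt x a" if "x \<in> set xs" for x
      using top[of x] that \<open>xs \<in> _\<close> False by (auto simp: inc_lists_def)
    then show ?thesis
      using that a False by (auto simp: s_def inc_lists_def sorted_wrt_append intro!: chains_in_cmul)
  qed (simp add: s_def)
  have "boundary (s xs) = frag_of xs - frag_extend s (list_boundary xs)" if xs: "xs \<in> inc_lists lt A" for xs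
  proof (cases "a \<in> set xs")
    case False
    have "frag_extend s (list_boundary xs) =
        frag_extend (\<lambda>m. frag_cmul (- ((-1) ^ length xs)) (frag_of (m @ [a]))) (list_boundary xs)"
    proof (rule frag_extend_eq)
      fix m assume "m \<in> Poly_Mapping.keys (list_boundary xs)"
      then obtain us x vs where "xs = us @ x # vs" "m = us @ vs" by (rule keys_list_boundary)
      with False show "s m = frag_cmul (- ((-1) ^ length xs)) (frag_of (m @ [a]))"
        by (auto simp: s_def)
    qed
    then show ?thesis
      using False
      by (simp add: s_def frag_extend_cmul list_boundary_snoc frag_extend_fun_cmul frag_cmul_distrib2
          flip: power_add mult_2)
  next
    case True
    then obtain ms us where xs': "xs = ms @ a # us" by (meson split_list)
    have "us = []"
    proof (rule ccontr)
      assume "us \<noteq> []"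
      then obtain u where "u \<in> set us" by fastforce
      with xs xs' max[of u] show False by (auto simp: inc_lists_def sorted_wrt_append)
    qed
    with xs' have xs': "xs = ms @ [a]" by simp
    have "a \<notin> set ms"
      using xs xs' max[OF a] by (auto simp: inc_lists_def sorted_wrt_append)
    \<comment> \<open>Faces that keep \<open>a\<close> are sent to 0; the face \<open>ms\<close>
      that drops it comes back as \<open>ms @ [a]\<close>, with the square of a sign.\<close>
    then have "frag_extend s (list_boundary xs) = frag_of xs"
      by (simp add: xs' list_boundary_snoc frag_extend_add frag_extend_cmul frag_extend_extend s_def
          frag_extend_eq_0 flip: power_add mult_2)
    then show ?thesis using True by (simp add: s_def)
  qed
  then have "boundary (frag_extend s c) = frag_extend (\<lambda>xs. frag_of xs - frag_extend s (list_boundary xs)) c"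
    unfolding frag_extend_extend using c by (intro frag_extend_eq_chains_in) auto
  then have "boundary (frag_extend s c) = c"
    by (simp add: frag_extend_fun_diff frag_map_id bd flip: frag_extend_extend)
  then show "\<exists>e \<in> chains_in (inc_lists lt A) (Suc l). boundary e = c"
    using chains_in_extend[OF c, of s] s_in by blast
qed

text \<open>Vanishing passes to a retract: a cycle of \<open>B\<close> is carried to
  \<open>A\<close> by \<open>g\<close>, filled there, and the filling is carried back by
  \<open>f\<close>.\<close>

lemma acyclic_below_iso:
  assumes A: "acyclic_below lt A k"
    and f: "\<And>x. x \<in> A \<Longrightarrow> f x \<in> B" "\<And>x y. x \<in> A \<Longrightarrow> y \<in> A \<Longrightarrow> lt x y \<Longrightarrow> lt' (f x) (f y)"
    and g: "\<And>x. x \<in> B \<Longrightarrow> g x \<in> A" "\<And>x y. x \<in> B \<Longrightarrow> y \<in> B \<Longrightarrow> lt' x y \<Longrightarrow> lt (g x) (g y)"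
    and fg: "\<And>x. x \<in> B \<Longrightarrow> f (g x) = x"
  shows "acyclic_below lt' B k"
  unfolding acyclic_below_def fills_def
proof (intro allI impI ballI)
  fix l c assume l: "l < k" and c: "c \<in> chains_in (inc_lists lt' B) l" and bd: "boundary c = 0"
  let ?c = "frag_map (map g) c"
  have "?c \<in> chains_in (inc_lists lt A) l"
    by (rule chains_in_map[OF c], erule inc_lists_map) (simp_all add: g)
  moreover have "boundary ?c = 0" by (simp only: boundary_map bd frag_extend_0)
  ultimately obtain e where e: "e \<in> chains_in (inc_lists lt A) (Suc l)" "boundary e = ?c"
    using A l unfolding acyclic_below_def fills_def by blast
  have "frag_map (map f) e \<in> chains_in (inc_lists lt' B) (Suc l)"
    by (rule chains_in_map[OF e(1)], erule inc_lists_map) (simp_all add: f)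
  moreover have "boundary (frag_map (map f) e) = c"
  proof -
    have "boundary (frag_map (map f) e) = frag_map (\<lambda>xs. map f (map g xs)) c"
      unfolding boundary_map e(2) by (simp add: frag_extend_extend del: map_map)
    also have "\<dots> = c"
    proof (rule frag_map_cong_id)
      fix xs assume "xs \<in> Poly_Mapping.keys c"
      then have "set xs \<subseteq> B" using c by (auto simp: chains_in_def inc_lists_def)
      then show "map f (map g xs) = xs" using fg by (induction xs) auto
    qed
    finally show ?thesis .
  qed
  ultimately show "\<exists>e\<in>chains_in (inc_lists lt' B) (Suc l). boundary e = c" by blast
qed

text \<open>Elements of \<open>D\<close> are minimal, so they occur only as heads. The part of
  \<open>z\<close> with head \<open>x\<close> is the cone over a cycle \<open>c x\<close> in the
  link of \<open>x\<close>; filling that cycle by \<open>E x\<close> allows the cone to be replaced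
  by \<open>E x\<close>, and the cone over \<open>E x\<close> accounts for the difference.\<close>

lemma push_off_minimal:
  assumes D: "\<And>x y. x \<in> D \<Longrightarrow> y \<in> A \<Longrightarrow> \<not> lt y x"
    and link: "\<And>x. x \<in> D \<Longrightarrow> x \<in> A \<Longrightarrow> 0 < l \<Longrightarrow> fills (inc_lists lt {y \<in> A. lt x y}) (l - 1)"
    and z: "z \<in> chains_in (inc_lists lt A) l" "boundary z = 0"
  obtains z' e where "z' \<in> chains_in (inc_lists lt (A - D)) l" "e \<in> chains_in (inc_lists lt A) (Suc l)"
    "boundary e = z - z'"
proof (cases "l = 0")
  case True
  then have "z \<in> chains_in (inc_lists lt (A - D)) l"
    using z(1) by (auto simp: chains_in_def inc_lists_def)
  then show thesis using that[of z 0] by simp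
next
  case False
  define \<pi> where "\<pi> x xs = (case xs of [] \<Rightarrow> 0 | y # ys \<Rightarrow> if y = x then frag_of ys else 0)"
    for x :: 'a and xs
  define c where "c x = frag_extend (\<pi> x) z" for x
  have c_in: "c x \<in> chains_in (inc_lists lt {y \<in> A. lt x y}) (l - 1)" for x
    unfolding c_def
  proof (rule chains_in_extend[OF z(1)])
    fix xs assume "xs \<in> inc_lists lt A" "length xs = l"
    then show "\<pi> x xs \<in> chains_in (inc_lists lt {y \<in> A. lt x y}) (l - 1)"
      by (auto simp: \<pi>_def inc_lists_def split: list.split)
  qed
  have c_bd: "boundary (c x) = 0" if "x \<in> D" for x
  proof -
    have "frag_extend (\<pi> x) (boundary z) = frag_extend (\<lambda>xs. - boundary (\<pi> x xs)) z"
      unfolding frag_extend_extend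
    proof (rule frag_extend_eq_chains_in[OF z(1)])
      fix xs assume xs: "xs \<in> inc_lists lt A" "length xs = l"
      then obtain y m where xs': "xs = y # m" using False by (cases xs) auto
      \<comment> \<open>Dropping the head cannot produce a list with head \<open>x\<close>, because
        nothing of \<open>A\<close> lies below \<open>x\<close>.\<close>
      have "\<pi> x m = 0"
      proof (cases m)
        case (Cons w m')
        with xs xs' have "lt y w" "y \<in> A" by (auto simp: inc_lists_def)
        with D[OF that] have "w \<noteq> x" by auto
        then show ?thesis by (simp add: \<pi>_def Cons)
      qed (simp add: \<pi>_def)
      moreover have "frag_extend (\<pi> x) (frag_map ((#) y) (list_boundary m)) =
          (if y = x then list_boundary m else 0)"
        by (simp add: frag_extend_extend \<pi>_def frag_map_id frag_extend_eq_0)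
      ultimately show "frag_extend (\<pi> x) (list_boundary xs) = - boundary (\<pi> x xs)"
        by (simp add: xs' frag_extend_diff) (simp add: \<pi>_def)
    qed
    also have "\<dots> = - boundary (c x)"
      by (simp add: c_def frag_extend_extend frag_extend_fun_cmul[of "-1", simplified])
    finally show ?thesis by (simp add: z(2))
  qed
  have "\<exists>E. E \<in> chains_in (inc_lists lt {y \<in> A. lt x y}) l \<and> boundary E = c x" if "x \<in> D" "x \<in> A" for x
    using link[OF that] c_in[of x] c_bd[OF that(1)] False unfolding fills_def by auto
  then obtain E where E: "\<And>x. x \<in> D \<Longrightarrow> x \<in> A \<Longrightarrow> E x \<in> chains_in (inc_lists lt {y \<in> A. lt x y}) l"
    "\<And>x. x \<in> D \<Longrightarrow> x \<in> A \<Longrightarrow> boundary (E x) = c x"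
    by metis
  \<comment> \<open>Only finitely many elements of \<open>D\<close> are heads in \<open>z\<close>,
    which keeps the correction a finite sum.\<close>
  define D0 where "D0 = D \<inter> A \<inter> hd ` Poly_Mapping.keys z"
  have fin: "finite D0" by (simp add: D0_def)
  define e where "e = - (\<Sum>x\<in>D0. frag_map ((#) x) (E x))"
  have e_in: "e \<in> chains_in (inc_lists lt A) (Suc l)"
    unfolding e_def
  proof (intro chains_in_minus chains_in_sum)
    fix x assume "x \<in> D0"
    then have x: "x \<in> D" "x \<in> A" by (auto simp: D0_def)
    show "frag_map ((#) x) (E x) \<in> chains_in (inc_lists lt A) (Suc l)"
      by (rule chains_in_extend[OF E(1)[OF x]]) (use x in \<open>auto simp: inc_lists_def\<close>)
  qed
  have "boundary e = (\<Sum>x\<in>D0. frag_map ((#) x) (c x)) - (\<Sum>x\<in>D0. E x)"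
  proof -
    have "boundary e = - (\<Sum>x\<in>D0. E x - frag_map ((#) x) (c x))"
      unfolding e_def frag_extend_minus frag_extend_sum[OF fin] o_def boundary_Cons
      using E(2) by (auto simp: D0_def intro!: sum.cong)
    then show ?thesis by (simp add: sum_subtractf)
  qed
  moreover have "z - (\<Sum>x\<in>D0. frag_map ((#) x) (c x)) \<in> chains_in (inc_lists lt (A - D)) l"
  proof -
    have "z - (\<Sum>x\<in>D0. frag_map ((#) x) (c x)) =
        frag_extend (\<lambda>xs. frag_of xs - (\<Sum>x\<in>D0. frag_map ((#) x) (\<pi> x xs))) z"
      using fin by (simp add: c_def frag_extend_fun_diff frag_map_id frag_extend_fun_sum frag_extend_extend)
    also have "\<dots> \<in> chains_in (inc_lists lt (A - D)) l"
    proof -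
      have "frag_of xs - (\<Sum>x\<in>D0. frag_map ((#) x) (\<pi> x xs)) \<in> chains_in (inc_lists lt (A - D)) l"
        if "xs \<in> Poly_Mapping.keys z" for xs
      proof -
        have xs: "xs \<in> inc_lists lt A" "length xs = l" using that z(1) by (auto simp: chains_in_def)
        then obtain y m where xs': "xs = y # m" using False by (cases xs) auto
        have eq: "(\<Sum>x\<in>D0. frag_map ((#) x) (\<pi> x xs)) = (if y \<in> D0 then frag_of xs else 0)"
          using fin by (simp add: xs' \<pi>_def if_distrib[of "frag_extend _"] sum.delta' cong: if_cong)
        show ?thesis
        proof (cases "y \<in> D")
          case True
          then have "y \<in> D0"
            using that xs xs' by (force simp: D0_def inc_lists_def)
          then show ?thesis by (simp add: eq)
        next
          case False
          then have "y \<notin> D0" by (simp add: D0_def)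
          moreover have "xs \<in> inc_lists lt (A - D)"
            using xs xs' False D by (auto simp: inc_lists_def)
          ultimately show ?thesis using xs by (simp add: eq)
        qed
      qed
      then show ?thesis
        using keys_frag_extend[of "\<lambda>xs. frag_of xs - (\<Sum>x\<in>D0. frag_map ((#) x) (\<pi> x xs))" z]
        unfolding chains_in_def by blast
    qed
    finally show ?thesis .
  qed
  moreover have "(\<Sum>x\<in>D0. E x) \<in> chains_in (inc_lists lt (A - D)) l"
  proof (intro chains_in_sum)
    fix x assume "x \<in> D0"
    then have x: "x \<in> D" "x \<in> A" by (auto simp: D0_def)
    show "E x \<in> chains_in (inc_lists lt (A - D)) l"
      by (rule chains_in_mono[OF E(1)[OF x]]) (use x D in \<open>auto simp: inc_lists_def\<close>)
  qed
  ultimately show thesis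
    using that[of "z - (\<Sum>x\<in>D0. frag_map ((#) x) (c x)) + (\<Sum>x\<in>D0. E x)" e] e_in
    by (auto intro: chains_in_add)
qed

section \<open>Comparison of posets through principal down-sets\<close>

lemma fills_down:
  assumes trans: "\<And>x y z. x \<in> A \<Longrightarrow> y \<in> A \<Longrightarrow> z \<in> A \<Longrightarrow> lt x y \<Longrightarrow> lt y z \<Longrightarrow> lt x z"
    and irrefl: "\<And>x. x \<in> A \<Longrightarrow> \<not> lt x x" and a: "a \<in> A"
  shows "fills (inc_lists lt {x \<in> A. lt x a \<or> x = a}) l"
proof (rule fills_top)
  show "\<not> lt a x" if "x \<in> {x \<in> A. lt x a \<or> x = a}" for x
    using that trans[of a x a] irrefl a by auto
qed (use a in auto)

lemma downset_mono:
  assumes trans: "\<And>x y z. x \<in> A \<Longrightarrow> y \<in> A \<Longrightarrow> z \<in> A \<Longrightarrow> lt x y \<Longrightarrow> lt y z \<Longrightarrow> lt x z"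
    and "a \<in> A" "b \<in> A" "lt a b \<or> a = b" "\<And>x. x \<in> S \<Longrightarrow> f x \<in> A"
  shows "{x \<in> S. lt (f x) a \<or> f x = a} \<subseteq> {x \<in> S. lt (f x) b \<or> f x = b}"
proof clarify
  fix x assume x: "x \<in> S" "lt (f x) a \<or> f x = a" "f x \<noteq> b"
  then show "lt (f x) b"
    using trans[OF assms(5)[OF x(1)] assms(2,3)] assms(4) by auto
qed

lemma inc_lists_le_last:
  assumes "xs \<in> inc_lists lt A" "x \<in> set xs"
  shows "lt x (last xs) \<or> x = last xs"
  using assms by (induction xs rule: rev_induct) (auto simp: inc_lists_def sorted_wrt_append)

lemma inc_lists_last_face:
  assumes "xs @ x # ys \<in> inc_lists lt A" "xs @ ys \<noteq> []"
  shows "lt (last (xs @ ys)) (last (xs @ x # ys)) \<or> last (xs @ ys) = last (xs @ x # ys)"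
  using assms by (cases "ys = []") (auto simp: inc_lists_def sorted_wrt_append)

lemma inc_lists_last_in: "xs \<in> inc_lists lt A \<Longrightarrow> xs \<noteq> [] \<Longrightarrow> last xs \<in> A"
  by (auto simp: inc_lists_def)

text \<open>Converts bounds on acyclicity that are stated by rank into bounds by list length: ranks
  start at \<open>m\<close> and rise at every entry.\<close>

lemma inc_lists_rank:
  assumes "xs \<in> inc_lists lt A" "xs \<noteq> []"
    and "\<And>x y. x \<in> A \<Longrightarrow> y \<in> A \<Longrightarrow> lt x y \<Longrightarrow> rk x < (rk y :: nat)" "\<And>x. x \<in> A \<Longrightarrow> m \<le> rk x"
  shows "m + length xs \<le> Suc (rk (last xs))"
  using assms(1,2)
proof (induction xs rule: rev_induct)
  case (snoc x xs)
  show ?case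
  proof (cases "xs = []")
    case False
    then have "m + length xs \<le> Suc (rk (last xs))" "last xs \<in> A" "x \<in> A" "lt (last xs) x"
      using snoc by (auto simp: inc_lists_def sorted_wrt_append)
    with assms(3)[of "last xs" x] show ?thesis by simp
  qed (use snoc assms(4) in \<open>auto simp: inc_lists_def\<close>)
qed simp

text \<open>Since \<open>r x\<close> lies below \<open>x\<close>, the map \<open>r\<close> is
  homotopic to the identity. It may identify comparable elements and so need not preserve strict
  lists; hence it is replaced by a chain map \<open>G\<close>, and \<open>G\<close> and the identity
  are compared inside the down-set of the last entry, which is a cone.\<close>

lemma acyclic_below_retract:
  assumes A0: "A0 \<subseteq> A"
    and trans: "\<And>x y z. x \<in> A \<Longrightarrow> y \<in> A \<Longrightarrow> z \<in> A \<Longrightarrow> lt x y \<Longrightarrow> lt y z \<Longrightarrow> lt x z"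
    and irrefl: "\<And>x. x \<in> A \<Longrightarrow> \<not> lt x x"
    and r: "\<And>x. x \<in> A \<Longrightarrow> r x \<in> A0" "\<And>x. x \<in> A \<Longrightarrow> lt (r x) x \<or> r x = x"
    "\<And>x y. x \<in> A \<Longrightarrow> y \<in> A \<Longrightarrow> lt x y \<Longrightarrow> lt (r x) (r y) \<or> r x = r y"
    and acyc: "acyclic_below lt A0 k"
  shows "acyclic_below lt A k"
proof -
  let ?le = "\<lambda>x y. lt x y \<or> x = y"
  have rA: "r x \<in> A" if "x \<in> A" for x using r(1)[OF that] A0 by blast
  let ?K = "inc_lists lt A"
  \<comment> \<open>The empty list has no last entry; giving it the carrier \<open>{[]}\<close>
    makes the chain map preserve the augmentation.\<close>
  define \<Phi> where "\<Phi> xs = (if xs = [] then {[]} else inc_lists lt {y \<in> A0. ?le y (r (last xs))})" for xs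
  define \<Psi> where "\<Psi> xs = (if xs = [] then {[]} else inc_lists lt {y \<in> A. ?le y (last xs)})" for xs
  have last_mono: "?le (last (xs @ ys)) (last (xs @ x # ys))" "last (xs @ ys) \<in> A" "last (xs @ x # ys) \<in> A"
    if "xs @ x # ys \<in> ?K" "xs @ ys \<noteq> []" for xs x ys
    using inc_lists_last_face[OF that] that
    by (cases "ys = []"; auto simp: inc_lists_def subset_iff)+
  obtain G where G: "G [] = frag_of []"
    "\<And>xs. xs \<in> ?K \<Longrightarrow> G xs \<in> chains_in (\<Phi> xs) (length xs)"
    "\<And>xs. xs \<in> ?K \<Longrightarrow> boundary (G xs) = frag_extend G (list_boundary xs)"
  proof (rule carrier_chain_map[of ?K \<Phi>])
    fix xs x ys assume *: "xs @ x # ys \<in> ?K"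
    show "\<Phi> (xs @ ys) \<subseteq> \<Phi> (xs @ x # ys)"
    proof (cases "xs @ ys = []")
      case False
      note l = last_mono[OF * False]
      have *: "?le (r (last (xs @ ys))) (r (last (xs @ x # ys)))" using r(3)[OF l(2,3)] l(1) by auto
      have "inc_lists lt {y \<in> A0. ?le y (r (last (xs @ ys)))} \<subseteq> inc_lists lt {y \<in> A0. ?le y (r (last (xs @ x # ys)))}"
        by (rule inc_lists_mono, rule downset_mono[where A = A and f = "\<lambda>x. x"], fact trans)
          (use rA[OF l(2)] rA[OF l(3)] * A0 in auto)
      moreover have "xs @ x # ys \<noteq> []" by simp
      ultimately show ?thesis by (simp only: \<Phi>_def False if_False)
    qed (auto simp: \<Phi>_def inc_lists_def)
  next
    fix xs assume "xs \<in> ?K" "xs \<noteq> []"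
    then have "r (last xs) \<in> A0" using r(1)[OF inc_lists_last_in] by blast
    then have "fills (inc_lists lt {y \<in> A0. ?le y (r (last xs))}) (length xs - 1)"
      using A0 by (intro fills_down) (auto intro: trans simp: irrefl subset_iff)
    with \<open>xs \<noteq> []\<close> show "fills (\<Phi> xs) (length xs - 1)" by (simp add: \<Phi>_def)
  qed (auto simp: \<Phi>_def face_closed_inc_lists)
  have \<Phi>\<Psi>: "\<Phi> xs \<subseteq> \<Psi> xs" if "xs \<in> ?K" for xs
  proof (cases "xs = []")
    case False
    then have l: "last xs \<in> A" using inc_lists_last_in that by blast
    have "{y \<in> A0. ?le y (r (last xs))} \<subseteq> {y \<in> A0. ?le y (last xs)}"
      by (rule downset_mono[where A = A and f = "\<lambda>x. x"], fact trans) (use rA[OF l] l r(2)[OF l] A0 in auto)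
    then have "{y \<in> A0. ?le y (r (last xs))} \<subseteq> {y \<in> A. ?le y (last xs)}"
      using A0 by auto
    with False show ?thesis by (simp add: \<Phi>_def \<Psi>_def inc_lists_mono)
  qed (simp add: \<Phi>_def \<Psi>_def)
  obtain h where h: "h [] = 0"
    "\<And>xs. xs \<in> ?K \<Longrightarrow> h xs \<in> chains_in (\<Psi> xs) (Suc (length xs))"
    "\<And>xs. xs \<in> ?K \<Longrightarrow> boundary (h xs) = G xs - frag_of xs - frag_extend h (list_boundary xs)"
  proof (rule carrier_homotopy[of ?K \<Psi> G frag_of])
    fix xs x ys assume *: "xs @ x # ys \<in> ?K"
    show "\<Psi> (xs @ ys) \<subseteq> \<Psi> (xs @ x # ys)"
    proof (cases "xs @ ys = []")
      case False
      note l = last_mono[OF * False]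
      have "inc_lists lt {y \<in> A. ?le y (last (xs @ ys))} \<subseteq> inc_lists lt {y \<in> A. ?le y (last (xs @ x # ys))}"
        by (rule inc_lists_mono, rule downset_mono[where A = A and f = "\<lambda>x. x"], fact trans) (use l in auto)
      moreover have "xs @ x # ys \<noteq> []" by simp
      ultimately show ?thesis by (simp only: \<Psi>_def False if_False)
    qed (auto simp: \<Psi>_def inc_lists_def)
  next
    fix xs assume xs: "xs \<in> ?K" "xs \<noteq> []"
    have "fills (inc_lists lt {y \<in> A. ?le y (last xs)}) (length xs)"
      by (intro fills_down) (fact trans, fact irrefl, rule inc_lists_last_in[OF xs])
    then show "fills (\<Psi> xs) (length xs)" using xs(2) by (simp add: \<Psi>_def)
  next
    fix xs assume *: "xs \<in> ?K"
    show "frag_of xs \<in> chains_in (\<Psi> xs) (length xs)"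
      using inc_lists_le_last[OF *] * by (auto simp: \<Psi>_def inc_lists_def)
    show "G xs \<in> chains_in (\<Psi> xs) (length xs)"
      using chains_in_mono[OF G(2) \<Phi>\<Psi>] * by blast
  qed (auto simp: G face_closed_inc_lists frag_map_id)
  show ?thesis
    unfolding acyclic_below_def fills_def
  proof (intro allI impI ballI)
    fix l c assume l: "l < k" and c: "c \<in> chains_in ?K l" and bd: "boundary c = 0"
    have sub: "\<Phi> xs \<subseteq> inc_lists lt A0" "\<Psi> xs \<subseteq> ?K" for xs
      by (auto simp: \<Phi>_def \<Psi>_def inc_lists_def)
    have "frag_extend G c \<in> chains_in (inc_lists lt A0) l"
      proof (rule chains_in_extend[OF c])
      show "G xs \<in> chains_in (inc_lists lt A0) (l)" if "xs \<in> ?K" "length xs = l" for xs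
        using chains_in_mono[OF G(2)[OF that(1)] sub(1)] that(2) by simp
    qed
    moreover have "boundary (frag_extend G c) = 0"
      using boundary_extend[OF G(3) c] bd by simp
    ultimately obtain e where e: "e \<in> chains_in (inc_lists lt A0) (Suc l)" "boundary e = frag_extend G c"
      using acyc l unfolding acyclic_below_def fills_def by blast
    have "frag_extend h c \<in> chains_in ?K (Suc l)"
      proof (rule chains_in_extend[OF c])
      show "h xs \<in> chains_in (?K) (Suc l)" if "xs \<in> ?K" "length xs = l" for xs
        using chains_in_mono[OF h(2)[OF that(1)] sub(2)] that(2) by simp
    qed
    with e(1) have "e - frag_extend h c \<in> chains_in ?K (Suc l)"
      by (meson A0 chains_in_diff chains_in_mono inc_lists_mono)
    moreover have "boundary (e - frag_extend h c) = c"
      using boundary_homotopy[OF h(3) c] bd e(2) by (simp add: frag_extend_diff frag_map_id)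
    ultimately show "\<exists>e\<in>chains_in ?K (Suc l). boundary e = c" by blast
  qed
qed

text \<open>A form of Quillen's fibre lemma. A cycle of lists of length \<open>l < k\<close> is first pushed to ranks above
  \<open>k - l\<close>; there the fibres are acyclic in a range large enough for comparing it with its image in
  \<open>Y\<close>.\<close>

lemma acyclic_below_fibres:
  fixes rk :: "'x \<Rightarrow> nat" and rk' :: "'y \<Rightarrow> nat"
  assumes rk: "\<And>x y. x \<in> X \<Longrightarrow> y \<in> X \<Longrightarrow> lt x y \<Longrightarrow> rk x < rk y"
    and rk': "\<And>x y. x \<in> Y \<Longrightarrow> y \<in> Y \<Longrightarrow> lt' x y \<Longrightarrow> rk' x < rk' y" "\<And>y. y \<in> Y \<Longrightarrow> 0 < rk' y"
    and trans: "\<And>x y z. x \<in> Y \<Longrightarrow> y \<in> Y \<Longrightarrow> z \<in> Y \<Longrightarrow> lt' x y \<Longrightarrow> lt' y z \<Longrightarrow> lt' x z"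
    and g: "\<And>x. x \<in> X \<Longrightarrow> g x \<in> Y" "\<And>x y. x \<in> X \<Longrightarrow> y \<in> X \<Longrightarrow> lt x y \<Longrightarrow> lt' (g x) (g y)"
    and rkg: "\<And>x. x \<in> X \<Longrightarrow> rk' (g x) = rk x"
    and up: "\<And>x. x \<in> X \<Longrightarrow> acyclic_below lt {y \<in> X. lt x y} (k - rk x)"
    and fibre: "\<And>y. y \<in> Y \<Longrightarrow> acyclic_below lt {x \<in> X. lt' (g x) y \<or> g x = y} (rk' y)"
    and Y: "acyclic_below lt' Y k"
  shows "acyclic_below lt X k"
  unfolding acyclic_below_def fills_def
proof (intro allI impI ballI)
  fix l z assume l: "l < k" and z: "z \<in> chains_in (inc_lists lt X) l" "boundary z = 0"
  let ?le = "\<lambda>x y. lt' x y \<or> x = y"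
  let ?X = "\<lambda>j. {x \<in> X. j < rk x}"
  \<comment> \<open>The elements of rank \<open>j + 1\<close> are minimal once ranks up to
    \<open>j\<close> are cleared. Their upper links are acyclic below \<open>k - (j + 1)\<close>,
    and this covers the link cycles, of length \<open>l - 1\<close>, exactly while
    \<open>j + 1\<close> is at most \<open>k - l\<close>.\<close>
  have "\<exists>z' e. z' \<in> chains_in (inc_lists lt (?X j)) l \<and> e \<in> chains_in (inc_lists lt X) (Suc l) \<and>
      boundary e = z - z'" if "j \<le> k - l" for j
    using that
  proof (induction j)
    case 0
    have "0 < rk x" if "x \<in> X" for x using rk'(2)[OF g(1)[OF that]] rkg[OF that] by simp
    then have "?X 0 = X" by auto
    with z show ?case by (intro exI[of _ z] exI[of _ 0]) simp
  next
    case (Suc j)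
    then obtain z' e where z': "z' \<in> chains_in (inc_lists lt (?X j)) l"
      and e: "e \<in> chains_in (inc_lists lt X) (Suc l)" "boundary e = z - z'" by auto
    have "boundary (boundary e) = boundary z - boundary z'" by (simp only: e(2) frag_extend_diff)
    then have bz': "boundary z' = 0" by (simp add: boundary_boundary z(2))
    obtain z'' e' where z'': "z'' \<in> chains_in (inc_lists lt (?X j - {x \<in> X. rk x = Suc j})) l"
      and e': "e' \<in> chains_in (inc_lists lt (?X j)) (Suc l)" "boundary e' = z' - z''"
    proof (rule push_off_minimal[OF _ _ z' bz', of "{x \<in> X. rk x = Suc j}"])
      show "\<not> lt y x" if "x \<in> {x \<in> X. rk x = Suc j}" "y \<in> ?X j" for x y
        using that rk[of y x] by auto
      show "fills (inc_lists lt {y \<in> ?X j. lt x y}) (l - 1)"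
        if "x \<in> {x \<in> X. rk x = Suc j}" "x \<in> ?X j" "0 < l" for x
      proof -
        have "{y \<in> ?X j. lt x y} = {y \<in> X. lt x y}" using rk[of x] that by force
        moreover have "l - 1 < k - rk x" using that Suc.prems l by auto
        ultimately show ?thesis using up[of x] that by (simp add: acyclic_below_def)
      qed
    qed
    have "?X j - {x \<in> X. rk x = Suc j} = ?X (Suc j)" by auto
    moreover have "e + e' \<in> chains_in (inc_lists lt X) (Suc l)"
      by (rule chains_in_add[OF e(1) chains_in_mono[OF e'(1)]]) (auto simp: inc_lists_def)
    ultimately show ?case
      using z'' e(2) e'(2) by (intro exI[of _ z''] exI[of _ "e + e'"]) (simp add: frag_extend_add)
  qed
  from this[of "k - l"] obtain z' e where z': "z' \<in> chains_in (inc_lists lt (?X (k - l))) l"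
    and e: "e \<in> chains_in (inc_lists lt X) (Suc l)" "boundary e = z - z'" by auto
  have "boundary (boundary e) = boundary z - boundary z'" by (simp only: e(2) frag_extend_diff)
  then have bz': "boundary z' = 0" by (simp add: boundary_boundary z(2))
  define \<Phi> where "\<Phi> ys = (if ys = [] then {[]} else inc_lists lt {x \<in> X. ?le (g x) (last ys)})" for ys
  have \<Phi>_mono: "\<Phi> (xs @ ys) \<subseteq> \<Phi> (xs @ x # ys)" if "xs @ x # ys \<in> inc_lists lt' Y" for xs x ys
  proof (cases "xs @ ys = []")
    case False
    have l: "last (xs @ ys) \<in> Y" "last (xs @ x # ys) \<in> Y"
      using that False by (cases "ys = []"; auto simp: inc_lists_def subset_iff)+
    have "inc_lists lt {u \<in> X. ?le (g u) (last (xs @ ys))} \<subseteq> inc_lists lt {u \<in> X. ?le (g u) (last (xs @ x # ys))}"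
      by (intro inc_lists_mono downset_mono[of Y lt', OF trans l inc_lists_last_face[OF that False] g(1)]) auto
    moreover have "xs @ x # ys \<noteq> []" by simp
    ultimately show ?thesis by (simp only: \<Phi>_def False if_False)
  qed (auto simp: \<Phi>_def inc_lists_def)
  have sub: "\<Phi> ys \<subseteq> inc_lists lt X" for ys
    by (auto simp: \<Phi>_def inc_lists_def)
  obtain G where G: "G [] = frag_of []"
    "\<And>xs. xs \<in> inc_lists lt' Y \<Longrightarrow> G xs \<in> chains_in (\<Phi> xs) (length xs)"
    "\<And>xs. xs \<in> inc_lists lt' Y \<Longrightarrow> boundary (G xs) = frag_extend G (list_boundary xs)"
  proof (rule carrier_chain_map[of "inc_lists lt' Y" \<Phi>])
    fix ys assume ys: "ys \<in> inc_lists lt' Y" "ys \<noteq> []"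
    have "1 + length ys \<le> Suc (rk' (last ys))"
      by (rule inc_lists_rank[OF ys rk'(1)]) (use rk'(2) in \<open>auto simp: Suc_le_eq\<close>)
    then have "length ys - 1 < rk' (last ys)" using ys(2) by (cases ys) auto
    then show "fills (\<Phi> ys) (length ys - 1)"
      using fibre[OF inc_lists_last_in[OF ys]] ys(2) by (simp add: \<Phi>_def acyclic_below_def)
  qed (use \<Phi>_mono in \<open>auto simp: \<Phi>_def face_closed_inc_lists\<close>)
  define K where "K = {xs \<in> inc_lists lt (?X (k - l)). length xs \<le> l}"
  have K: "face_closed K"
    using face_closed_inc_lists[of lt "?X (k - l)"] by (auto simp: K_def face_closed_def)
  have z'K: "z' \<in> chains_in K l" using z' by (auto simp: K_def chains_in_def)
  have map_g: "map g xs \<in> inc_lists lt' Y" if "xs \<in> inc_lists lt X" for xs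
    by (rule inc_lists_map[OF that]) (use g in auto)
  have KX: "xs \<in> inc_lists lt X" if "xs \<in> K" for xs
    using that by (auto simp: K_def inc_lists_def)
  obtain h where h: "h [] = 0"
    "\<And>xs. xs \<in> K \<Longrightarrow> h xs \<in> chains_in (\<Phi> (map g xs)) (Suc (length xs))"
    "\<And>xs. xs \<in> K \<Longrightarrow> boundary (h xs) = G (map g xs) - frag_of xs - frag_extend h (list_boundary xs)"
  proof (rule carrier_homotopy[of K "\<lambda>xs. \<Phi> (map g xs)" "\<lambda>xs. G (map g xs)" frag_of])
    fix xs x ys assume "xs @ x # ys \<in> K"
    then show "\<Phi> (map g (xs @ ys)) \<subseteq> \<Phi> (map g (xs @ x # ys))"
      using \<Phi>_mono[of "map g xs" "g x" "map g ys"] map_g[OF KX] by fastforce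
  next
    fix xs assume xs: "xs \<in> K" "xs \<noteq> []"
    then have xs': "xs \<in> inc_lists lt (?X (k - l))" "length xs \<le> l" by (auto simp: K_def)
    \<comment> \<open>As \<open>k - l\<close> is positive, the last entry has rank above
      \<open>length xs\<close>. This is one more than \<open>G\<close> required, and is what the
      homotopy needs; the pushing was done for this.\<close>
    have "Suc (k - l) + length xs \<le> Suc (rk (last xs))"
      by (rule inc_lists_rank[OF xs'(1) xs(2)]) (use rk in auto)
    then have "length xs < rk (last xs)" using l by linarith
    moreover have "last xs \<in> X" using inc_lists_last_in[OF KX] xs by blast
    ultimately show "fills (\<Phi> (map g xs)) (length xs)"
      using fibre[OF g(1)] rkg xs(2) by (simp add: \<Phi>_def acyclic_below_def last_map)
  next
    fix xs assume xs: "xs \<in> K"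
    show "G (map g xs) \<in> chains_in (\<Phi> (map g xs)) (length xs)"
      using G(2)[OF map_g[OF KX[OF xs]]] by simp
    show "boundary (G (map g xs)) = frag_extend (\<lambda>xs. G (map g xs)) (list_boundary xs)"
      using G(3)[OF map_g[OF KX[OF xs]]] by (simp add: list_boundary_map frag_extend_extend)
    show "frag_of xs \<in> chains_in (\<Phi> (map g xs)) (length xs)"
    proof (cases "xs = []")
      case False
      have "?le (g x) (g (last xs))" if "x \<in> set xs" for x
      proof -
        have "x \<in> X" "last xs \<in> X" using that KX[OF xs] False by (auto simp: inc_lists_def)
        then show ?thesis using inc_lists_le_last[OF KX[OF xs] that] g(2) by auto
      qed
      with False KX[OF xs] show ?thesis by (auto simp: \<Phi>_def inc_lists_def last_map)
    qed (simp add: \<Phi>_def)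
  qed (use K G(1) in \<open>auto simp: frag_map_id\<close>)
  let ?w = "frag_map (map g) z'"
  have z'X: "z' \<in> chains_in (inc_lists lt X) l"
    by (rule chains_in_mono[OF z'K]) (use KX in auto)
  have "?w \<in> chains_in (inc_lists lt' Y) l" by (rule chains_in_map[OF z'X map_g])
  moreover have "boundary ?w = 0" by (simp add: boundary_map bz')
  ultimately obtain c where c: "c \<in> chains_in (inc_lists lt' Y) (Suc l)" "boundary c = ?w"
    using Y l unfolding acyclic_below_def fills_def by blast
  have "frag_extend G c \<in> chains_in (inc_lists lt X) (Suc l)"
    proof (rule chains_in_extend[OF c(1)])
      show "G xs \<in> chains_in (inc_lists lt X) (Suc l)" if "xs \<in> inc_lists lt' Y" "length xs = Suc l" for xs
        using chains_in_mono[OF G(2)[OF that(1)] sub] that(2) by simp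
    qed
  moreover have "frag_extend h z' \<in> chains_in (inc_lists lt X) (Suc l)"
    proof (rule chains_in_extend[OF z'K])
      show "h xs \<in> chains_in (inc_lists lt X) (Suc l)" if "xs \<in> K" "length xs = l" for xs
        using chains_in_mono[OF h(2)[OF that(1)] sub] that(2) by simp
    qed
  \<comment> \<open>The three boundaries are the \<open>G\<close>-image of \<open>g z'\<close>, that
    image minus \<open>z'\<close>, and \<open>z - z'\<close>; combined they leave
    \<open>z\<close>.\<close>
  ultimately have "frag_extend G c - frag_extend h z' + e \<in> chains_in (inc_lists lt X) (Suc l)"
    using e(1) by (intro chains_in_add chains_in_diff)
  moreover have "boundary (frag_extend G c - frag_extend h z' + e) = z"
    using boundary_extend[OF G(3) c(1)] boundary_homotopy[OF h(3) z'K] bz' c(2) e(2)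
    by (simp add: frag_extend_diff frag_extend_add frag_map_id frag_extend_extend)
  ultimately show "\<exists>e\<in>chains_in (inc_lists lt X) (Suc l). boundary e = z" by blast
qed

section \<open>Lifting chains along a map with acyclic fibres\<close>

text \<open>The vertices chosen for the corners of a singular simplex may repeat and come in any order.\<close>

definition chain_lists :: "('x \<Rightarrow> 'x \<Rightarrow> bool) \<Rightarrow> 'x set \<Rightarrow> 'x list set" where
  "chain_lists leq A = {xs. set xs \<subseteq> A \<and> Complete_Partial_Order.chain leq (set xs)}"

lemma face_closed_chain_lists: "face_closed (chain_lists leq A)"
  by (auto simp: face_closed_def chain_lists_def Complete_Partial_Order.chain_def)

lemma fills_cone: "(\<And>xs. xs \<in> K \<Longrightarrow> a # xs \<in> K) \<Longrightarrow> fills K l"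
  unfolding fills_def
proof (intro ballI impI)
  fix c assume *: "\<And>xs. xs \<in> K \<Longrightarrow> a # xs \<in> K" and "c \<in> chains_in K l" "boundary c = 0"
  then show "\<exists>e\<in>chains_in K (Suc l). boundary e = c"
    by (intro bexI[of _ "frag_map ((#) a) c"]) (auto simp: boundary_Cons intro!: chains_in_extend)
qed

lemma finite_chain_has_max:
  assumes "finite S" "S \<noteq> {}" "Complete_Partial_Order.chain leq S"
    and "\<And>x y z. x \<in> S \<Longrightarrow> y \<in> S \<Longrightarrow> z \<in> S \<Longrightarrow> leq x y \<Longrightarrow> leq y z \<Longrightarrow> leq x z"
  shows "\<exists>m\<in>S. \<forall>x\<in>S. leq x m"
  using assms
proof (induction S rule: finite_ne_induct)
  case (singleton x)
  from singleton(1) show ?case by (simp add: Complete_Partial_Order.chain_def)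
next
  case (insert x S)
  have "Complete_Partial_Order.chain leq S"
    using insert.prems(1) by (auto simp: Complete_Partial_Order.chain_def)
  with insert obtain m where m: "m \<in> S" "\<forall>y\<in>S. leq y m" by blast
  have refl: "leq x x" and "leq x m \<or> leq m x"
    using insert.prems(1) m(1) by (auto simp: Complete_Partial_Order.chain_def)
  then show ?case using m insert.prems(2) refl by blast
qed

text \<open>The fibres are used only to construct \<open>P\<close>. The homotopy \<open>h\<close>
  comes for free: both \<open>ys\<close> and the projection of \<open>P ys\<close> lie in the
  down-closure of \<open>ys\<close>, which is a cone over the largest entry.\<close>

lemma lift_chains:
  fixes rk :: "'y \<Rightarrow> nat"
  assumes reflY: "\<And>y. y \<in> Y \<Longrightarrow> leq' y y"
    and antisymY: "\<And>x y. x \<in> Y \<Longrightarrow> y \<in> Y \<Longrightarrow> leq' x y \<Longrightarrow> leq' y x \<Longrightarrow> x = y"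
    and transY: "\<And>x y z. x \<in> Y \<Longrightarrow> y \<in> Y \<Longrightarrow> z \<in> Y \<Longrightarrow> leq' x y \<Longrightarrow> leq' y z \<Longrightarrow> leq' x z"
    and reflX: "\<And>x. x \<in> X \<Longrightarrow> leq x x"
    and f: "\<And>x. x \<in> X \<Longrightarrow> f x \<in> Y" "\<And>x y. x \<in> X \<Longrightarrow> y \<in> X \<Longrightarrow> leq x y \<Longrightarrow> leq' (f x) (f y)"
    and rk: "\<And>x y. x \<in> Y \<Longrightarrow> y \<in> Y \<Longrightarrow> leq' x y \<Longrightarrow> x \<noteq> y \<Longrightarrow> rk x < rk y" "\<And>y. y \<in> Y \<Longrightarrow> 0 < rk y"
    and fibre: "\<And>y. y \<in> Y \<Longrightarrow> acyclic_below (\<lambda>x y. leq x y \<and> x \<noteq> y) {x \<in> X. leq' (f x) y} (rk y)"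
  obtains P h where "P [] = frag_of []"
    "\<And>ys. ys \<in> chain_lists leq' Y \<Longrightarrow> P ys \<in> chains_in (chain_lists leq X) (length ys)"
    "\<And>ys. ys \<in> chain_lists leq' Y \<Longrightarrow> boundary (P ys) = frag_extend P (list_boundary ys)"
    "h [] = 0"
    "\<And>ys. ys \<in> chain_lists leq' Y \<Longrightarrow> h ys \<in> chains_in (chain_lists leq' Y) (Suc (length ys))"
    "\<And>ys. ys \<in> chain_lists leq' Y \<Longrightarrow>
      boundary (h ys) = frag_of ys - frag_map (map f) (P ys) - frag_extend h (list_boundary ys)"
proof -
  let ?lt = "\<lambda>x y. leq x y \<and> x \<noteq> y" and ?lt' = "\<lambda>x y. leq' x y \<and> x \<noteq> y"
  let ?K = "chain_lists leq' Y"
  have max: "\<exists>m\<in>set ys. \<forall>y\<in>set ys. leq' y m" if "ys \<in> ?K" "ys \<noteq> []" for ys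
  proof (rule finite_chain_has_max)
    have sub: "y \<in> Y" if "y \<in> set ys" for y using that \<open>ys \<in> ?K\<close> by (auto simp: chain_lists_def)
    show "leq' x z" if "x \<in> set ys" "y \<in> set ys" "z \<in> set ys" "leq' x y" "leq' y z" for x y z
      by (rule transY[OF sub sub sub]) (use that in auto)
  qed (use that in \<open>auto simp: chain_lists_def\<close>)
  \<comment> \<open>Normalisation: a list with repetitions in any order is replaced by strictly
    increasing lists on the same vertices, which form a cone because a finite chain has a
    maximum.\<close>
  obtain N where N: "N [] = frag_of []"
    "\<And>ys. ys \<in> ?K \<Longrightarrow> N ys \<in> chains_in (inc_lists ?lt' (set ys)) (length ys)"
    "\<And>ys. ys \<in> ?K \<Longrightarrow> boundary (N ys) = frag_extend N (list_boundary ys)"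
  proof (rule carrier_chain_map[of ?K "\<lambda>ys. inc_lists ?lt' (set ys)"])
    fix ys assume ys: "ys \<in> ?K" "ys \<noteq> []"
    obtain m where m: "m \<in> set ys" "\<forall>y\<in>set ys. leq' y m" using max[OF ys] by blast
    show "fills (inc_lists ?lt' (set ys)) (length ys - 1)"
    proof (rule fills_top[of m])
      show "\<not> ?lt' m y" if "y \<in> set ys" for y
        using that m antisymY[of m y] ys by (auto simp: chain_lists_def)
    qed (use m in auto)
  qed (auto simp: face_closed_chain_lists inc_lists_def)
  define \<Phi> where "\<Phi> ys = (if ys = [] then {[]} else inc_lists ?lt {x \<in> X. leq' (f x) (last ys)})" for ys
  obtain G where G: "G [] = frag_of []"
    "\<And>xs. xs \<in> inc_lists ?lt' Y \<Longrightarrow> G xs \<in> chains_in (\<Phi> xs) (length xs)"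
    "\<And>xs. xs \<in> inc_lists ?lt' Y \<Longrightarrow> boundary (G xs) = frag_extend G (list_boundary xs)"
  proof (rule carrier_chain_map[of "inc_lists ?lt' Y" \<Phi>])
    fix xs x ys assume *: "xs @ x # ys \<in> inc_lists ?lt' Y"
    show "\<Phi> (xs @ ys) \<subseteq> \<Phi> (xs @ x # ys)"
    proof (cases "xs @ ys = []")
      case False
      have "last (xs @ ys) \<in> Y" "last (xs @ x # ys) \<in> Y"
        using * False by (cases "ys = []"; auto simp: inc_lists_def subset_iff)+
      then have "inc_lists ?lt {u \<in> X. leq' (f u) (last (xs @ ys))} \<subseteq> inc_lists ?lt {u \<in> X. leq' (f u) (last (xs @ x # ys))}"
        using inc_lists_last_face[OF * False] f(1) transY[of "f _" "last (xs @ ys)" "last (xs @ x # ys)"]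
        by (intro inc_lists_mono) auto
      moreover have "xs @ x # ys \<noteq> []" by simp
      ultimately show ?thesis by (simp only: \<Phi>_def False if_False)
    qed (auto simp: \<Phi>_def inc_lists_def)
  next
    fix ys assume ys: "ys \<in> inc_lists ?lt' Y" "ys \<noteq> []"
    \<comment> \<open>Ranks start at 1, so a strict list ending in \<open>y\<close> has at most
      \<open>rk y\<close> entries; the fibre over \<open>y\<close> is acyclic just as far as the
      chain map requires.\<close>
    have "1 + length ys \<le> Suc (rk (last ys))"
      by (rule inc_lists_rank[OF ys]) (use rk in \<open>auto simp: Suc_le_eq\<close>)
    then have "length ys - 1 < rk (last ys)" using ys(2) by (cases ys) auto
    then show "fills (\<Phi> ys) (length ys - 1)"
      using fibre[OF inc_lists_last_in[OF ys]] ys(2) by (simp add: \<Phi>_def acyclic_below_def)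
  qed (auto simp: \<Phi>_def face_closed_inc_lists)
  \<comment> \<open>The carrier for the homotopy has to contain \<open>f\<close> of every vertex of
    \<open>P ys\<close>; such vertices lie over elements below some entry of
    \<open>ys\<close>.\<close>
  define D where "D ys = {y \<in> Y. \<exists>m\<in>set ys. leq' y m}" for ys
  define P where "P ys = frag_extend G (N ys)" for ys
  have inc_sub: "xs \<in> inc_lists ?lt' Y" if "xs \<in> inc_lists ?lt' (set ys)" "ys \<in> ?K" for xs ys
    using that by (auto simp: inc_lists_def chain_lists_def)
  have inc_chain: "xs \<in> chain_lists leq A" if "xs \<in> inc_lists ?lt A" "A \<subseteq> X" for xs A
  proof -
    have "Complete_Partial_Order.chain leq (set xs)" if "sorted_wrt ?lt xs" "set xs \<subseteq> X"
      using that by (induction xs) (auto simp: Complete_Partial_Order.chain_def reflX)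
    with that show ?thesis by (auto simp: inc_lists_def chain_lists_def)
  qed
  have P_in: "P ys \<in> chains_in (chain_lists leq {x \<in> X. f x \<in> D ys}) (length ys)" if ys: "ys \<in> ?K" for ys
    unfolding P_def
  proof (rule chains_in_extend[OF N(2)[OF ys]])
    fix xs assume xs: "xs \<in> inc_lists ?lt' (set ys)" "length xs = length ys"
    have "\<Phi> xs \<subseteq> chain_lists leq {x \<in> X. f x \<in> D ys}"
    proof (cases "xs = []")
      case False
      then have "last xs \<in> set ys" using xs by (auto simp: inc_lists_def)
      then have "inc_lists ?lt {x \<in> X. leq' (f x) (last xs)} \<subseteq> inc_lists ?lt {x \<in> X. f x \<in> D ys}"
        using f(1) by (intro inc_lists_mono) (auto simp: D_def)
      then show ?thesis using False inc_chain[of _ "{x \<in> X. f x \<in> D ys}"] by (auto simp: \<Phi>_def)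
    qed (simp add: \<Phi>_def chain_lists_def Complete_Partial_Order.chain_def)
    then show "G xs \<in> chains_in (chain_lists leq {x \<in> X. f x \<in> D ys}) (length ys)"
      using chains_in_mono[OF G(2)[OF inc_sub[OF xs(1) ys]]] xs(2) by simp
  qed
  have P_bd: "boundary (P ys) = frag_extend P (list_boundary ys)" if ys: "ys \<in> ?K" for ys
  proof -
    have "N ys \<in> chains_in (inc_lists ?lt' Y) (length ys)"
      by (rule chains_in_mono[OF N(2)[OF ys]]) (use inc_sub ys in blast)
    from boundary_extend[OF G(3) this] show ?thesis
      by (simp add: P_def[abs_def] N(3)[OF ys] frag_extend_extend)
  qed
  have P_Nil: "P [] = frag_of []" by (simp add: P_def N(1) G(1))
  have map_f: "map f xs \<in> chain_lists leq' (D ys)" if "xs \<in> chain_lists leq {x \<in> X. f x \<in> D ys}" for xs ys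
    using that f(2) by (auto simp: chain_lists_def Complete_Partial_Order.chain_def subset_iff) blast
  obtain h where h: "h [] = 0"
    "\<And>ys. ys \<in> ?K \<Longrightarrow> h ys \<in> chains_in (chain_lists leq' (D ys)) (Suc (length ys))"
    "\<And>ys. ys \<in> ?K \<Longrightarrow> boundary (h ys) = frag_of ys - frag_map (map f) (P ys) - frag_extend h (list_boundary ys)"
  proof (rule carrier_homotopy[of ?K "\<lambda>ys. chain_lists leq' (D ys)" frag_of "\<lambda>ys. frag_map (map f) (P ys)"])
    fix ys assume ys: "ys \<in> ?K" "ys \<noteq> []"
    obtain m where m: "m \<in> set ys" "\<forall>y\<in>set ys. leq' y m" using max[OF ys] by blast
    then have mY: "m \<in> Y" using ys by (auto simp: chain_lists_def)
    have top: "leq' y m" "y \<in> Y" if "y \<in> D ys" for y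
      using that m transY[OF _ _ mY] ys by (auto simp: D_def chain_lists_def)
    show "fills (chain_lists leq' (D ys)) (length ys)"
    proof (rule fills_cone[of _ m])
      fix xs assume "xs \<in> chain_lists leq' (D ys)"
      moreover have "m \<in> D ys" using m mY by (auto simp: D_def)
      ultimately show "m # xs \<in> chain_lists leq' (D ys)"
        using top by (auto simp: chain_lists_def Complete_Partial_Order.chain_def)
    qed
  next
    fix ys assume ys: "ys \<in> ?K"
    show "frag_of ys \<in> chains_in (chain_lists leq' (D ys)) (length ys)"
      using ys reflY by (auto simp: chain_lists_def D_def)
    show "frag_map (map f) (P ys) \<in> chains_in (chain_lists leq' (D ys)) (length ys)"
      by (rule chains_in_map[OF P_in[OF ys] map_f])
    show "boundary (frag_map (map f) (P ys)) = frag_extend (\<lambda>ys. frag_map (map f) (P ys)) (list_boundary ys)"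
      unfolding boundary_map P_bd[OF ys] by (simp add: frag_extend_extend)
  next
    show "chain_lists leq' (D (xs @ ys)) \<subseteq> chain_lists leq' (D (xs @ x # ys))" for xs x ys
      by (auto simp: chain_lists_def D_def)
  qed (simp_all add: face_closed_chain_lists frag_map_id P_Nil)
  show thesis
  proof (rule that[of P h])
    show "P [] = frag_of []" by (rule P_Nil)
    show "h [] = 0" by (rule h(1))
    fix ys assume ys: "ys \<in> ?K"
    show "boundary (P ys) = frag_extend P (list_boundary ys)" by (rule P_bd[OF ys])
    show "boundary (h ys) = frag_of ys - frag_map (map f) (P ys) - frag_extend h (list_boundary ys)"
      by (rule h(3)[OF ys])
    show "P ys \<in> chains_in (chain_lists leq X) (length ys)"
      by (rule chains_in_mono[OF P_in[OF ys]]) (auto simp: chain_lists_def)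
    show "h ys \<in> chains_in (chain_lists leq' Y) (Suc (length ys))"
      by (rule chains_in_mono[OF h(2)[OF ys]]) (auto simp: chain_lists_def D_def)
  qed
qed

section \<open>Modular lattices with a notion of good position\<close>

text \<open>In the lattice of summands of a module, two summands \<open>P\<close>, \<open>Q\<close> are in good position if \<open>P + Q\<close> is again
  a summand. The axioms are self-dual.\<close>

locale summand_lattice =
  fixes L :: "'l set" and le :: "'l \<Rightarrow> 'l \<Rightarrow> bool" (infix "\<preceq>" 50)
    and meet :: "'l \<Rightarrow> 'l \<Rightarrow> 'l" (infixl "\<^bold>\<and>" 70) and join :: "'l \<Rightarrow> 'l \<Rightarrow> 'l" (infixl "\<^bold>\<or>" 65)
    and rk :: "'l \<Rightarrow> int" and good :: "'l \<Rightarrow> 'l \<Rightarrow> bool"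
  assumes le_refl [simp]: "x \<in> L \<Longrightarrow> x \<preceq> x"
    and le_antisym: "x \<in> L \<Longrightarrow> y \<in> L \<Longrightarrow> x \<preceq> y \<Longrightarrow> y \<preceq> x \<Longrightarrow> x = y"
    and le_trans: "x \<in> L \<Longrightarrow> y \<in> L \<Longrightarrow> z \<in> L \<Longrightarrow> x \<preceq> y \<Longrightarrow> y \<preceq> z \<Longrightarrow> x \<preceq> z"
    and meet_in [simp]: "x \<in> L \<Longrightarrow> y \<in> L \<Longrightarrow> x \<^bold>\<and> y \<in> L"
    and join_in [simp]: "x \<in> L \<Longrightarrow> y \<in> L \<Longrightarrow> x \<^bold>\<or> y \<in> L"
    and meet_le1 [simp]: "x \<in> L \<Longrightarrow> y \<in> L \<Longrightarrow> x \<^bold>\<and> y \<preceq> x"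
    and meet_le2 [simp]: "x \<in> L \<Longrightarrow> y \<in> L \<Longrightarrow> x \<^bold>\<and> y \<preceq> y"
    and meet_greatest: "x \<in> L \<Longrightarrow> y \<in> L \<Longrightarrow> z \<in> L \<Longrightarrow> z \<preceq> x \<Longrightarrow> z \<preceq> y \<Longrightarrow> z \<preceq> x \<^bold>\<and> y"
    and join_ge1 [simp]: "x \<in> L \<Longrightarrow> y \<in> L \<Longrightarrow> x \<preceq> x \<^bold>\<or> y"
    and join_ge2 [simp]: "x \<in> L \<Longrightarrow> y \<in> L \<Longrightarrow> y \<preceq> x \<^bold>\<or> y"
    and join_least: "x \<in> L \<Longrightarrow> y \<in> L \<Longrightarrow> z \<in> L \<Longrightarrow> x \<preceq> z \<Longrightarrow> y \<preceq> z \<Longrightarrow> x \<^bold>\<or> y \<preceq> z"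
    and modular: "x \<in> L \<Longrightarrow> y \<in> L \<Longrightarrow> z \<in> L \<Longrightarrow> x \<preceq> z \<Longrightarrow> x \<^bold>\<or> (y \<^bold>\<and> z) = (x \<^bold>\<or> y) \<^bold>\<and> z"
    and rk_less: "x \<in> L \<Longrightarrow> y \<in> L \<Longrightarrow> x \<preceq> y \<Longrightarrow> x \<noteq> y \<Longrightarrow> rk x < rk y"
    and rk_modular: "x \<in> L \<Longrightarrow> y \<in> L \<Longrightarrow> rk (x \<^bold>\<or> y) + rk (x \<^bold>\<and> y) = rk x + rk y"
    and good_sym: "x \<in> L \<Longrightarrow> y \<in> L \<Longrightarrow> good x y \<Longrightarrow> good y x"
    and good_le: "x \<in> L \<Longrightarrow> y \<in> L \<Longrightarrow> x \<preceq> y \<Longrightarrow> good x y"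
    and good_join: "x \<in> L \<Longrightarrow> y \<in> L \<Longrightarrow> z \<in> L \<Longrightarrow> good x y \<Longrightarrow> good y z \<Longrightarrow>
      good x (y \<^bold>\<or> z) \<longleftrightarrow> good (x \<^bold>\<or> y) z"
    and good_meet: "x \<in> L \<Longrightarrow> y \<in> L \<Longrightarrow> z \<in> L \<Longrightarrow> good x y \<Longrightarrow> good y z \<Longrightarrow>
      good x (y \<^bold>\<and> z) \<longleftrightarrow> good (x \<^bold>\<and> y) z"
    and complement: "a \<in> L \<Longrightarrow> w \<in> L \<Longrightarrow> b \<in> L \<Longrightarrow> a \<preceq> w \<Longrightarrow> w \<preceq> b \<Longrightarrow>
      \<exists>c\<in>L. w \<^bold>\<and> c = a \<and> w \<^bold>\<or> c = b \<and> good w c"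
    and coatom: "a \<in> L \<Longrightarrow> w \<in> L \<Longrightarrow> a \<preceq> w \<Longrightarrow> a \<noteq> w \<Longrightarrow> \<exists>c\<in>L. a \<preceq> c \<and> c \<preceq> w \<and> rk c = rk w - 1"
begin

section \<open>Elementary lattice identities\<close>

lemma meet_comm: "x \<in> L \<Longrightarrow> y \<in> L \<Longrightarrow> x \<^bold>\<and> y = y \<^bold>\<and> x"
  by (rule le_antisym) (auto intro: meet_greatest)

lemma join_comm: "x \<in> L \<Longrightarrow> y \<in> L \<Longrightarrow> x \<^bold>\<or> y = y \<^bold>\<or> x"
  by (rule le_antisym) (auto intro: join_least)

lemma meet_absorb1: "x \<in> L \<Longrightarrow> y \<in> L \<Longrightarrow> x \<preceq> y \<Longrightarrow> x \<^bold>\<and> y = x"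
  by (rule le_antisym) (auto intro: meet_greatest)

lemma meet_absorb2: "x \<in> L \<Longrightarrow> y \<in> L \<Longrightarrow> x \<preceq> y \<Longrightarrow> y \<^bold>\<and> x = x"
  by (rule le_antisym) (auto intro: meet_greatest)

lemma join_absorb1: "x \<in> L \<Longrightarrow> y \<in> L \<Longrightarrow> x \<preceq> y \<Longrightarrow> x \<^bold>\<or> y = y"
  by (rule le_antisym) (auto intro: join_least)

lemma join_absorb2: "x \<in> L \<Longrightarrow> y \<in> L \<Longrightarrow> x \<preceq> y \<Longrightarrow> y \<^bold>\<or> x = y"
  by (rule le_antisym) (auto intro: join_least)

lemma le_joinI1: "x \<in> L \<Longrightarrow> y \<in> L \<Longrightarrow> z \<in> L \<Longrightarrow> z \<preceq> x \<Longrightarrow> z \<preceq> x \<^bold>\<or> y"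
  by (rule le_trans[of z x "x \<^bold>\<or> y"]) auto

lemma le_joinI2: "x \<in> L \<Longrightarrow> y \<in> L \<Longrightarrow> z \<in> L \<Longrightarrow> z \<preceq> y \<Longrightarrow> z \<preceq> x \<^bold>\<or> y"
  by (rule le_trans[of z y "x \<^bold>\<or> y"]) auto

lemma meet_leI1: "x \<in> L \<Longrightarrow> y \<in> L \<Longrightarrow> z \<in> L \<Longrightarrow> x \<preceq> z \<Longrightarrow> x \<^bold>\<and> y \<preceq> z"
  by (rule le_trans[of "x \<^bold>\<and> y" x z]) auto

lemma meet_leI2: "x \<in> L \<Longrightarrow> y \<in> L \<Longrightarrow> z \<in> L \<Longrightarrow> y \<preceq> z \<Longrightarrow> x \<^bold>\<and> y \<preceq> z"
  by (rule le_trans[of "x \<^bold>\<and> y" y z]) auto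

lemma meet_mono: "x \<in> L \<Longrightarrow> x' \<in> L \<Longrightarrow> y \<in> L \<Longrightarrow> x \<preceq> x' \<Longrightarrow> x \<^bold>\<and> y \<preceq> x' \<^bold>\<and> y"
  by (rule meet_greatest) (auto intro: meet_leI1)

lemma join_mono: "x \<in> L \<Longrightarrow> x' \<in> L \<Longrightarrow> y \<in> L \<Longrightarrow> x \<preceq> x' \<Longrightarrow> x \<^bold>\<or> y \<preceq> x' \<^bold>\<or> y"
  by (rule join_least) (auto intro: le_joinI1)

lemma rk_le: "x \<in> L \<Longrightarrow> y \<in> L \<Longrightarrow> x \<preceq> y \<Longrightarrow> rk x \<le> rk y"
  using rk_less[of x y] by (cases "x = y") auto

lemma eq_if_rk_eq: "x \<in> L \<Longrightarrow> y \<in> L \<Longrightarrow> x \<preceq> y \<Longrightarrow> rk x = rk y \<Longrightarrow> x = y"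
  using rk_less[of x y] by auto

text \<open>An instance of \<open>good_meet\<close>: the meet of \<open>y\<close> and
  \<open>w\<close> is \<open>w\<close>, and the meet of \<open>x\<close> and \<open>y\<close>, lying
  below \<open>w\<close>, is in good position to it.\<close>

lemma good_sub:
  assumes "x \<in> L" "y \<in> L" "w \<in> L" "good x y" "x \<^bold>\<and> y \<preceq> w" "w \<preceq> y"
  shows "good x w"
  using good_meet[of x y w] good_le[of "x \<^bold>\<and> y" w] good_sym[OF _ _ good_le[of w y]] assms
  by (simp add: meet_absorb2)

text \<open>Makes every result available for the reversed order. Ranks are integers so that the dual
  rank is simply the negative; only differences of ranks matter.\<close>

lemma dual: "summand_lattice L (\<lambda>x y. y \<preceq> x) (\<^bold>\<or>) (\<^bold>\<and>) (\<lambda>x. - rk x) good"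
proof unfold_locales
  fix x y z assume "x \<in> L" "y \<in> L" "z \<in> L" "z \<preceq> x"
  then show "x \<^bold>\<and> (y \<^bold>\<or> z) = x \<^bold>\<and> y \<^bold>\<or> z"
    using modular[of z y x] by (simp add: meet_comm join_comm)
next
  fix a w b assume *: "a \<in> L" "w \<in> L" "b \<in> L" "w \<preceq> a" "b \<preceq> w"
  then show "\<exists>c\<in>L. w \<^bold>\<or> c = a \<and> w \<^bold>\<and> c = b \<and> good w c"
    using complement[of b w a] by blast
next
  fix a w assume *: "a \<in> L" "w \<in> L" "w \<preceq> a" "a \<noteq> w"
  then obtain c where c: "c \<in> L" "w \<preceq> c" "c \<preceq> a" "rk c = rk a - 1" using coatom[of w a] by auto
  \<comment> \<open>The dual of \<open>coatom\<close> asks for an element one rank above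
    \<open>w\<close>: a complement of a coatom, relative to the interval from \<open>w\<close> to
    \<open>a\<close>, has this rank by modularity.\<close>
  obtain d where d: "d \<in> L" "c \<^bold>\<and> d = w" "c \<^bold>\<or> d = a" using complement[of w c a] c * by auto
  have "rk d = rk w + 1" using rk_modular[of c d] c d by simp
  moreover have "w \<preceq> d" using meet_le2[of c d] c d by simp
  moreover have "d \<preceq> a" using join_ge2[of c d] c d by simp
  ultimately show "\<exists>c\<in>L. c \<preceq> a \<and> w \<preceq> c \<and> - rk c = - rk w - 1"
    using d by (intro bexI[of _ d]) auto
qed (auto intro: le_antisym le_trans meet_greatest join_least good_sym simp: good_join good_meet
    dest: rk_less rk_modular good_le)

abbreviation lt :: "'l \<Rightarrow> 'l \<Rightarrow> bool" where
  "lt x y \<equiv> x \<preceq> y \<and> x \<noteq> y"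

lemma lt_trans: "x \<in> L \<Longrightarrow> y \<in> L \<Longrightarrow> z \<in> L \<Longrightarrow> lt x y \<Longrightarrow> lt y z \<Longrightarrow> lt x z"
  using le_trans[of x y z] le_antisym[of x y] by auto

text \<open>Both ends are variable because the induction lowers \<open>b\<close> to an element of
  corank 1 and, for links, raises \<open>a\<close> to an atom.\<close>

definition partial_complements :: "'l \<Rightarrow> 'l \<Rightarrow> 'l \<Rightarrow> 'l set" where
  "partial_complements a b w = {p \<in> L. lt a p \<and> p \<preceq> b \<and> p \<^bold>\<and> w = a \<and> good p w}"

text \<open>Choose \<open>h\<close> of corank 1 with \<open>h + w = b\<close>. Those partial complements that lie in \<open>h\<close> or meet it
  nontrivially retract onto those in \<open>h\<close>; the others are atoms.\<close>

lemma acyclic_partial_complements: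
  assumes "a \<in> L" "b \<in> L" "w \<in> L" "a \<preceq> w" "w \<preceq> b"
  shows "acyclic_below lt (partial_complements a b w) (nat (rk b - rk w))"
  using assms
proof (induction "nat (rk b - rk a)" arbitrary: a b w rule: less_induct)
  case less
  note [simp] = \<open>a \<in> L\<close> \<open>b \<in> L\<close> \<open>w \<in> L\<close>
  note aw = \<open>a \<preceq> w\<close> and wb = \<open>w \<preceq> b\<close>
  have ab: "a \<preceq> b" using le_trans[of a w b] aw wb by simp
  let ?Y = "partial_complements a b w"
  show ?case
  proof (cases "w = a")
    case True
    show ?thesis
    proof (cases "b = a")
      case False
      have "fills (inc_lists lt ?Y) l" for l
      proof (rule fills_top[of b])
        show "b \<in> ?Y"
          using False ab True good_sym[OF _ _ good_le[of a b]]
          by (auto simp: partial_complements_def meet_absorb2)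
        show "\<not> lt b p" if "p \<in> ?Y" for p
          using that le_antisym[of b p] by (auto simp: partial_complements_def)
      qed (auto simp: partial_complements_def)
      then show ?thesis by (simp add: acyclic_below_def)
    qed (simp add: True acyclic_below_def)
  next
    case False
    obtain w1 where w1 [simp]: "w1 \<in> L" and aw1: "a \<preceq> w1" and w1w: "w1 \<preceq> w" and rkw1: "rk w1 = rk w - 1"
      using coatom[of a w] aw False by auto
    have "w1 \<preceq> b" using le_trans[of w1 w b] w1w wb by simp
    \<comment> \<open>A complement of \<open>w\<close> relative to \<open>w1\<close>; by modularity
      its corank in \<open>b\<close> is that of \<open>w1\<close> in \<open>w\<close>, namely
      1.\<close>
    obtain h where h [simp]: "h \<in> L" and wh: "w \<^bold>\<and> h = w1" "w \<^bold>\<or> h = b" "good w h"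
      using complement[of w1 w b] w1w wb by auto
    have w1h: "w1 \<preceq> h" using meet_le2[of w h] wh by simp
    have hb: "h \<preceq> b" using join_ge2[of w h] wh by simp
    have ah: "a \<preceq> h" using le_trans[of a w1 h] aw1 w1h by simp
    have rkh: "rk h = rk b - 1" using rk_modular[of w h] wh rkw1 by simp
    let ?k = "nat (rk b - rk w)"
    let ?Z = "partial_complements a h w1"
    have YD: "p \<in> L" "a \<preceq> p" "p \<noteq> a" "p \<preceq> b" "p \<^bold>\<and> w = a" "good p w" if "p \<in> ?Y" for p
      using that by (auto simp: partial_complements_def)
    have "nat (rk h - rk a) < nat (rk b - rk a)"
      using rkh rk_le[of a h] ah \<open>a \<in> L\<close> h by linarith
    \<comment> \<open>Both ranks drop by 1, so the induction hypothesis gives the full range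
      \<open>?k\<close> inside \<open>h\<close>.\<close>
    moreover have "rk h - rk w1 = rk b - rk w" using rkh rkw1 by simp
    ultimately have Y0: "acyclic_below lt ?Z ?k"
      using less.hyps[of h a w1] aw1 w1h by simp
    \<comment> \<open>For elements below \<open>h\<close> the conditions relative to
      \<open>w\<close> and to \<open>w1\<close> agree, as \<open>w1\<close> is the meet of
      \<open>w\<close> and \<open>h\<close>, which are in good position.\<close>
    have Y0_eq: "?Z = {p \<in> ?Y. p \<preceq> h}"
    proof (intro equalityI subsetI)
      fix p assume "p \<in> ?Z"
      then have p: "p \<in> L" "lt a p" "p \<preceq> h" "p \<^bold>\<and> w1 = a" "good p w1"
        by (auto simp: partial_complements_def)
      have "p \<^bold>\<and> w = a"
      proof (rule le_antisym)
        have "p \<^bold>\<and> w \<preceq> w \<^bold>\<and> h" using p by (intro meet_greatest) (auto intro: meet_leI1)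
        then have "p \<^bold>\<and> w \<preceq> p \<^bold>\<and> w1" using p wh by (intro meet_greatest) auto
        then show "p \<^bold>\<and> w \<preceq> a" using p by simp
        show "a \<preceq> p \<^bold>\<and> w" using p aw by (intro meet_greatest) auto
      qed (use p in auto)
      moreover have "good w (h \<^bold>\<and> p) \<longleftrightarrow> good (w \<^bold>\<and> h) p"
        using good_meet[of w h p] good_sym[OF _ _ good_le[of p h]] p wh by simp
      then have "good p w"
        using p wh good_sym[of p w1] good_sym[of w p] by (simp add: meet_absorb2)
      moreover have "p \<preceq> b" using le_trans[of p h b] p hb by simp
      ultimately show "p \<in> {p \<in> ?Y. p \<preceq> h}" using p by (auto simp: partial_complements_def)
    next
      fix p assume "p \<in> {p \<in> ?Y. p \<preceq> h}"
      then have p: "p \<in> L" "lt a p" "p \<preceq> h" "p \<^bold>\<and> w = a" "good p w"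
        by (auto simp: partial_complements_def)
      have "p \<^bold>\<and> w1 = a"
      proof (rule le_antisym)
        have "p \<^bold>\<and> w1 \<preceq> p \<^bold>\<and> w" using p w1w by (intro meet_greatest) (auto intro: meet_leI2)
        then show "p \<^bold>\<and> w1 \<preceq> a" using p by simp
        show "a \<preceq> p \<^bold>\<and> w1" using p aw1 by (intro meet_greatest) auto
      qed (use p in auto)
      moreover have "good p w1" using good_sub[of p w w1] p aw1 w1w by simp
      ultimately show "p \<in> ?Z" using p by (auto simp: partial_complements_def)
    qed
    \<comment> \<open>The elements on which meeting with \<open>h\<close> gives something other than
      \<open>a\<close>, hence a value again in the poset.\<close>
    define Y' where "Y' = {p \<in> ?Y. p \<preceq> h \<or> p \<^bold>\<and> h \<noteq> a}"
    have Y'D: "p \<in> ?Y" if "p \<in> Y'" for p using that by (simp add: Y'_def)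
    have "acyclic_below lt Y' ?k"
    proof (rule acyclic_below_retract[where r = "\<lambda>p. p \<^bold>\<and> h", OF _ _ _ _ _ _ Y0])
      show "?Z \<subseteq> Y'" by (auto simp: Y0_eq Y'_def)
      show "lt x z" if "x \<in> Y'" "y \<in> Y'" "z \<in> Y'" "lt x y" "lt y z" for x y z
        by (rule lt_trans[OF YD(1) YD(1) YD(1)]) (use that Y'D in auto)
      show "lt (p \<^bold>\<and> h) p \<or> p \<^bold>\<and> h = p" if "p \<in> Y'" for p
        using YD(1)[OF Y'D[OF that]] by simp
      show "lt (p \<^bold>\<and> h) (q \<^bold>\<and> h) \<or> p \<^bold>\<and> h = q \<^bold>\<and> h" if "p \<in> Y'" "q \<in> Y'" "lt p q" for p q
        using YD(1)[OF Y'D[OF that(1)]] YD(1)[OF Y'D[OF that(2)]] that(3) by (simp add: meet_mono)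
      show "p \<^bold>\<and> h \<in> ?Z" if "p \<in> Y'" for p
      proof -
        note p = YD[OF Y'D[OF that]]
        note [simp] = p(1)
        have ap: "a \<preceq> p \<^bold>\<and> h" using p ah by (intro meet_greatest) auto
        have ne: "p \<^bold>\<and> h \<noteq> a" using that p(3) by (auto simp: Y'_def meet_absorb1)
        have le: "p \<^bold>\<and> h \<^bold>\<and> w \<preceq> a"
          using meet_mono[of "p \<^bold>\<and> h" p w] p(5) by simp
        have eq: "p \<^bold>\<and> h \<^bold>\<and> w = a"
          by (rule le_antisym) (use le ap aw in \<open>auto intro: meet_greatest\<close>)
        have "good w p" using p(6) by (simp add: good_sym)
        then have "good w (p \<^bold>\<and> h)"
          using good_sub[of w p "p \<^bold>\<and> h"] p(5) ap by (simp add: meet_comm)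
        then have "good (p \<^bold>\<and> h) w" by (simp add: good_sym)
        moreover have "p \<^bold>\<and> h \<preceq> b" using p(4) by (simp add: meet_leI1)
        ultimately show ?thesis unfolding Y0_eq using ap ne eq by (simp add: partial_complements_def)
      qed
    qed auto
    note Y' = this
    show ?thesis
      unfolding acyclic_below_def fills_def
    proof (intro allI impI ballI)
      fix l z assume l: "l < ?k" and z: "z \<in> chains_in (inc_lists lt ?Y) l" "boundary z = 0"
      \<comment> \<open>Such an \<open>x\<close> is not below \<open>h\<close>, so its join with
        \<open>h\<close> has rank \<open>rk b\<close>; since \<open>h\<close> has corank 1 and meets
        \<open>x\<close> in \<open>a\<close>, modularity yields the rank of
        \<open>x\<close>.\<close>
      have D: "rk x = rk a + 1 \<and> x \<in> ?Y" if "x \<in> ?Y - Y'" for x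
      proof -
        have x: "x \<in> ?Y" "\<not> x \<preceq> h" "x \<^bold>\<and> h = a" using that by (auto simp: Y'_def)
        note [simp] = YD(1)[OF x(1)]
        have "h \<noteq> x \<^bold>\<or> h"
        proof
          assume "h = x \<^bold>\<or> h"
          then show False using join_ge1[of x h] x(2) by simp
        qed
        then have "rk h < rk (x \<^bold>\<or> h)" by (simp add: rk_less)
        moreover have "rk (x \<^bold>\<or> h) \<le> rk b"
          using YD(4)[OF x(1)] hb by (intro rk_le join_least) auto
        ultimately show ?thesis using rk_modular[of x h] x rkh by simp
      qed
      obtain z' e where z': "z' \<in> chains_in (inc_lists lt (?Y - (?Y - Y'))) l"
        and e: "e \<in> chains_in (inc_lists lt ?Y) (Suc l)" "boundary e = z - z'"
      proof (rule push_off_minimal[OF _ _ z, of "?Y - Y'"])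
        show "\<not> lt y x" if "x \<in> ?Y - Y'" "y \<in> ?Y" for x y
          using D[OF that(1)] rk_less[of y x] rk_less[of a y] YD[OF that(2)] YD(1)[of x] by auto
        fix x assume x': "x \<in> ?Y - Y'" and "0 < l"
        note x = D[OF x'] YD[OF D[OF x', THEN conjunct2]]
        have xL [simp]: "x \<in> L" using x by simp
        have rkxw: "rk (x \<^bold>\<or> w) = rk w + 1" using rk_modular[of x w] x by simp
        have xwb: "x \<^bold>\<or> w \<preceq> b" using x wb by (intro join_least) auto
        \<comment> \<open>The link of an atom is a poset of the same kind over \<open>x\<close>. The
          corank of the join of \<open>x\<close> and \<open>w\<close> is smaller by 1, which suits
          the link cycles of length \<open>l - 1\<close>.\<close>
        have "{y \<in> ?Y. lt x y} = partial_complements x b (x \<^bold>\<or> w)"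
        proof (intro equalityI subsetI)
          fix y assume y: "y \<in> {y \<in> ?Y. lt x y}"
          then have [simp]: "y \<in> L" by (simp add: YD)
          have "y \<^bold>\<and> (x \<^bold>\<or> w) = x"
            using modular[of x w y] y YD(5)[of y] x by (simp add: meet_comm join_absorb2)
          moreover have "good y x" using y good_sym[OF _ _ good_le[of x y]] by simp
          then have "good y (x \<^bold>\<or> w) \<longleftrightarrow> good (y \<^bold>\<or> x) w"
            using good_join[of y x w] x by simp
          then have "good y (x \<^bold>\<or> w)" using y YD(6)[of y] by (simp add: join_absorb2)
          ultimately show "y \<in> partial_complements x b (x \<^bold>\<or> w)"
            using y by (simp add: partial_complements_def)
        next
          fix y assume "y \<in> partial_complements x b (x \<^bold>\<or> w)"
          then have y: "y \<in> L" "lt x y" "y \<preceq> b" "y \<^bold>\<and> (x \<^bold>\<or> w) = x" "good y (x \<^bold>\<or> w)"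
            by (auto simp: partial_complements_def)
          note [simp] = y(1)
          have ay: "a \<preceq> y" "a \<noteq> y"
            using lt_trans[of a x y] x y by auto
          have "y \<^bold>\<and> w \<preceq> x"
            using meet_greatest[of y "x \<^bold>\<or> w" "y \<^bold>\<and> w"] y(4) by (simp add: meet_leI2)
          then have "y \<^bold>\<and> w \<preceq> x \<^bold>\<and> w" by (intro meet_greatest) auto
          then have "y \<^bold>\<and> w = a"
            using x ay aw by (intro le_antisym meet_greatest) auto
          moreover have "good y x" using y good_sym[OF _ _ good_le[of x y]] by simp
          then have "good y (x \<^bold>\<or> w) \<longleftrightarrow> good (y \<^bold>\<or> x) w"
            using good_join[of y x w] x by simp
          then have "good y w" using y by (simp add: join_absorb2)
          ultimately show "y \<in> {y \<in> ?Y. lt x y}"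
            using y ay by (simp add: partial_complements_def)
        qed
        moreover have "nat (rk b - rk x) < nat (rk b - rk a)"
          using rk_le[of x b] x by auto
        then have "acyclic_below lt (partial_complements x b (x \<^bold>\<or> w)) (nat (rk b - rk (x \<^bold>\<or> w)))"
          using less.hyps[of b x "x \<^bold>\<or> w"] xwb by simp
        moreover have "l - 1 < nat (rk b - rk (x \<^bold>\<or> w))" using l \<open>0 < l\<close> rkxw by simp
        ultimately show "fills (inc_lists lt {y \<in> ?Y. lt x y}) (l - 1)"
          by (simp add: acyclic_below_def)
      qed
      have "?Y - (?Y - Y') = Y'" using Y'D by blast
      with z' have z'Y: "z' \<in> chains_in (inc_lists lt Y') l" by simp
      have "boundary (boundary e) = boundary z - boundary z'" by (simp only: e(2) frag_extend_diff)
      then have "boundary z' = 0" by (simp add: boundary_boundary z(2))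
      with Y' l z'Y obtain e' where e': "e' \<in> chains_in (inc_lists lt Y') (Suc l)" "boundary e' = z'"
        unfolding acyclic_below_def fills_def by blast
      have "e' \<in> chains_in (inc_lists lt ?Y) (Suc l)"
        by (rule chains_in_mono[OF e'(1) inc_lists_mono]) (use Y'D in blast)
      then have "e + e' \<in> chains_in (inc_lists lt ?Y) (Suc l)" using e(1) by (rule chains_in_add[rotated])
      moreover have "boundary (e + e') = z" by (simp add: frag_extend_add e e')
      ultimately show "\<exists>e\<in>chains_in (inc_lists lt ?Y) (Suc l). boundary e = z" by blast
    qed
  qed
qed

section \<open>Complementary pairs and posets of splittings\<close>

definition compl :: "'l \<Rightarrow> 'l \<Rightarrow> 'l \<Rightarrow> 'l \<Rightarrow> bool" where
  "compl a b p q \<longleftrightarrow> p \<in> L \<and> q \<in> L \<and> p \<^bold>\<and> q = a \<and> p \<^bold>\<or> q = b \<and> good p q"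

text \<open>With \<open>w\<close> above \<open>a\<close>, only the trivial splitting
  \<open>(a, b)\<close> needs exclusion: \<open>(b, a)\<close> can occur only for
  \<open>w = a\<close>, and then it is a greatest element when \<open>b\<close> differs from
  \<open>a\<close>.\<close>

definition splittings_above :: "'l \<Rightarrow> 'l \<Rightarrow> 'l \<Rightarrow> ('l \<times> 'l) set" where
  "splittings_above a b w = {(p, q). compl a b p q \<and> w \<preceq> q \<and> p \<noteq> a}"

definition split_lt :: "'l \<times> 'l \<Rightarrow> 'l \<times> 'l \<Rightarrow> bool" where
  "split_lt x y \<longleftrightarrow> lt (fst x) (fst y) \<and> lt (snd y) (snd x)"

lemma complD:
  assumes "compl a b p q"
  shows "p \<in> L" "q \<in> L" "a \<in> L" "b \<in> L" "p \<^bold>\<and> q = a" "p \<^bold>\<or> q = b" "good p q" "good q p"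
    "a \<preceq> p" "a \<preceq> q" "p \<preceq> b" "q \<preceq> b" "rk p + rk q = rk a + rk b"
proof -
  show *: "p \<in> L" "q \<in> L" "p \<^bold>\<and> q = a" "p \<^bold>\<or> q = b" "good p q"
    using assms by (auto simp: compl_def)
  then show "a \<in> L" "b \<in> L" "good q p" "a \<preceq> p" "a \<preceq> q" "p \<preceq> b" "q \<preceq> b"
    using meet_in[of p q] join_in[of p q] good_sym[of p q]
      meet_le1[of p q] meet_le2[of p q] join_ge1[of p q] join_ge2[of p q] by auto
  show "rk p + rk q = rk a + rk b" using rk_modular[of p q] * by simp
qed

text \<open>Above a given splitting \<open>(p, q)\<close>, the poset of splittings of \<open>b\<close> is a poset of splittings of \<open>q\<close>.\<close>

lemma acyclic_splittings_up:
  assumes pq: "(p, q) \<in> splittings_above a b w"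
    and acyc: "acyclic_below split_lt (splittings_above a q w) k"
  shows "acyclic_below split_lt {y \<in> splittings_above a b w. split_lt (p, q) y} k"
proof -
  have c: "compl a b p q" "w \<preceq> q" "p \<noteq> a" using pq by (auto simp: splittings_above_def)
  note C = complD[OF c(1)]
  note [simp] = C(1-4)
  \<comment> \<open>By the modular law, joining with \<open>p\<close> and meeting with
    \<open>q\<close> are mutually inverse between the interval from \<open>a\<close> to
    \<open>q\<close> and that from \<open>p\<close> to \<open>b\<close>.\<close>
  have inj: "(p \<^bold>\<or> r) \<^bold>\<and> q = r" if "r \<in> L" "r \<preceq> q" "a \<preceq> r" for r
    using modular[of r p q] that C by (simp add: join_comm join_absorb1 join_absorb2)
  have surj: "p \<^bold>\<or> (p' \<^bold>\<and> q) = p'" if "p' \<in> L" "p \<preceq> p'" "p' \<preceq> b" for p'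
    using modular[of p q p'] that C by (simp add: meet_comm meet_absorb2)
  show ?thesis
  proof (rule acyclic_below_iso[OF acyc, where f = "\<lambda>(r, q'). (p \<^bold>\<or> r, q')" and g = "\<lambda>(p', q'). (p' \<^bold>\<and> q, q')"])
    fix x assume "x \<in> splittings_above a q w"
    then obtain r q' where x: "x = (r, q')" and rq: "compl a q r q'" "w \<preceq> q'" "r \<noteq> a"
      by (auto simp: splittings_above_def)
    note R = complD[OF rq(1)]
    note [simp] = R(1-2)
    have q'b: "q' \<preceq> b" using R C le_trans[of q' q b] by simp
    have "(p \<^bold>\<or> r) \<^bold>\<and> q' = a"
    proof (rule le_antisym)
      have "(p \<^bold>\<or> r) \<^bold>\<and> q' \<preceq> (p \<^bold>\<or> r) \<^bold>\<and> q" using R by (intro meet_greatest) (auto intro: meet_leI2)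
      then have "(p \<^bold>\<or> r) \<^bold>\<and> q' \<preceq> r" using inj[of r] R by simp
      then have "(p \<^bold>\<or> r) \<^bold>\<and> q' \<preceq> r \<^bold>\<and> q'" by (intro meet_greatest) auto
      then show "(p \<^bold>\<or> r) \<^bold>\<and> q' \<preceq> a" using R by simp
      show "a \<preceq> (p \<^bold>\<or> r) \<^bold>\<and> q'" using R C by (intro meet_greatest) (auto intro: le_joinI1)
    qed auto
    moreover have "(p \<^bold>\<or> r) \<^bold>\<or> q' = b"
    proof (rule le_antisym)
      show "(p \<^bold>\<or> r) \<^bold>\<or> q' \<preceq> b"
        using R C q'b le_trans[of r q b] by (intro join_least) auto
      have "r \<^bold>\<or> q' \<preceq> (p \<^bold>\<or> r) \<^bold>\<or> q'" by (intro join_mono) auto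
      then have "p \<^bold>\<or> q \<preceq> (p \<^bold>\<or> r) \<^bold>\<or> q'" using R by (intro join_least) (auto intro: le_joinI1)
      then show "b \<preceq> (p \<^bold>\<or> r) \<^bold>\<or> q'" using C by simp
    qed auto
    moreover have "good p r" using good_sub[of p q r] R C by simp
    then have "good p (r \<^bold>\<or> q') \<longleftrightarrow> good (p \<^bold>\<or> r) q'" using good_join[of p r q'] R by simp
    then have "good (p \<^bold>\<or> r) q'" using R C by simp
    moreover have "lt p (p \<^bold>\<or> r)"
    proof -
      have "r = a" if "p = p \<^bold>\<or> r"
        using inj[of r] R C that by simp
      then show ?thesis using rq by auto
    qed
    moreover have "lt q' q"
    proof -
      have "q' \<noteq> q" using R rq meet_absorb1[of r q] by auto
      then show ?thesis using R by simp
    qed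
    moreover have "p \<^bold>\<or> r \<noteq> a"
      using \<open>lt p (p \<^bold>\<or> r)\<close> C(9) le_antisym[of p a] by auto
    ultimately show "(case x of (r, q') \<Rightarrow> (p \<^bold>\<or> r, q')) \<in> {y \<in> splittings_above a b w. split_lt (p, q) y}"
      using rq by (simp add: x splittings_above_def compl_def split_lt_def)
  next
    fix x y assume "x \<in> splittings_above a q w" "y \<in> splittings_above a q w" "split_lt x y"
    then obtain r q' r' q'' where x: "x = (r, q')" "compl a q r q'" and y: "y = (r', q'')" "compl a q r' q''"
      and lt: "lt r r'" "lt q'' q'"
      by (auto simp: splittings_above_def split_lt_def)
    note R = complD[OF x(2)] complD[OF y(2)]
    have "p \<^bold>\<or> r \<preceq> p \<^bold>\<or> r'" using join_mono[of r r' p] R lt by (simp add: join_comm)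
    moreover have "p \<^bold>\<or> r \<noteq> p \<^bold>\<or> r'" using inj[of r] inj[of r'] R lt by auto
    ultimately show "split_lt (case x of (r, q') \<Rightarrow> (p \<^bold>\<or> r, q')) (case y of (r, q') \<Rightarrow> (p \<^bold>\<or> r, q'))"
      using x y lt by (simp add: split_lt_def)
  next
    fix x assume "x \<in> {y \<in> splittings_above a b w. split_lt (p, q) y}"
    then obtain p' q' where x: "x = (p', q')" and pq': "compl a b p' q'" "w \<preceq> q'" "p' \<noteq> a"
      and lt: "lt p p'" "lt q' q"
      by (auto simp: splittings_above_def split_lt_def)
    note R = complD[OF pq'(1)]
    note [simp] = R(1-2)
    show "(case case x of (p', q') \<Rightarrow> (p' \<^bold>\<and> q, q') of (r, q') \<Rightarrow> (p \<^bold>\<or> r, q')) = x"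
      using surj[of p'] R lt by (simp add: x)
    have "(p' \<^bold>\<and> q) \<^bold>\<and> q' = a"
    proof (rule le_antisym)
      have "(p' \<^bold>\<and> q) \<^bold>\<and> q' \<preceq> p' \<^bold>\<and> q'" by (intro meet_mono) auto
      then show "(p' \<^bold>\<and> q) \<^bold>\<and> q' \<preceq> a" using R by simp
      show "a \<preceq> (p' \<^bold>\<and> q) \<^bold>\<and> q'" using R C by (intro meet_greatest) auto
    qed auto
    moreover have "(p' \<^bold>\<and> q) \<^bold>\<or> q' = q"
      using modular[of q' p' q] R lt C by (simp add: join_comm meet_comm meet_absorb2)
    moreover have "good q' (p' \<^bold>\<and> q)"
      using good_sub[of q' p' "p' \<^bold>\<and> q"] R C by (simp add: meet_comm[of q' p'] meet_greatest)
    then have "good (p' \<^bold>\<and> q) q'" by (simp add: good_sym)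
    moreover have "p' \<^bold>\<and> q \<noteq> a"
      using surj[of p'] R C lt by (auto simp: join_absorb2)
    ultimately show "(case x of (p', q') \<Rightarrow> (p' \<^bold>\<and> q, q')) \<in> splittings_above a q w"
      using pq' by (simp add: x splittings_above_def compl_def)
  next
    fix x y assume "x \<in> {y \<in> splittings_above a b w. split_lt (p, q) y}"
      "y \<in> {y \<in> splittings_above a b w. split_lt (p, q) y}" "split_lt x y"
    then obtain r q' r' q'' where x: "x = (r, q')" "compl a b r q'" and y: "y = (r', q'')" "compl a b r' q''"
      and lt: "lt r r'" "lt q'' q'" "lt p r" "lt p r'"
      by (auto simp: splittings_above_def split_lt_def)
    note R = complD[OF x(2)] complD[OF y(2)]
    have "r \<^bold>\<and> q \<preceq> r' \<^bold>\<and> q" using meet_mono[of r r' q] R lt by simp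
    moreover have "r \<^bold>\<and> q \<noteq> r' \<^bold>\<and> q" using surj[of r] surj[of r'] R lt by auto
    ultimately show "split_lt (case x of (p', q') \<Rightarrow> (p' \<^bold>\<and> q, q')) (case y of (p', q') \<Rightarrow> (p' \<^bold>\<and> q, q'))"
      using x y lt by (simp add: split_lt_def)
  qed
qed

text \<open>The splittings \<open>(p, q)\<close> with \<open>w\<close> below \<open>q\<close> and \<open>p\<close> below \<open>v\<close> only depend on the interval from \<open>w\<close>
  to \<open>b\<close>: the lift of \<open>p\<close> is determined by \<open>v\<close>. This is where duality enters.\<close>

lemma acyclic_splittings_fibre:
  assumes v: "v \<in> partial_complements a b w" and w: "a \<in> L" "b \<in> L" "w \<in> L" "a \<preceq> w" "w \<preceq> b"
    and acyc: "v \<^bold>\<or> w \<noteq> b \<Longrightarrow> acyclic_below (\<lambda>x y. lt (fst y) (fst x) \<and> lt (snd x) (snd y))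
      {(q, p). compl w b p q \<and> p \<preceq> v \<^bold>\<or> w \<and> q \<noteq> b} k"
  shows "acyclic_below split_lt {x \<in> splittings_above a b w. lt (fst x) v \<or> fst x = v} k"
proof -
  have V: "v \<in> L" "lt a v" "v \<preceq> b" "v \<^bold>\<and> w = a" "good v w"
    using v by (auto simp: partial_complements_def)
  note [simp] = V(1) w(1-3)
  have XD: "compl a b p q" "w \<preceq> q" "p \<noteq> a" "p \<preceq> v"
    if "(p, q) \<in> {x \<in> splittings_above a b w. lt (fst x) v \<or> fst x = v}" for p q
    using that by (auto simp: splittings_above_def)
  show ?thesis
  proof (cases "v \<^bold>\<or> w = b")
    \<comment> \<open>Here \<open>(v, w)\<close> is itself a splitting in the fibre, and it is the
      greatest: by ranks, equality in one component forces equality in the other.\<close>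
    case True
    have "fills (inc_lists split_lt {x \<in> splittings_above a b w. lt (fst x) v \<or> fst x = v}) l" for l
    proof (rule fills_top[of "(v, w)"])
      show "(v, w) \<in> {x \<in> splittings_above a b w. lt (fst x) v \<or> fst x = v}"
        using V True by (auto simp: splittings_above_def compl_def)
      fix x assume x: "x \<in> {x \<in> splittings_above a b w. lt (fst x) v \<or> fst x = v}"
      obtain p q where pq: "x = (p, q)" by (cases x)
      note X = XD[OF x[unfolded pq]]
      note C = complD[OF X(1)]
      have rk: "rk p + rk q = rk v + rk w" using C(13) rk_modular[of v w] V True by simp
      show "\<not> split_lt (v, w) x"
        using X le_antisym[of v p] C by (auto simp: pq split_lt_def)
      assume ne: "x \<noteq> (v, w)"
      have "p = v \<longleftrightarrow> q = w"
      proof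
        assume "p = v"
        with rk have "rk w = rk q" by simp
        then show "q = w" using eq_if_rk_eq[of w q] X(2) C(2) by simp
      next
        assume "q = w"
        with rk have "rk p = rk v" by simp
        then show "p = v" using eq_if_rk_eq[of p v] X(4) C(1) by simp
      qed
      with ne have "p \<noteq> v" "w \<noteq> q" by (auto simp: pq)
      then show "split_lt x (v, w)" using X by (simp add: pq split_lt_def)
    qed
    then show ?thesis by (simp add: acyclic_below_def)
  next
    case False
    have sub: "good p w" "p \<^bold>\<and> w = a" if "p \<in> L" "a \<preceq> p" "p \<preceq> v" for p
    proof -
      have "good w v" by (rule good_sym[OF _ _ V(5)]) simp_all
      moreover have "w \<^bold>\<and> v = a" by (rule trans[OF meet_comm V(4)]) simp_all
      ultimately have "good w p" using that by (intro good_sub[of w v p]) simp_all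
      then show "good p w" using that(1) by (intro good_sym[of w p]) simp_all
      have "p \<^bold>\<and> w \<preceq> v \<^bold>\<and> w" using that by (intro meet_mono) auto
      then have "p \<^bold>\<and> w \<preceq> a" by (simp add: V(4))
      then show "p \<^bold>\<and> w = a" using that w by (intro le_antisym meet_greatest) simp_all
    qed
    \<comment> \<open>An instance of \<open>good_join\<close> through \<open>w\<close>:
      \<open>p\<close> is in good position to \<open>w\<close>, and the join of \<open>w\<close> and
      \<open>q\<close> is \<open>q\<close>.\<close>
    have good_iff: "good p q \<longleftrightarrow> good (p \<^bold>\<or> w) q" if "p \<in> L" "q \<in> L" "a \<preceq> p" "p \<preceq> v" "w \<preceq> q" for p q
      using good_join[of p w q] sub(1)[of p] good_le[of w q] that by (simp add: join_absorb1)
    have inj: "(p \<^bold>\<or> w) \<^bold>\<and> v = p" if "p \<in> L" "a \<preceq> p" "p \<preceq> v" for p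
    proof -
      have "w \<^bold>\<and> v = a" by (rule trans[OF meet_comm V(4)]) simp_all
      then show ?thesis using modular[of p w v] that by (simp add: join_absorb2)
    qed
    have surj: "(p \<^bold>\<and> v) \<^bold>\<or> w = p" if "p \<in> L" "w \<preceq> p" "p \<preceq> v \<^bold>\<or> w" for p
    proof -
      have "(p \<^bold>\<and> v) \<^bold>\<or> w = w \<^bold>\<or> (v \<^bold>\<and> p)"
        using that by (simp add: join_comm[of _ w] meet_comm[of p v])
      also have "\<dots> = (w \<^bold>\<or> v) \<^bold>\<and> p" using that by (simp add: modular)
      also have "\<dots> = p" using that by (simp add: join_comm[of w v] meet_absorb2)
      finally show ?thesis .
    qed
    show ?thesis
    \<comment> \<open>Joining with \<open>w\<close> loses nothing below \<open>v\<close>, since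
      \<open>v\<close> meets \<open>w\<close> in \<open>a\<close>; meeting with \<open>v\<close>
      undoes it. The components are swapped because in the dual lattice \<open>q\<close> takes the
      part of the first component.\<close>
    proof (rule acyclic_below_iso[OF acyc[OF False],
          where f = "\<lambda>(q, p). (p \<^bold>\<and> v, q)" and g = "\<lambda>(p, q). (q, p \<^bold>\<or> w)"])
      fix x assume "x \<in> {(q, p). compl w b p q \<and> p \<preceq> v \<^bold>\<or> w \<and> q \<noteq> b}"
      then obtain p q where x: "x = (q, p)" and pq: "compl w b p q" "p \<preceq> v \<^bold>\<or> w" "q \<noteq> b" by auto
      note C = complD[OF pq(1)]
      note [simp] = C(1-2)
      have ap: "a \<preceq> p \<^bold>\<and> v" using C V w le_trans[of a w p] by (intro meet_greatest) auto
      have s: "(p \<^bold>\<and> v) \<^bold>\<or> w = p" using surj[of p] C pq by simp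
      have "(p \<^bold>\<and> v) \<^bold>\<and> q = a"
      proof (rule le_antisym)
        have "(p \<^bold>\<and> v) \<^bold>\<and> q \<preceq> p \<^bold>\<and> q" by (intro meet_mono) auto
        then have "(p \<^bold>\<and> v) \<^bold>\<and> q \<preceq> v \<^bold>\<and> w" using C by (intro meet_greatest) (auto intro: meet_leI1)
        then show "(p \<^bold>\<and> v) \<^bold>\<and> q \<preceq> a" using V by simp
        have "a \<preceq> q" using C w le_trans[of a w q] by simp
        with ap show "a \<preceq> (p \<^bold>\<and> v) \<^bold>\<and> q" by (rule meet_greatest[rotated 3]) simp_all
      qed auto
      moreover have "(p \<^bold>\<and> v) \<^bold>\<or> q = b"
      proof (rule le_antisym)
        show "(p \<^bold>\<and> v) \<^bold>\<or> q \<preceq> b" using C V by (intro join_least) (auto intro: meet_leI2)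
        have "(p \<^bold>\<and> v) \<^bold>\<or> w \<preceq> (p \<^bold>\<and> v) \<^bold>\<or> q" using C by (intro join_least) (auto intro: le_joinI2)
        then have "p \<^bold>\<or> q \<preceq> (p \<^bold>\<and> v) \<^bold>\<or> q" by (intro join_least) (simp_all add: s)
        then show "b \<preceq> (p \<^bold>\<and> v) \<^bold>\<or> q" using C by simp
      qed auto
      moreover have "good (p \<^bold>\<and> v) q" using good_iff[of "p \<^bold>\<and> v" q] ap s C by simp
      moreover have "p \<^bold>\<and> v \<noteq> a"
        using s C pq w by (auto simp: join_absorb1)
      ultimately show "(case x of (q, p) \<Rightarrow> (p \<^bold>\<and> v, q)) \<in> {x \<in> splittings_above a b w. lt (fst x) v \<or> fst x = v}"
        using C by (simp add: x splittings_above_def compl_def)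
    next
      fix x y assume "x \<in> {(q, p). compl w b p q \<and> p \<preceq> v \<^bold>\<or> w \<and> q \<noteq> b}"
        "y \<in> {(q, p). compl w b p q \<and> p \<preceq> v \<^bold>\<or> w \<and> q \<noteq> b}" "lt (fst y) (fst x) \<and> lt (snd x) (snd y)"
      then obtain p q p' q' where x: "x = (q, p)" "compl w b p q" "p \<preceq> v \<^bold>\<or> w"
        and y: "y = (q', p')" "compl w b p' q'" "p' \<preceq> v \<^bold>\<or> w" and lt: "lt q' q" "lt p p'"
        by auto
      note R = complD[OF x(2)] complD[OF y(2)]
      have "p \<^bold>\<and> v \<preceq> p' \<^bold>\<and> v" using meet_mono[of p p' v] R lt by simp
      moreover have "p \<^bold>\<and> v \<noteq> p' \<^bold>\<and> v" using surj[of p] surj[of p'] R x y lt by auto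
      ultimately show "split_lt (case x of (q, p) \<Rightarrow> (p \<^bold>\<and> v, q)) (case y of (q, p) \<Rightarrow> (p \<^bold>\<and> v, q))"
        using x y lt by (simp add: split_lt_def)
    next
      fix x assume x: "x \<in> {x \<in> splittings_above a b w. lt (fst x) v \<or> fst x = v}"
      obtain p q where pq: "x = (p, q)" by (cases x)
      note X = XD[OF x[unfolded pq]]
      note C = complD[OF X(1)]
      note [simp] = C(1-2)
      show "(case case x of (p, q) \<Rightarrow> (q, p \<^bold>\<or> w) of (q, p) \<Rightarrow> (p \<^bold>\<and> v, q)) = x"
        using inj[of p] C X by (simp add: pq)
      have "(p \<^bold>\<or> w) \<^bold>\<and> q = w"
        using modular[of w p q] X C w by (simp add: join_comm[of w] join_absorb1)
      moreover have "(p \<^bold>\<or> w) \<^bold>\<or> q = b"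
      proof (rule le_antisym)
        show "(p \<^bold>\<or> w) \<^bold>\<or> q \<preceq> b" using C w by (intro join_least) auto
        have "p \<^bold>\<or> q \<preceq> (p \<^bold>\<or> w) \<^bold>\<or> q" by (intro join_mono) auto
        then show "b \<preceq> (p \<^bold>\<or> w) \<^bold>\<or> q" using C by simp
      qed auto
      moreover have "good (p \<^bold>\<or> w) q" using good_iff[of p q] X C by simp
      moreover have "p \<^bold>\<or> w \<preceq> v \<^bold>\<or> w" using X by (intro join_mono) auto
      moreover have "q \<noteq> b" using C X meet_absorb1[of p b] by auto
      ultimately show "(case x of (p, q) \<Rightarrow> (q, p \<^bold>\<or> w)) \<in> {(q, p). compl w b p q \<and> p \<preceq> v \<^bold>\<or> w \<and> q \<noteq> b}"
        by (simp add: pq compl_def)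
    next
      fix x y assume x: "x \<in> {x \<in> splittings_above a b w. lt (fst x) v \<or> fst x = v}"
        and y: "y \<in> {x \<in> splittings_above a b w. lt (fst x) v \<or> fst x = v}" and lt: "split_lt x y"
      obtain p q p' q' where pq: "x = (p, q)" "y = (p', q')" by (cases x; cases y)
      note X = XD[OF x[unfolded pq]] XD[OF y[unfolded pq]]
      note C = complD[OF X(1)] complD[OF X(5)]
      have "p \<^bold>\<or> w \<preceq> p' \<^bold>\<or> w" using join_mono[of p p' w] C lt by (simp add: pq split_lt_def)
      moreover have "p \<^bold>\<or> w \<noteq> p' \<^bold>\<or> w"
        using inj[of p] inj[of p'] C X lt by (auto simp: pq split_lt_def)
      ultimately show "lt (fst (case y of (p, q) \<Rightarrow> (q, p \<^bold>\<or> w))) (fst (case x of (p, q) \<Rightarrow> (q, p \<^bold>\<or> w))) \<and>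
          lt (snd (case x of (p, q) \<Rightarrow> (q, p \<^bold>\<or> w))) (snd (case y of (p, q) \<Rightarrow> (q, p \<^bold>\<or> w)))"
        using lt by (simp add: pq split_lt_def)
    qed
  qed
qed

end

text \<open>Stated outside the locale so that the induction ranges over the lattice operations too:
  the fibre over \<open>v\<close> calls the hypothesis for the dual lattice. The measure drops above
  a splitting because \<open>p\<close> differs from \<open>a\<close>, and in a fibre because the
  join of \<open>v\<close> and \<open>w\<close> differs from \<open>b\<close>.\<close>

lemma acyclic_splittings_above:
  fixes L :: "'l set" and le :: "'l \<Rightarrow> 'l \<Rightarrow> bool" and meet join :: "'l \<Rightarrow> 'l \<Rightarrow> 'l" and rk :: "'l \<Rightarrow> int"
  assumes "summand_lattice L le meet join rk good" "a \<in> L" "b \<in> L" "w \<in> L" "le a w" "le w b"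
  shows "acyclic_below (summand_lattice.split_lt le) (summand_lattice.splittings_above L le meet join good a b w)
    (nat (rk b - rk w))"
  using assms
proof (induction "nat (rk b - rk w)" arbitrary: le meet join rk a b w rule: less_induct)
  case less
  interpret summand_lattice L le meet join rk good by (rule less.prems(1))
  interpret d: summand_lattice L "\<lambda>x y. le y x" join meet "\<lambda>x. - rk x" good by (rule dual)
  note [simp] = less.prems(2-4)
  note aw = less.prems(5) and wb = less.prems(6)
  let ?X = "splittings_above a b w" and ?Y = "partial_complements a b w"
  let ?k = "nat (rk b - rk w)"
  have XD: "compl a b p q" "le w q" "p \<noteq> a" if "(p, q) \<in> ?X" for p q
    using that by (auto simp: splittings_above_def)
  have YD: "p \<in> L" "lt a p" "le p b" "meet p w = a" "good p w" if "p \<in> ?Y" for p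
    using that by (auto simp: partial_complements_def)
  have gX: "fst x \<in> ?Y" if "x \<in> ?X" for x
  proof -
    obtain p q where pq: "x = (p, q)" by (cases x)
    note X = XD[OF that[unfolded pq]]
    note C = complD[OF X(1)]
    have "meet p w = a"
    proof (rule le_antisym)
      have "le (meet p w) (meet p q)" using C X by (intro meet_greatest) (auto intro: meet_leI2)
      then show "le (meet p w) a" using C by simp
      show "le a (meet p w)" using C aw by (intro meet_greatest) auto
    qed (use C in auto)
    moreover have "good p w" using good_sub[of p q w] C X aw by simp
    ultimately show ?thesis using C X by (simp add: pq partial_complements_def)
  qed
  show ?case
  proof (rule acyclic_below_fibres[where Y = ?Y and lt' = lt and g = fst and
        rk = "\<lambda>x. nat (rk (fst x) - rk a)" and rk' = "\<lambda>y. nat (rk y - rk a)"])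
    show "nat (rk x - rk a) < nat (rk y - rk a)" if "x \<in> ?Y" "y \<in> ?Y" "lt x y" for x y
      using rk_less[of x y] rk_less[of a x] YD[OF that(1)] YD[OF that(2)] that(3) by auto
    show "nat (rk (fst x) - rk a) < nat (rk (fst y) - rk a)" if "x \<in> ?X" "y \<in> ?X" "split_lt x y" for x y
      using rk_less[of "fst x" "fst y"] rk_less[of a "fst x"] YD[OF gX[OF that(1)]] YD[OF gX[OF that(2)]] that(3)
      by (auto simp: split_lt_def)
    show "0 < nat (rk y - rk a)" if "y \<in> ?Y" for y
      using rk_less[of a y] YD[OF that] by auto
    show "lt x z" if "x \<in> ?Y" "y \<in> ?Y" "z \<in> ?Y" "lt x y" "lt y z" for x y z
      by (rule lt_trans[OF YD(1) YD(1) YD(1)]) (use that in auto)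
    show "fst x \<in> ?Y" if "x \<in> ?X" for x by (rule gX[OF that])
    show "lt (fst x) (fst y)" if "split_lt x y" for x y
      using that by (simp add: split_lt_def)
    show "acyclic_below split_lt {y \<in> ?X. split_lt x y} (?k - nat (rk (fst x) - rk a))" if "x \<in> ?X" for x
    proof -
      obtain p q where pq: "x = (p, q)" by (cases x)
      note X = XD[OF that[unfolded pq]]
      note C = complD[OF X(1)]
      have p: "rk a < rk p" using rk_less[of a p] C X by auto
      have q: "rk w \<le> rk q" using rk_le[of w q] C X by simp
      have "nat (rk q - rk w) < ?k" using p q C(13) by linarith
      then have "acyclic_below split_lt (splittings_above a q w) (nat (rk q - rk w))"
        using less.hyps[OF _ summand_lattice_axioms, of q w a] C X aw by simp
      \<comment> \<open>Ranks of a complementary pair add up to \<open>rk a + rk b\<close>, so the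
        range for \<open>q\<close> is precisely the one demanded of upper links.\<close>
      moreover have "nat (rk q - rk w) = ?k - nat (rk (fst x) - rk a)"
        using p q C(13) pq by simp
      ultimately show ?thesis
        using acyclic_splittings_up[of p q a b w] that by (simp add: pq)
    qed
    show "acyclic_below split_lt {x \<in> ?X. lt (fst x) v \<or> fst x = v} (nat (rk v - rk a))" if v: "v \<in> ?Y" for v
    proof (rule acyclic_splittings_fibre[OF v _ _ _ aw wb])
      note V = YD[OF v]
      note [simp] = V(1)
      assume ne: "join v w \<noteq> b"
      have rkvw: "rk (join v w) = rk v + rk w - rk a" using rk_modular[of v w] V by simp
      have vw: "le (join v w) b" using V wb by (intro join_least) auto
      then have "rk (join v w) < rk b" using ne by (intro rk_less) auto
      \<comment> \<open>In the dual lattice the interval runs from \<open>b\<close> down to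
        \<open>w\<close>, with the join of \<open>v\<close> and \<open>w\<close> in the role of
        \<open>w\<close>; its measure is \<open>rk v - rk a\<close>, the range wanted for the
        fibre.\<close>
      then have "nat (- rk w - - rk (join v w)) < ?k" using rkvw rk_less[of a v] V by simp
      then have *: "acyclic_below d.split_lt (d.splittings_above b w (join v w)) (nat (- rk w - - rk (join v w)))"
        using less.hyps[OF _ d.summand_lattice_axioms, of w "join v w" b] vw by simp
      have c: "d.compl b w q p \<longleftrightarrow> compl w b p q" for p q
        by (auto simp: d.compl_def compl_def meet_comm join_comm good_sym)
      have "d.splittings_above b w (join v w) = {(q, p). compl w b p q \<and> le p (join v w) \<and> q \<noteq> b}"
        by (auto simp: d.splittings_above_def c)
      moreover have "d.split_lt = (\<lambda>x y. lt (fst y) (fst x) \<and> lt (snd x) (snd y))"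
        by (auto simp: d.split_lt_def fun_eq_iff)
      moreover have "nat (- rk w - - rk (join v w)) = nat (rk v - rk a)" using rkvw by simp
      ultimately show "acyclic_below (\<lambda>x y. lt (fst y) (fst x) \<and> lt (snd x) (snd y))
          {(q, p). compl w b p q \<and> le p (join v w) \<and> q \<noteq> b} (nat (rk v - rk a))"
        using * by simp
    qed auto
    show "acyclic_below lt ?Y ?k"
      by (rule acyclic_partial_complements) (use aw wb in auto)
  qed auto
qed

section \<open>The weak topology\<close>

lemma closedin_closed_simplex:
  assumes "finite \<sigma>"
  shows "closedin (powertop_real UNIV) (closed_simplex \<sigma>)"
proof -
  let ?X = "powertop_real UNIV"
  have eq: "closed_simplex \<sigma> = (\<Inter>x. {t \<in> topspace ?X. t x \<in> {0..}}) \<inter>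
      (\<Inter>x. if x \<in> \<sigma> then topspace ?X else {t \<in> topspace ?X. t x \<in> {0}}) \<inter>
      {t \<in> topspace ?X. (\<Sum>x\<in>\<sigma>. t x) \<in> {1}}"
    by (auto simp: closed_simplex_def split: if_splits)
  have 1: "continuous_map ?X euclideanreal (\<lambda>t. t x)" for x
    by (rule continuous_map_product_projection) simp
  have 2: "continuous_map ?X euclideanreal (\<lambda>t. \<Sum>x\<in>\<sigma>. t x)"
    by (rule continuous_map_sum[OF assms 1])
  have "closedin ?X {t \<in> topspace ?X. t x \<in> {0..}}" "closedin ?X {t \<in> topspace ?X. t x \<in> {0}}" for x
    by (rule closedin_continuous_map_preimage[OF 1]; simp)+
  moreover have "closedin ?X {t \<in> topspace ?X. (\<Sum>x\<in>\<sigma>. t x) \<in> {1}}"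
    by (rule closedin_continuous_map_preimage[OF 2]) simp
  ultimately show ?thesis
    unfolding eq by (intro closedin_Int closedin_Inter) (auto simp del: topspace_product_topology)
qed

lemma closedin_geometric_realization:
  "closedin (geometric_realization A leq) C \<longleftrightarrow>
     C \<subseteq> realization_points A leq \<and>
     (\<forall>\<sigma>\<in>order_complex A leq. closedin (powertop_real UNIV) (C \<inter> closed_simplex \<sigma>))"
proof -
  have "openin (subtopology (powertop_real UNIV) (closed_simplex \<sigma>))
        ((realization_points A leq - C) \<inter> closed_simplex \<sigma>) \<longleftrightarrow>
      closedin (powertop_real UNIV) (C \<inter> closed_simplex \<sigma>)"
    if C: "C \<subseteq> realization_points A leq" and \<sigma>: "\<sigma> \<in> order_complex A leq" for \<sigma>
  proof -
    let ?S = "subtopology (powertop_real UNIV) (closed_simplex \<sigma>)"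
    have cl: "closedin (powertop_real UNIV) (closed_simplex \<sigma>)"
      using \<sigma> by (intro closedin_closed_simplex) (simp add: order_complex_def)
    have "(realization_points A leq - C) \<inter> closed_simplex \<sigma> = topspace ?S - (C \<inter> closed_simplex \<sigma>)"
      using \<sigma> by (auto simp: realization_points_eq_Union)
    then have "openin ?S ((realization_points A leq - C) \<inter> closed_simplex \<sigma>) \<longleftrightarrow> closedin ?S (C \<inter> closed_simplex \<sigma>)"
      by (simp add: closedin_def)
    also have "\<dots> \<longleftrightarrow> closedin (powertop_real UNIV) (C \<inter> closed_simplex \<sigma>)"
      using closedin_closed_subtopology[OF cl] by simp
    finally show ?thesis .
  qed
  then show ?thesis
    by (auto simp: closedin_def[of "geometric_realization A leq"] topspace_geometric_realization
        openin_geometric_realization)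
qed

lemma support_in_order_complex:
  assumes "t \<in> realization_points A leq"
  shows "{x. t x \<noteq> 0} \<in> order_complex A leq" "t \<in> closed_simplex {x. t x \<noteq> 0}"
proof -
  have "{x. t x \<noteq> 0} \<noteq> {}"
  proof
    assume "{x. t x \<noteq> 0} = {}"
    then have "(\<Sum>x | t x \<noteq> 0. t x) = 0" by (simp only: sum.empty)
    with assms show False by (simp add: realization_points_def)
  qed
  with assms show "{x. t x \<noteq> 0} \<in> order_complex A leq" "t \<in> closed_simplex {x. t x \<noteq> 0}"
    by (auto simp: realization_points_def order_complex_def closed_simplex_def)
qed

text \<open>If all values are supported in a finite set, a preimage is a union over finitely many
  closed simplices, on which the weak topology is that of the coordinates.\<close>

lemma continuous_map_into_realization:
  assumes V: "finite V" "\<And>z. z \<in> topspace Z \<Longrightarrow> {x. f z x \<noteq> 0} \<subseteq> V"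
    and pts: "\<And>z. z \<in> topspace Z \<Longrightarrow> f z \<in> realization_points A leq"
    and cont: "\<And>v. continuous_map Z euclideanreal (\<lambda>z. f z v)"
  shows "continuous_map Z (geometric_realization A leq) f"
  unfolding continuous_map_closedin topspace_geometric_realization
proof (intro conjI allI impI)
  show "f \<in> topspace Z \<rightarrow> realization_points A leq" using pts by blast
  fix C assume C: "closedin (geometric_realization A leq) C"
  let ?\<Sigma> = "{\<sigma> \<in> order_complex A leq. \<sigma> \<subseteq> V}"
  have cf: "continuous_map Z (powertop_real UNIV) f"
    using cont by (simp add: continuous_map_componentwise_UNIV)
  have "{z \<in> topspace Z. f z \<in> C} = (\<Union>\<sigma>\<in>?\<Sigma>. {z \<in> topspace Z. f z \<in> C \<inter> closed_simplex \<sigma>})"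
    using V(2) support_in_order_complex[OF pts] by blast
  moreover have "closedin Z (\<Union>\<sigma>\<in>?\<Sigma>. {z \<in> topspace Z. f z \<in> C \<inter> closed_simplex \<sigma>})"
  proof (rule closedin_Union)
    show "finite ((\<lambda>\<sigma>. {z \<in> topspace Z. f z \<in> C \<inter> closed_simplex \<sigma>}) ` ?\<Sigma>)"
      using V(1) by (intro finite_imageI finite_subset[of ?\<Sigma> "Pow V"]) auto
    show "closedin Z S" if "S \<in> (\<lambda>\<sigma>. {z \<in> topspace Z. f z \<in> C \<inter> closed_simplex \<sigma>}) ` ?\<Sigma>" for S
    proof -
      from that obtain \<sigma> where "\<sigma> \<in> order_complex A leq" "S = {z \<in> topspace Z. f z \<in> C \<inter> closed_simplex \<sigma>}"
        by blast
      with C show ?thesis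
        using closedin_continuous_map_preimage[OF cf, of "C \<inter> closed_simplex \<sigma>"]
        by (simp add: closedin_geometric_realization)
    qed
  qed
  ultimately show "closedin Z {z \<in> topspace Z. f z \<in> C}" by simp
qed

text \<open>Pick one point of \<open>S\<close> for each support that occurs. A closed simplex
  contains only finitely many of these points, so every subset of them is closed; in a compact set
  there can be only finitely many.\<close>

lemma compactin_realization_finite_support:
  assumes S: "compactin (geometric_realization A leq) S"
  shows "finite (\<Union>t\<in>S. {x. t x \<noteq> 0})"
proof -
  let ?X = "geometric_realization A leq"
  define supp where "supp t = {x. t x \<noteq> 0}" for t :: "'a \<Rightarrow> real"
  have SX: "S \<subseteq> realization_points A leq"
    using compactin_subset_topspace[OF S] by (simp add: topspace_geometric_realization)
  obtain D where D: "D \<subseteq> S" "inj_on supp D" "supp ` D = supp ` S"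
    using subset_image_inj[of "supp ` S" supp S] by auto
  have closed: "closedin ?X E" if "E \<subseteq> D" for E
    unfolding closedin_geometric_realization
  proof (intro conjI ballI)
    fix \<sigma> assume "\<sigma> \<in> order_complex A leq"
    then have "finite (Pow \<sigma>)" by (simp add: order_complex_def)
    moreover have "supp ` (E \<inter> closed_simplex \<sigma>) \<subseteq> Pow \<sigma>"
      by (auto simp: supp_def closed_simplex_def)
    moreover have "inj_on supp (E \<inter> closed_simplex \<sigma>)"
      using D(2) that by (auto intro: inj_on_subset)
    ultimately have "finite (E \<inter> closed_simplex \<sigma>)"
      by (meson finite_imageD finite_subset)
    moreover have "t1_space (powertop_real (UNIV :: 'a set))"
      by (simp add: t1_space_product_topology t1_space_euclidean)
    ultimately show "closedin (powertop_real UNIV) (E \<inter> closed_simplex \<sigma>)"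
      by (simp add: t1_space_closedin_finite)
  qed (use that D(1) SX in blast)
  have op: "openin ?X (topspace ?X - E)" if "E \<subseteq> D" for E
    using closed[OF that] by (simp add: closedin_def)
  \<comment> \<open>An open set that meets \<open>D\<close> in \<open>t\<close> alone; together with
    the complement of \<open>D\<close> these sets cover \<open>S\<close>, and a finite subcover
    bounds \<open>D\<close>.\<close>
  define U where "U t = topspace ?X - (D - {t})" for t
  have "S \<subseteq> \<Union>(insert (topspace ?X - D) (U ` D))"
    using SX by (auto simp: U_def topspace_geometric_realization)
  moreover have "openin ?X u" if "u \<in> insert (topspace ?X - D) (U ` D)" for u
    using that op[of D] op[of "D - {_}"] by (auto simp: U_def)
  ultimately obtain \<F> where F: "finite \<F>" "\<F> \<subseteq> insert (topspace ?X - D) (U ` D)" "S \<subseteq> \<Union>\<F>"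
    using compactinD[OF S, of "insert (topspace ?X - D) (U ` D)"] by blast
  have one: "\<exists>t. D \<inter> u \<subseteq> {t}" if "u \<in> \<F>" for u
    using that F(2) by (auto simp: U_def)
  have "finite (D \<inter> u)" if "u \<in> \<F>" for u
    using one[OF that] by (meson finite.emptyI finite.insertI finite_subset)
  then have "finite (\<Union>u\<in>\<F>. D \<inter> u)" using F(1) by blast
  moreover have "D \<subseteq> (\<Union>u\<in>\<F>. D \<inter> u)" using D(1) F(3) by blast
  ultimately have "finite D" by (rule finite_subset[rotated])
  then have "finite (supp ` S)" using D(3) by (metis finite_imageI)
  moreover have "finite (supp t)" if "t \<in> S" for t
    using that SX by (auto simp: supp_def realization_points_def)
  ultimately have "finite (\<Union>(supp ` S))" by blast
  then show ?thesis by (simp add: supp_def)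
qed

text \<open>On a given closed simplex only the finitely many coordinates of that simplex and of
  \<open>p\<close> impose a condition. These balls are the cover to which singular simplices are
  subdivided.\<close>

lemma openin_coordinate_ball:
  assumes p: "p \<in> realization_points A leq"
  shows "openin (geometric_realization A leq) {q \<in> realization_points A leq. \<forall>v. \<bar>q v - p v\<bar> < \<epsilon>}"
  unfolding openin_geometric_realization
proof (intro conjI ballI)
  fix \<sigma> assume \<sigma>: "\<sigma> \<in> order_complex A leq"
  let ?T = "powertop_real UNIV"
  let ?V = "\<sigma> \<union> {x. p x \<noteq> 0}"
  let ?B = "{q \<in> realization_points A leq. \<forall>v. \<bar>q v - p v\<bar> < \<epsilon>}"
  have fin: "finite ?V" using \<sigma> p by (auto simp: order_complex_def realization_points_def)
  show "openin (subtopology ?T (closed_simplex \<sigma>)) (?B \<inter> closed_simplex \<sigma>)"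
  proof (cases "0 < \<epsilon>")
    case True
    have "openin ?T {q \<in> topspace ?T. q v \<in> {p v - \<epsilon><..<p v + \<epsilon>}}" for v
      by (rule openin_continuous_map_preimage[of _ euclideanreal])
        (auto intro: continuous_map_product_projection)
    then have "openin ?T (topspace ?T \<inter> (\<Inter>v\<in>?V. {q \<in> topspace ?T. q v \<in> {p v - \<epsilon><..<p v + \<epsilon>}}))"
      using fin by (intro openin_Int_Inter) (auto simp del: topspace_product_topology)
    then have "openin (subtopology ?T (closed_simplex \<sigma>))
        (closed_simplex \<sigma> \<inter> (topspace ?T \<inter> (\<Inter>v\<in>?V. {q \<in> topspace ?T. q v \<in> {p v - \<epsilon><..<p v + \<epsilon>}})))"
      by (rule openin_subtopology_Int2)
    moreover have "?B \<inter> closed_simplex \<sigma> =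
        closed_simplex \<sigma> \<inter> (topspace ?T \<inter> (\<Inter>v\<in>?V. {q \<in> topspace ?T. q v \<in> {p v - \<epsilon><..<p v + \<epsilon>}}))"
      (is "?L = ?R")
    proof (intro equalityI subsetI)
      fix q assume "q \<in> ?L"
      then have q: "q \<in> closed_simplex \<sigma>" and lt: "\<bar>q v - p v\<bar> < \<epsilon>" for v by auto
      have "p v - \<epsilon> < q v \<and> q v < p v + \<epsilon>" for v
        using lt[of v] by (auto simp: abs_less_iff)
      with q show "q \<in> ?R" by auto
    next
      fix q assume q: "q \<in> ?R"
      then have q\<sigma>: "q \<in> closed_simplex \<sigma>" by blast
      have "\<bar>q v - p v\<bar> < \<epsilon>" for v
      proof (cases "v \<in> ?V")
        case True
        then have "q v \<in> {p v - \<epsilon><..<p v + \<epsilon>}" using q by blast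
        then show ?thesis by (auto simp: abs_less_iff)
      next
        case False
        then have "q v = 0" "p v = 0" using q\<sigma> by (auto simp: closed_simplex_def)
        with True show ?thesis by simp
      qed
      with q\<sigma> \<sigma> show "q \<in> ?L" by (auto simp: realization_points_eq_Union)
    qed
    ultimately show ?thesis by simp
  next
    case False
    then have "\<not> \<bar>q v - p v\<bar> < \<epsilon>" for q v by linarith
    then have "?B = {}" by blast
    then show ?thesis by (simp only: Int_empty_left openin_empty)
  qed
qed auto

section \<open>Affine simplices\<close>

text \<open>The affine map sending the i-th corner of the standard simplex to the vertex
  \<open>l ! i\<close>; coordinates at repeated vertices add up.\<close>

definition bary :: "'i list \<Rightarrow> (nat \<Rightarrow> real) \<Rightarrow> 'i \<Rightarrow> real" where
  "bary l t = (\<lambda>v. \<Sum>i<length l. if l ! i = v then t i else 0)"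

definition delete_nth :: "nat \<Rightarrow> 'i list \<Rightarrow> 'i list" where
  "delete_nth k l = take k l @ drop (Suc k) l"

abbreviation unit_vec :: "nat \<Rightarrow> nat \<Rightarrow> real" where
  "unit_vec i \<equiv> (\<lambda>j. if j = i then 1 else 0)"

lemma length_delete_nth [simp]: "k < length l \<Longrightarrow> length (delete_nth k l) = length l - 1"
  by (simp add: delete_nth_def)

lemma map_delete_nth: "map f (delete_nth k l) = delete_nth k (map f l)"
  by (simp add: delete_nth_def take_map drop_map)

lemma nth_delete_nth: "k < length l \<Longrightarrow> i < length l - 1 \<Longrightarrow>
  delete_nth k l ! i = (if i < k then l ! i else l ! Suc i)"
  by (auto simp: delete_nth_def nth_append min_def)

lemma delete_nth_upt:
  "k \<le> p \<Longrightarrow> delete_nth k [0..<Suc p] = map (\<lambda>i. if i < k then i else Suc i) [0..<p]"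
  by (rule nth_equalityI) (auto simp: nth_delete_nth simp del: upt_Suc)

lemma bary_face:
  assumes "length l = Suc p" "1 \<le> p" "k \<le> p"
  shows "bary l (simplical_face k x) = bary (delete_nth k l) x"
proof
  fix v
  have "bary l (simplical_face k x) v =
      (\<Sum>j\<le>p. if j < k then (if l ! j = v then x j else 0) else if j = k then 0
        else (if l ! Suc (j - Suc 0) = v then x (j - Suc 0) else 0))"
    unfolding bary_def simplical_face_def using assms
    by (intro sum.cong) (auto simp: less_Suc_eq_le)
  also have "\<dots> = (\<Sum>j\<le>p - Suc 0. if j < k then (if l ! j = v then x j else 0) else (if l ! Suc j = v then x j else 0))"
    by (rule sum.zero_middle[OF assms(2,3)])
  also have "\<dots> = bary (delete_nth k l) x v"
    unfolding bary_def using assms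
    by (intro sum.cong) (auto simp: nth_delete_nth)
  finally show "bary l (simplical_face k x) v = bary (delete_nth k l) x v" .
qed

lemma bary_nonneg: "(\<And>i. 0 \<le> t i) \<Longrightarrow> 0 \<le> bary l t v"
  by (auto simp: bary_def intro: sum_nonneg)

lemma bary_nonzeroD: "bary l t v \<noteq> 0 \<Longrightarrow> v \<in> set l"
  unfolding bary_def by (erule sum.not_neutral_contains_not_neutral) (auto split: if_splits)

lemma sum_bary: "finite V \<Longrightarrow> set l \<subseteq> V \<Longrightarrow> (\<Sum>v\<in>V. bary l t v) = (\<Sum>i<length l. t i)"
  unfolding bary_def
  by (subst sum.swap) (auto simp: sum.delta subset_iff intro!: sum.cong)

lemma bary_map: "finite V \<Longrightarrow> set l \<subseteq> V \<Longrightarrow> bary (map f l) t w = (\<Sum>v\<in>{v\<in>V. f v = w}. bary l t v)"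
  unfolding bary_def
  by (subst sum.swap) (auto simp: sum.delta' subset_iff intro!: sum.cong)

lemma simplexD:
  assumes "t \<in> standard_simplex (length l - 1)" "l \<noteq> []"
  shows "\<And>i. 0 \<le> t i" "(\<Sum>i<length l. t i) = 1"
proof -
  have "{..<length l} = {..length l - 1}" using assms(2) by (cases l) auto
  with assms show "\<And>i. 0 \<le> t i" "(\<Sum>i<length l. t i) = 1" by (auto simp: standard_simplex_def)
qed

lemma bary_closed_simplex:
  assumes "t \<in> standard_simplex (length l - 1)" "l \<noteq> []"
  shows "bary l t \<in> closed_simplex (set l)"
  using simplexD[OF assms] bary_nonneg[of t] bary_nonzeroD[of l t]
  by (auto simp: closed_simplex_def sum_bary)

lemma bary_standard_simplex:
  assumes "t \<in> standard_simplex (length l - 1)" "l \<noteq> []" "set l \<subseteq> {..p}"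
  shows "bary l t \<in> standard_simplex p"
proof -
  have one: "(\<Sum>v\<le>p. bary l t v) = 1"
    using simplexD[OF assms(1,2)] assms(3) by (simp add: sum_bary)
  have nn: "0 \<le> bary l t v" for v by (rule bary_nonneg) (rule simplexD[OF assms(1,2)])
  have zero: "bary l t v = 0" if "p < v" for v
    using bary_nonzeroD[of l t v] assms(3) that by fastforce
  have "bary l t v \<le> 1" for v
  proof (cases "v \<le> p")
    case True
    then have "bary l t v \<le> (\<Sum>v\<le>p. bary l t v)" by (intro member_le_sum) (auto simp: nn)
    then show ?thesis by (simp add: one)
  qed (simp add: zero)
  with one nn zero show ?thesis by (simp add: standard_simplex_def)
qed

lemma bary_upt:
  assumes "t \<in> standard_simplex p"
  shows "bary [0..<Suc p] t = t"
proof
  fix v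
  have "bary [0..<Suc p] t v = (\<Sum>i<Suc p. if i = v then t i else 0)"
    unfolding bary_def by (intro sum.cong) (auto simp del: upt_Suc)
  also have "\<dots> = t v" using assms by (auto simp: standard_simplex_def sum.delta)
  finally show "bary [0..<Suc p] t v = t v" .
qed

lemma continuous_map_bary:
  "continuous_map (subtopology (powertop_real UNIV) S) euclideanreal (\<lambda>t. bary l t v)"
  unfolding bary_def
  by (intro continuous_map_sum) (auto intro: continuous_map_from_subtopology continuous_map_product_projection)

definition affine_simplex :: "'i list \<Rightarrow> (nat \<Rightarrow> real) \<Rightarrow> 'i \<Rightarrow> real" where
  "affine_simplex l = restrict (bary l) (standard_simplex (length l - 1))"

lemma singular_simplex_affine_simplex:
  assumes l: "l \<in> chain_lists leq A" "length l = Suc p"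
  shows "singular_simplex p (geometric_realization A leq) (affine_simplex l)"
  unfolding singular_simplex_def
proof
  let ?Z = "subtopology (powertop_real UNIV) (standard_simplex p)"
  have ne: "l \<noteq> []" using l by auto
  have \<sigma>: "set l \<in> order_complex A leq" using l ne by (auto simp: order_complex_def chain_lists_def)
  have "continuous_map ?Z (geometric_realization A leq) (bary l)"
  proof (rule continuous_map_into_realization[of "set l"])
    fix z assume "z \<in> topspace ?Z"
    then have "bary l z \<in> closed_simplex (set l)" using l(2) ne by (intro bary_closed_simplex) auto
    with \<sigma> show "bary l z \<in> realization_points A leq" "{x. bary l z x \<noteq> 0} \<subseteq> set l"
      by (auto simp: realization_points_eq_Union closed_simplex_def)
  qed (auto intro: continuous_map_bary)
  then show "continuous_map ?Z (geometric_realization A leq) (affine_simplex l)"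
    by (rule continuous_map_eq) (simp add: affine_simplex_def l(2))
  show "affine_simplex l \<in> extensional (standard_simplex p)"
    by (simp add: affine_simplex_def l(2))
qed

lemma realization_map_bary: "realization_map f (bary l t) = bary (map f l) t"
proof
  fix w
  have "{x. bary l t x \<noteq> 0} \<subseteq> set l" using bary_nonzeroD by fast
  then have "realization_map f (bary l t) w = (\<Sum>x\<in>{x \<in> set l. f x = w}. bary l t x)"
    by (intro realization_map_eq_sum) auto
  then show "realization_map f (bary l t) w = bary (map f l) t w" using bary_map[of "set l" l f t w] by simp
qed

lemma simplex_map_affine_simplex:
  "length l = Suc p \<Longrightarrow> simplex_map p (realization_map f) (affine_simplex l) = affine_simplex (map f l)"
  by (auto simp: simplex_map_def affine_simplex_def realization_map_bary restrict_def)

text \<open>Both affine simplices and the faces of a prism are of the form \<open>R\<close> below.\<close>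

lemma chain_boundary_lists:
  fixes R :: "'i list \<Rightarrow> (nat \<Rightarrow> real) \<Rightarrow> 'b"
  assumes face: "\<And>l p k. length l = Suc p \<Longrightarrow> 1 \<le> p \<Longrightarrow> k \<le> p \<Longrightarrow> singular_face p k (R l) = R (delete_nth k l)"
    and c: "c \<in> chains_in K (Suc p)" and p: "1 \<le> p"
  shows "chain_boundary p (frag_map R c) = frag_map R (boundary c)"
proof -
  have "frag_extend (\<lambda>l. chain_boundary p (frag_of (R l))) c = frag_extend (\<lambda>l. frag_map R (list_boundary l)) c"
  proof (rule frag_extend_eq_chains_in[OF c])
    fix l :: "'i list" assume l: "length l = Suc p"
    have "chain_boundary p (frag_of (R l)) = (\<Sum>k\<le>p. frag_cmul ((-1) ^ k) (frag_of (R (delete_nth k l))))"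
      using p l by (simp add: chain_boundary_of face)
    also have "\<dots> = frag_map R (list_boundary l)"
      by (simp add: list_boundary_altdef l frag_extend_sum o_def frag_extend_cmul delete_nth_def lessThan_Suc_atMost)
    finally show "chain_boundary p (frag_of (R l)) = frag_map R (list_boundary l)" .
  qed
  moreover have "chain_boundary p (frag_map R c) = frag_extend (\<lambda>l. chain_boundary p (frag_of (R l))) c"
    using p by (simp add: chain_boundary_def frag_extend_extend)
  moreover have "frag_map R (boundary c) = frag_extend (\<lambda>l. frag_map R (list_boundary l)) c"
    by (rule frag_extend_extend)
  ultimately show ?thesis by metis
qed

lemma singular_face_affine_simplex:
  assumes "length l = Suc p" "1 \<le> p" "k \<le> p"
  shows "singular_face p k (affine_simplex l) = affine_simplex (delete_nth k l)"
  using assms simplical_face_in_standard_simplex[OF assms(2,3)]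
  by (auto simp: singular_face_def affine_simplex_def restrict_def bary_face fun_eq_iff)

section \<open>Prisms\<close>

text \<open>The usual triangulation of a simplex times an interval: \<open>False\<close> marks the
  bottom copy, \<open>True\<close> the top, and the summands differ in the entry where the list
  changes from bottom to top.\<close>

primrec prism :: "'i list \<Rightarrow> ('i \<times> bool) list \<Rightarrow>\<^sub>0 int" where
  "prism [] = 0"
| "prism (a # l) = frag_of ((a, False) # map (\<lambda>i. (i, True)) (a # l)) - frag_map ((#) (a, False)) (prism l)"

lemma boundary_prism:
  "boundary (prism l) = frag_of (map (\<lambda>i. (i, True)) l) - frag_of (map (\<lambda>i. (i, False)) l)
    - frag_extend prism (list_boundary l)"
proof (induction l)
  case (Cons a l)
  have "frag_extend prism (frag_map ((#) a) (list_boundary l)) =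
      frag_map (\<lambda>m. (a, False) # (a, True) # map (\<lambda>i. (i, True)) m) (list_boundary l)
      - frag_map ((#) (a, False)) (frag_extend prism (list_boundary l))"
    by (simp add: frag_extend_extend frag_extend_fun_diff)
  moreover have "boundary (prism (a # l)) = frag_of (map (\<lambda>i. (i, True)) (a # l))
      - frag_map ((#) (a, False)) (list_boundary (map (\<lambda>i. (i, True)) (a # l)))
      - (prism l - frag_map ((#) (a, False)) (boundary (prism l)))"
    by (simp only: prism.simps frag_extend_diff boundary_Cons frag_extend_of list_boundary.simps)
  ultimately show ?case
    by (simp add: Cons frag_extend_diff list_boundary_map frag_extend_extend)
qed simp

lemma prism_map: "prism (map g l) = frag_map (map (map_prod g id)) (prism l)"
  by (induction l) (auto simp: frag_extend_diff frag_extend_extend o_def)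

lemma prism_chains_in: "prism l \<in> chains_in {m. set m \<subseteq> set l \<times> UNIV} (Suc (length l))"
proof (induction l)
  case (Cons a l)
  have "frag_map ((#) (a, False)) (prism l) \<in> chains_in {m. set m \<subseteq> set (a # l) \<times> UNIV} (Suc (length (a # l)))"
    by (rule chains_in_extend[OF Cons.IH]) auto
  then show ?case by (auto intro!: chains_in_diff)
qed simp

text \<open>The weak topology is finer than the one inherited from the product.\<close>

lemma continuous_map_realization_coordinate:
  "continuous_map (geometric_realization A leq) euclideanreal (\<lambda>q. q v)"
  unfolding continuous_map_def topspace_geometric_realization
proof (intro conjI allI impI)
  fix U :: "real set" assume U: "openin euclideanreal U"
  have op: "openin (powertop_real UNIV) {q \<in> topspace (powertop_real UNIV). q v \<in> U}"
    by (rule openin_continuous_map_preimage[OF _ U]) (auto intro: continuous_map_product_projection)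
  show "openin (geometric_realization A leq) {q \<in> realization_points A leq. q v \<in> U}"
    unfolding openin_geometric_realization
  proof (intro conjI ballI)
    fix \<sigma> assume "\<sigma> \<in> order_complex A leq"
    then have "{q \<in> realization_points A leq. q v \<in> U} \<inter> closed_simplex \<sigma> =
        closed_simplex \<sigma> \<inter> {q \<in> topspace (powertop_real UNIV). q v \<in> U}"
      by (auto simp: realization_points_eq_Union)
    then show "openin (subtopology (powertop_real UNIV) (closed_simplex \<sigma>))
        ({q \<in> realization_points A leq. q v \<in> U} \<inter> closed_simplex \<sigma>)"
      by (simp only: openin_subtopology_Int2[OF op])
  qed auto
qed auto

text \<open>A list of vertices of the prism over the \<open>p\<close>-simplex is sent to the straight-line homotopy from \<open>f\<close>
  to the affine simplex with vertices \<open>vs\<close>.\<close>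

definition prism_simplex ::
  "'y list \<Rightarrow> ((nat \<Rightarrow> real) \<Rightarrow> 'y \<Rightarrow> real) \<Rightarrow> (nat \<times> bool) list \<Rightarrow> (nat \<Rightarrow> real) \<Rightarrow> 'y \<Rightarrow> real" where
  "prism_simplex vs f l = restrict (\<lambda>t v. (1 - bary (map snd l) t True) * f (bary (map fst l) t) v
      + bary (map snd l) t True * bary vs (bary (map fst l) t) v) (standard_simplex (length l - 1))"

lemma singular_face_prism_simplex:
  assumes "length l = Suc p" "1 \<le> p" "k \<le> p"
  shows "singular_face p k (prism_simplex vs f l) = prism_simplex vs f (delete_nth k l)"
proof -
  have "bary (map g l) (simplical_face k x) = bary (map g (delete_nth k l)) x" for g :: "nat \<times> bool \<Rightarrow> 'c" and x
    using bary_face[of "map g l" p k x] assms by (simp add: map_delete_nth)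
  note this[of fst] this[of snd]
  then show ?thesis
    using assms simplical_face_in_standard_simplex[OF assms(2,3)]
    by (auto simp: singular_face_def prism_simplex_def restrict_def)
qed

lemma closed_simplex_convex:
  assumes "q \<in> closed_simplex \<tau>" "q' \<in> closed_simplex \<tau>" "0 \<le> s" "s \<le> 1"
  shows "(\<lambda>v. (1 - s) * q v + s * q' v) \<in> closed_simplex \<tau>"
proof -
  have "q x = 0 \<and> q' x = 0" if "x \<notin> \<tau>" for x
    using assms(1,2) that by (auto simp: closed_simplex_def)
  then have "{x. (1 - s) * q x + s * q' x \<noteq> 0} \<subseteq> \<tau>" by fastforce
  then show ?thesis
    using assms by (auto simp: closed_simplex_def sum.distrib simp flip: sum_distrib_left)
qed

lemma closed_simplex_mono:
  assumes "q \<in> closed_simplex \<sigma>" "\<sigma> \<subseteq> \<tau>" "finite \<tau>"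
  shows "q \<in> closed_simplex \<tau>"
proof -
  have "(\<Sum>x\<in>\<sigma>. q x) = (\<Sum>x\<in>\<tau>. q x)"
    using assms by (intro sum.mono_neutral_left) (auto simp: closed_simplex_def)
  with assms show ?thesis by (auto simp: closed_simplex_def)
qed

text \<open>At every point the vertices \<open>vs\<close> belong to the support of \<open>f\<close>,
  so the segment from \<open>f\<close> to the affine simplex stays in one closed simplex. Continuity
  holds because the image of \<open>f\<close> is compact and so involves finitely many
  vertices.\<close>

lemma singular_simplex_prism_simplex:
  assumes f: "singular_simplex p (geometric_realization A leq) f"
    and vs: "length vs = Suc p" "\<And>x. x \<in> standard_simplex p \<Longrightarrow> set vs \<subseteq> {v. f x v \<noteq> 0}"
    and l: "length l = Suc q" "set l \<subseteq> {..p} \<times> UNIV"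
  shows "singular_simplex q (geometric_realization A leq) (prism_simplex vs f l)"
  unfolding singular_simplex_def
proof
  let ?Z = "subtopology (powertop_real UNIV) (standard_simplex q)"
  let ?D = "subtopology (powertop_real UNIV) (standard_simplex p)"
  let ?G = "geometric_realization A leq"
  define u where "u t = bary (map fst l) t" for t
  define s where "s t = bary (map snd l) t True" for t
  define F where "F t v = (1 - s t) * f (u t) v + s t * bary vs (u t) v" for t v
  have fD: "continuous_map ?D ?G f" using f by (simp add: singular_simplex_def)
  have ne: "map fst l \<noteq> []" "map snd l \<noteq> []" "vs \<noteq> []" using l vs by auto
  have u_in: "u t \<in> standard_simplex p" if "t \<in> standard_simplex q" for t
    unfolding u_def using that l ne by (intro bary_standard_simplex) auto
  have s_in: "0 \<le> s t" "s t \<le> 1" if "t \<in> standard_simplex q" for t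
  proof -
    have t: "t \<in> standard_simplex (length (map snd l) - 1)" using that l by simp
    note S = simplexD[OF t ne(2)]
    show "0 \<le> s t" unfolding s_def by (rule bary_nonneg) (rule S)
    have "bary (map snd l) t True \<le> (\<Sum>i<length (map snd l). t i)"
      unfolding bary_def using S(1) by (intro sum_mono) auto
    then show "s t \<le> 1" unfolding s_def by (simp only: S(2))
  qed
  have uc: "continuous_map ?Z ?D u"
    unfolding continuous_map_in_subtopology continuous_map_componentwise_UNIV u_def
    using u_in by (auto simp: u_def continuous_map_bary)
  have sc: "continuous_map ?Z euclideanreal s"
    unfolding s_def by (rule continuous_map_bary)
  define V where "V = (\<Union>t\<in>f ` standard_simplex p. {x. t x \<noteq> 0})"
  have "compactin ?G (f ` standard_simplex p)"
    by (rule image_compactin[OF _ fD]) (simp add: compactin_subtopology compactin_standard_simplex)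
  then have V: "finite V" unfolding V_def by (rule compactin_realization_finite_support)
  have "continuous_map ?Z ?G F"
  proof (rule continuous_map_into_realization[OF V])
    fix t assume "t \<in> topspace ?Z"
    then have t: "t \<in> standard_simplex q" by simp
    let ?\<tau> = "{x. f (u t) x \<noteq> 0}"
    have fu: "f (u t) \<in> realization_points A leq"
      using continuous_map_image_subset_topspace[OF fD] u_in[OF t] by (auto simp: topspace_geometric_realization)
    note \<tau> = support_in_order_complex[OF fu]
    have fin: "finite ?\<tau>" using \<tau>(1) by (simp add: order_complex_def)
    have "bary vs (u t) \<in> closed_simplex (set vs)"
      using u_in[OF t] vs(1) ne by (intro bary_closed_simplex) auto
    then have "bary vs (u t) \<in> closed_simplex ?\<tau>"
      using closed_simplex_mono vs(2)[OF u_in[OF t]] fin by blast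
    then have F: "F t \<in> closed_simplex ?\<tau>"
      unfolding F_def[abs_def] by (intro closed_simplex_convex \<tau>(2) s_in[OF t])
    with \<tau>(1) show "F t \<in> realization_points A leq" by (auto simp: realization_points_eq_Union)
    have "?\<tau> \<subseteq> V" using u_in[OF t] by (auto simp: V_def)
    with F show "{x. F t x \<noteq> 0} \<subseteq> V" by (auto simp: closed_simplex_def)
  next
    fix v
    have "continuous_map ?Z euclideanreal (\<lambda>t. f (u t) v)"
      using continuous_map_compose[OF continuous_map_compose[OF uc fD] continuous_map_realization_coordinate]
      by (simp add: o_def)
    moreover have "continuous_map ?Z euclideanreal (\<lambda>t. bary vs (u t) v)"
      using continuous_map_compose[OF uc continuous_map_bary] by (simp add: o_def)
    ultimately show "continuous_map ?Z euclideanreal (\<lambda>t. F t v)"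
      unfolding F_def
      by (intro continuous_map_add continuous_map_real_mult continuous_map_diff sc) auto
  qed
  then show "continuous_map ?Z ?G (prism_simplex vs f l)"
    by (rule continuous_map_eq) (simp add: prism_simplex_def l(1) F_def[abs_def] u_def s_def)
  show "prism_simplex vs f l \<in> extensional (standard_simplex q)"
    by (simp add: prism_simplex_def l(1))
qed

lemma simplical_face_bary:
  "simplical_face k (bary m t) = bary (map (\<lambda>i. if i < k then i else Suc i) m) t"
proof
  fix w
  have "simplical_face k (bary m t) w = (\<Sum>i<length m. if (if m ! i < k then m ! i else Suc (m ! i)) = w then t i else 0)"
  proof -
    consider "w < k" | "w = k" | w' where "w = Suc w'" "k \<le> w'"
      by (metis Suc_le_lessD gr0_implies_Suc less_Suc_eq_le linorder_neqE_nat not_less0 Suc_lessE)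
    then show ?thesis
      by cases (auto simp: simplical_face_def bary_def intro!: sum.cong sum.neutral)
  qed
  also have "\<dots> = bary (map (\<lambda>i. if i < k then i else Suc i) m) t w"
    unfolding bary_def by (intro sum.cong) auto
  finally show "simplical_face k (bary m t) w = bary (map (\<lambda>i. if i < k then i else Suc i) m) t w" .
qed

text \<open>Naturality of the straight-line homotopy under faces; it identifies the sides of a prism
  with the prisms over the faces.\<close>

lemma prism_simplex_singular_face:
  assumes vs: "length vs = Suc p" and p: "1 \<le> p" "k \<le> p"
    and l: "l \<noteq> []" "set l \<subseteq> {..<p} \<times> UNIV"
  shows "prism_simplex (delete_nth k vs) (singular_face p k f) l =
    prism_simplex vs f (map (map_prod (\<lambda>i. if i < k then i else Suc i) id) l)"
proof -
  let ?\<delta> = "\<lambda>i. if i < k then i else Suc i"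
  have "(1 - bary (map snd l) t True) * singular_face p k f (bary (map fst l) t) v
      + bary (map snd l) t True * bary (delete_nth k vs) (bary (map fst l) t) v =
    (1 - bary (map snd l) t True) * f (bary (map ?\<delta> (map fst l)) t) v
      + bary (map snd l) t True * bary vs (bary (map ?\<delta> (map fst l)) t) v"
    if "t \<in> standard_simplex (length l - 1)" for t v
  proof -
    have "bary (map fst l) t \<in> standard_simplex (p - 1)"
      using that l p by (intro bary_standard_simplex) (auto simp: subset_iff)
    then have "singular_face p k f (bary (map fst l) t) = f (bary (map ?\<delta> (map fst l)) t)"
      by (simp add: singular_face_def simplical_face_bary)
    moreover have "bary (delete_nth k vs) (bary (map fst l) t) = bary vs (bary (map ?\<delta> (map fst l)) t)"
      using bary_face[OF vs p, of "bary (map fst l) t"] by (simp add: simplical_face_bary)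
    ultimately show ?thesis by simp
  qed
  then show ?thesis
    by (auto simp: prism_simplex_def restrict_def fun_eq_iff o_def fst_map_prod snd_map_prod)
qed

lemma prism_simplex_top:
  "length vs = Suc p \<Longrightarrow> prism_simplex vs f (map (\<lambda>i. (i, True)) [0..<Suc p]) = affine_simplex vs"
proof -
  assume vs: "length vs = Suc p"
  have "bary (map (\<lambda>_. True) [0..<Suc p]) t True = 1" if "t \<in> standard_simplex p" for t
    using that by (auto simp: bary_def standard_simplex_def lessThan_Suc_atMost simp del: upt_Suc)
  then show ?thesis
    using vs by (auto simp: prism_simplex_def affine_simplex_def restrict_def fun_eq_iff o_def bary_upt
        simp del: upt_Suc)
qed

lemma prism_simplex_bottom:
  assumes "singular_simplex p X f"
  shows "prism_simplex vs f (map (\<lambda>i. (i, False)) [0..<Suc p]) = f"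
proof -
  have "bary (map (\<lambda>_. False) [0..<Suc p]) t True = 0" for t
    by (auto simp: bary_def simp del: upt_Suc)
  then have "prism_simplex vs f (map (\<lambda>i. (i, False)) [0..<Suc p]) = restrict f (standard_simplex p)"
    by (auto simp: prism_simplex_def restrict_def fun_eq_iff o_def bary_upt simp del: upt_Suc)
  then show ?thesis using assms by (simp add: singular_simplex_def extensional_restrict)
qed

section \<open>Surjectivity in singular homology\<close>

text \<open>The vertex chosen at a corner depends on the point only and not on the simplex, so
  adjacent simplices receive matching vertices.\<close>

definition vertex_list :: "(('y \<Rightarrow> real) \<Rightarrow> 'y) \<Rightarrow> nat \<Rightarrow> ((nat \<Rightarrow> real) \<Rightarrow> 'y \<Rightarrow> real) \<Rightarrow> 'y list" where
  "vertex_list vx p f = map (\<lambda>i. vx (f (unit_vec i))) [0..<Suc p]"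

lemma vertex_list_face:
  assumes "1 \<le> q" "k \<le> q"
  shows "vertex_list vx (q - 1) (singular_face q k f) = delete_nth k (vertex_list vx q f)"
proof -
  let ?\<delta> = "\<lambda>i. if i < k then i else Suc i"
  have "singular_face q k f (unit_vec i) = f (unit_vec (?\<delta> i))" if "i < q" for i
  proof -
    have "unit_vec i \<in> standard_simplex (q - 1)" using that by simp
    moreover have "simplical_face k (unit_vec i) = unit_vec (?\<delta> i)"
      by (auto simp: simplical_face_def fun_eq_iff)
    ultimately show ?thesis by (simp add: singular_face_def)
  qed
  moreover have "[0..<Suc (q - 1)] = [0..<q]" using assms by simp
  ultimately show ?thesis
    using assms unfolding vertex_list_def by (simp add: delete_nth_upt flip: map_delete_nth del: upt_Suc)
qed

lemma singular_chain_affine: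
  assumes "c \<in> chains_in (chain_lists leq A) (Suc p)"
  shows "singular_chain p (geometric_realization A leq) (frag_map affine_simplex c)"
  using assms keys_frag_extend[of "\<lambda>l. frag_of (affine_simplex l)" c] singular_simplex_affine_simplex[of _ leq A p]
  unfolding singular_chain_def chains_in_def by fastforce

lemma chain_boundary_frag_extend:
  "1 \<le> p \<Longrightarrow> chain_boundary p c = frag_extend (\<lambda>f. chain_boundary p (frag_of f)) c"
  by (simp add: chain_boundary_def)

text \<open>Serves the case of 0-cycles, whose augmented boundary is a possibly nonzero multiple of
  the empty list.\<close>

lemma frag_extend_length_0: "c \<in> chains_in K 0 \<Longrightarrow> h [] = 0 \<Longrightarrow> frag_extend h c = 0"
  by (rule frag_extend_eq_0) (auto simp: chains_in_def)

text \<open>Three homologies are composed: from \<open>z\<close> to a small cycle \<open>z'\<close>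
  by subdivision, from \<open>z'\<close> to the affine cycle of the lists \<open>t\<close> by
  prisms, and from there to the image of the lift \<open>P t\<close> by \<open>h\<close>.\<close>

lemma hom_induced_surjective:
  fixes rk :: "'y \<Rightarrow> nat"
  assumes reflY: "\<And>y. y \<in> Y \<Longrightarrow> leq' y y"
    and antisymY: "\<And>x y. x \<in> Y \<Longrightarrow> y \<in> Y \<Longrightarrow> leq' x y \<Longrightarrow> leq' y x \<Longrightarrow> x = y"
    and transY: "\<And>x y z. x \<in> Y \<Longrightarrow> y \<in> Y \<Longrightarrow> z \<in> Y \<Longrightarrow> leq' x y \<Longrightarrow> leq' y z \<Longrightarrow> leq' x z"
    and reflX: "\<And>x. x \<in> X \<Longrightarrow> leq x x"
    and f: "f ` X \<subseteq> Y" "monotone_on X leq leq' f"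
    and rk: "\<And>x y. x \<in> Y \<Longrightarrow> y \<in> Y \<Longrightarrow> leq' x y \<Longrightarrow> x \<noteq> y \<Longrightarrow> rk x < rk y"
      "\<And>y. y \<in> Y \<Longrightarrow> 0 < rk y" "\<And>y. y \<in> Y \<Longrightarrow> rk y \<le> N"
    and fibre: "\<And>y. y \<in> Y \<Longrightarrow> acyclic_below (\<lambda>x y. leq x y \<and> x \<noteq> y) {x \<in> X. leq' (f x) y} (rk y)"
    and c: "c \<in> carrier (homology_group (int p) (geometric_realization Y leq'))"
  shows "\<exists>d\<in>carrier (homology_group (int p) (geometric_realization X leq)).
    hom_induced (int p) (geometric_realization X leq) {} (geometric_realization Y leq') {} (realization_map f) d = c"
proof -
  let ?X = "geometric_realization X leq" and ?Y = "geometric_realization Y leq'"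
  let ?K = "chain_lists leq' Y"
  obtain P h where P: "P [] = frag_of []"
    "\<And>ys. ys \<in> ?K \<Longrightarrow> P ys \<in> chains_in (chain_lists leq X) (length ys)"
    "\<And>ys. ys \<in> ?K \<Longrightarrow> boundary (P ys) = frag_extend P (list_boundary ys)"
    and h: "h [] = 0"
    "\<And>ys. ys \<in> ?K \<Longrightarrow> h ys \<in> chains_in ?K (Suc (length ys))"
    "\<And>ys. ys \<in> ?K \<Longrightarrow> boundary (h ys) = frag_of ys - frag_map (map f) (P ys) - frag_extend h (list_boundary ys)"
  proof (rule lift_chains[where X = X and leq = leq and f = f and Y = Y and leq' = leq' and rk = rk])
    show "leq' (f x) (f y)" if "x \<in> X" "y \<in> X" "leq x y" for x y
      using f(2) that by (auto dest: monotone_onD)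
    show "f x \<in> Y" if "x \<in> X" for x using f(1) that by blast
  qed (rule reflY antisymY transY reflX rk(1) rk(2) fibre that; assumption)+
  obtain z where z: "singular_relcycle p ?Y {} z" "c = homologous_rel_set p ?Y {} z"
    using c by (auto simp: carrier_relative_homology_group)
  \<comment> \<open>A simplex has at most \<open>N\<close> vertices, since \<open>rk\<close> is
    injective on it with values from 1 to \<open>N\<close>; some coordinate is therefore at least
    \<open>1 / M\<close>. The successor keeps \<open>M\<close> positive when \<open>N\<close> is
    0.\<close>
  define M where "M = real (Suc N)"
  have M: "0 < M" by (simp add: M_def)
  have "\<exists>v. 1 / M \<le> t v" if t: "t \<in> realization_points Y leq'" for t
  proof (rule ccontr)
    assume "\<not> ?thesis"
    then have less: "t v < 1 / M" for v by (simp add: not_le)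
    let ?S = "{x. t x \<noteq> 0}"
    have S: "?S \<in> order_complex Y leq'" by (rule support_in_order_complex[OF t])
    have "inj_on rk ?S"
    proof (rule inj_onI)
      fix x y assume xy: "x \<in> ?S" "y \<in> ?S" "rk x = rk y"
      with S have "x \<in> Y" "y \<in> Y" "leq' x y \<or> leq' y x"
        by (auto simp: order_complex_def Complete_Partial_Order.chain_def)
      with rk(1)[of x y] rk(1)[of y x] xy(3) show "x = y" by auto
    qed
    moreover have "rk ` ?S \<subseteq> {1..N}" using S rk(2,3) by (auto simp: order_complex_def Suc_le_eq)
    ultimately have "card ?S \<le> N" using card_inj_on_le[of rk ?S "{1..N}"] by simp
    have "1 = (\<Sum>x\<in>?S. t x)" using t by (simp add: realization_points_def)
    also have "\<dots> < (\<Sum>x\<in>?S. 1 / M)"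
      using S less by (intro sum_strict_mono) (auto simp: order_complex_def)
    also have "\<dots> = real (card ?S) / M" by simp
    also have "\<dots> \<le> 1" using \<open>card ?S \<le> N\<close> by (simp add: M_def)
    finally show False by simp
  qed
  then obtain vx where vx: "\<And>t. t \<in> realization_points Y leq' \<Longrightarrow> 1 / M \<le> t (vx t)"
    by metis
  \<comment> \<open>With this radius two points of a ball differ by less than \<open>1 / M\<close>
    in each coordinate, so a coordinate that is at least \<open>1 / M\<close> at one of them is
    nonzero at the other.\<close>
  define ball where "ball q = {q' \<in> realization_points Y leq'. \<forall>v. \<bar>q' v - q v\<bar> < 1 / (2 * M)}" for q :: "'y \<Rightarrow> real"
  obtain z' where z': "singular_relcycle p ?Y {} z'" "homologous_rel p ?Y {} z z'"
    and fine: "\<And>g. g \<in> Poly_Mapping.keys z' \<Longrightarrow> \<exists>V\<in>ball ` realization_points Y leq'. g \<in> standard_simplex p \<rightarrow> V"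
  proof (rule small_homologous_rel_relcycle_exists[of "ball ` realization_points Y leq'" ?Y p "{}" z])
    show "openin ?Y U" if "U \<in> ball ` realization_points Y leq'" for U
      using that openin_coordinate_ball unfolding ball_def by blast
    show "topspace ?Y \<subseteq> \<Union> (ball ` realization_points Y leq')"
      using M by (auto simp: topspace_geometric_realization ball_def)
  qed (use z in auto)
  define small where "small q g \<longleftrightarrow> singular_simplex q ?Y g \<and>
      (\<forall>x\<in>standard_simplex q. \<forall>y\<in>standard_simplex q. \<forall>v. \<bar>g x v - g y v\<bar> < 1 / M)" for q g
  have z'_chain: "singular_chain p ?Y z'" and z'_bd: "chain_boundary p z' = 0"
    using z'(1) by (auto simp: singular_cycle)
  have z'_small: "small p g" if g: "g \<in> Poly_Mapping.keys z'" for g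
  proof -
    obtain q where q: "g \<in> standard_simplex p \<rightarrow> ball q" using fine[OF g] by blast
    have "\<bar>g x v - g y v\<bar> < 1 / M" if "x \<in> standard_simplex p" "y \<in> standard_simplex p" for x y v
    proof -
      have "\<bar>g x v - q v\<bar> < 1 / (2 * M)" "\<bar>g y v - q v\<bar> < 1 / (2 * M)"
        using q that by (auto simp: ball_def)
      moreover have "1 / M = 1 / (2 * M) + 1 / (2 * M)" using M by (simp add: field_simps)
      ultimately show ?thesis by linarith
    qed
    then show ?thesis using g z'_chain by (auto simp: small_def singular_chain_def)
  qed
  have small_face: "small (q - 1) (singular_face q k g)" if "small q g" "1 \<le> q" "k \<le> q" for q k g
    using that simplical_face_in_standard_simplex[OF that(2,3)] singular_simplex_singular_face[of q ?Y g k]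
    by (simp add: small_def singular_face_def)
  let ?vl = "vertex_list vx"
  have small_pts: "g x \<in> realization_points Y leq'" if "small q g" "x \<in> standard_simplex q" for q g x
    using that continuous_map_image_subset_topspace[of _ ?Y g]
    by (force simp: small_def singular_simplex_def topspace_geometric_realization)
  \<comment> \<open>This is where the constants meet: the vertex chosen at a corner lies in the
    support at every point of the small simplex, as the prism requires.\<close>
  have vl_supp: "set (?vl q g) \<subseteq> {v. g x v \<noteq> 0}" if g: "small q g" and x: "x \<in> standard_simplex q" for q g x
  proof
    fix v assume "v \<in> set (?vl q g)"
    then have "v \<in> (\<lambda>i. vx (g (unit_vec i))) ` {0..<Suc q}" by (simp add: vertex_list_def del: upt_Suc)
    then obtain i where i: "i \<le> q" "v = vx (g (unit_vec i))" by (auto simp: less_Suc_eq_le)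
    have e: "unit_vec i \<in> standard_simplex q" using i by simp
    have "1 / M \<le> g (unit_vec i) v" unfolding i(2) by (rule vx) (rule small_pts[OF g e])
    moreover have "\<bar>g (unit_vec i) v - g x v\<bar> < 1 / M" using g e x by (simp add: small_def)
    ultimately show "v \<in> {v. g x v \<noteq> 0}" by auto
  qed
  have vl_len: "length (?vl q g) = Suc q" for q g by (simp add: vertex_list_def)
  have vl_in: "?vl q g \<in> ?K" if "small q g" for q g
  proof -
    have e: "unit_vec 0 \<in> standard_simplex q" by simp
    have "{v. g (unit_vec 0) v \<noteq> 0} \<in> order_complex Y leq'"
      by (rule support_in_order_complex(1)) (rule small_pts[OF that e])
    with vl_supp[OF that e] show ?thesis
      by (auto simp: order_complex_def chain_lists_def Complete_Partial_Order.chain_def subset_iff)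
  qed
  define PR where "PR q g = frag_map (prism_simplex (?vl q g) g) (prism [0..<Suc q])" for q g
  have prism_in: "prism [0..<Suc q] \<in> chains_in {m. set m \<subseteq> {..q} \<times> UNIV} (Suc (Suc q))" for q
    using prism_chains_in[of "[0..<Suc q]"] by (simp add: atLeast0LessThan lessThan_Suc_atMost del: upt_Suc)
  have PR_chain: "singular_chain (Suc q) ?Y (PR q g)" if g: "small q g" for q g
  proof -
    have "singular_simplex (Suc q) ?Y (prism_simplex (?vl q g) g m)"
      if "m \<in> Poly_Mapping.keys (prism [0..<Suc q])" for m
      using that prism_in[of q] vl_supp[OF g] g
      by (intro singular_simplex_prism_simplex[of q]) (auto simp: chains_in_def small_def vl_len)
    then show ?thesis
      using keys_frag_extend[of "\<lambda>m. frag_of (prism_simplex (?vl q g) g m)" "prism [0..<Suc q]"]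
      unfolding PR_def singular_chain_def by fastforce
  qed
  have PR_bd: "chain_boundary (Suc q) (PR q g) = frag_of (affine_simplex (?vl q g)) - frag_of g
      - (if q = 0 then 0 else frag_extend (PR (q - 1)) (chain_boundary q (frag_of g)))"
    if g: "small q g" for q g
  proof -
    let ?R = "prism_simplex (?vl q g) g"
    have "chain_boundary (Suc q) (PR q g) = frag_map ?R (boundary (prism [0..<Suc q]))"
      unfolding PR_def by (rule chain_boundary_lists[OF _ prism_in]) (auto simp: singular_face_prism_simplex)
    also have "\<dots> = frag_of (affine_simplex (?vl q g)) - frag_of g
        - frag_map ?R (frag_extend prism (list_boundary [0..<Suc q]))"
      using g by (simp add: boundary_prism frag_extend_diff prism_simplex_top[OF vl_len] prism_simplex_bottom[of q ?Y]
          small_def del: upt_Suc)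
    also have "frag_map ?R (frag_extend prism (list_boundary [0..<Suc q])) =
        (if q = 0 then 0 else frag_extend (PR (q - 1)) (chain_boundary q (frag_of g)))"
    proof (cases "q = 0")
      case False
      then have q: "1 \<le> q" by simp
      \<comment> \<open>A face inherits its vertex list, so its prism is a side of the prism over
        \<open>g\<close>; the sides then cancel along with the faces of the cycle.\<close>
      have face: "PR (q - 1) (singular_face q k g) = frag_map ?R (prism (delete_nth k [0..<Suc q]))" if k: "k \<le> q" for k
      proof -
        have "PR (q - 1) (singular_face q k g) =
            frag_map (prism_simplex (delete_nth k (?vl q g)) (singular_face q k g)) (prism [0..<Suc (q - 1)])"
          by (simp only: PR_def vertex_list_face[OF q k])
        also have "\<dots> = frag_extend (\<lambda>m. frag_of (?R (map (map_prod (\<lambda>i. if i < k then i else Suc i) id) m))) (prism [0..<Suc (q - 1)])"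
        proof (rule frag_extend_eq_chains_in[OF prism_in])
          fix m :: "(nat \<times> bool) list" assume m: "m \<in> {m. set m \<subseteq> {..q - 1} \<times> UNIV}" "length m = Suc (Suc (q - 1))"
          have "{..q - 1} = {..<q}" using q by auto
          with m q show "frag_of (prism_simplex (delete_nth k (?vl q g)) (singular_face q k g) m) =
              frag_of (?R (map (map_prod (\<lambda>i. if i < k then i else Suc i) id) m))"
            by (subst prism_simplex_singular_face[OF vl_len q k]) auto
        qed
        also have "\<dots> = frag_map ?R (prism (delete_nth k [0..<Suc q]))"
          using q by (simp add: delete_nth_upt[OF k] prism_map frag_extend_extend del: upt_Suc)
        finally show ?thesis .
      qed
      have "frag_extend (PR (q - 1)) (chain_boundary q (frag_of g)) =
          (\<Sum>k\<le>q. frag_cmul ((-1) ^ k) (frag_map ?R (prism (delete_nth k [0..<Suc q]))))"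
        using q face by (simp add: chain_boundary_of frag_extend_sum frag_extend_cmul o_def del: upt_Suc)
      also have "\<dots> = frag_map ?R (frag_extend prism (list_boundary [0..<Suc q]))"
        by (simp add: list_boundary_altdef frag_extend_sum frag_extend_cmul o_def delete_nth_def lessThan_Suc_atMost
            del: upt_Suc)
      finally show ?thesis using False by simp
    qed simp
    finally show ?thesis .
  qed
  \<comment> \<open>Replacing a simplex by its vertex list commutes with faces, so for positive
    \<open>p\<close> the chain \<open>t\<close> is a cycle because \<open>z'\<close> is one.\<close>
  define t where "t = frag_map (?vl p) z'"
  have t_in: "t \<in> chains_in ?K (Suc p)"
    using keys_frag_extend[of "\<lambda>g. frag_of (?vl p g)" z'] vl_in[OF z'_small] vl_len
    unfolding t_def chains_in_def by fastforce
  have t_bd: "boundary t = 0" if p: "1 \<le> p"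
  proof -
    have "boundary t = frag_extend (\<lambda>g. frag_map (?vl (p - 1)) (chain_boundary p (frag_of g))) z'"
      unfolding t_def frag_extend_extend
    proof (rule frag_extend_eq)
      fix g
      have "frag_map (?vl (p - 1)) (chain_boundary p (frag_of g)) =
          (\<Sum>k\<le>p. frag_cmul ((-1) ^ k) (frag_of (delete_nth k (?vl p g))))"
        using p by (simp add: chain_boundary_of frag_extend_sum frag_extend_cmul o_def vertex_list_face[unfolded One_nat_def])
      also have "\<dots> = list_boundary (?vl p g)"
        by (simp add: list_boundary_altdef vl_len delete_nth_def lessThan_Suc_atMost)
      finally show "frag_extend list_boundary (frag_of (?vl p g)) = frag_map (?vl (p - 1)) (chain_boundary p (frag_of g))"
        by simp
    qed
    also have "\<dots> = frag_map (?vl (p - 1)) (chain_boundary p z')"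
      by (simp only: chain_boundary_frag_extend[OF p, of z'] frag_extend_extend)
    finally show ?thesis by (simp add: z'_bd)
  qed
  \<comment> \<open>For \<open>p = 0\<close> the boundary of \<open>t\<close> is a multiple of the
    empty list, on which \<open>h\<close> vanishes.\<close>
  have h_bd_t: "frag_extend h (boundary t) = 0"
  proof (cases "1 \<le> p")
    case False
    then have "p = 0" by simp
    then have "boundary t \<in> chains_in ?K 0"
      using boundary_chains_in[OF face_closed_chain_lists t_in] by simp
    then show ?thesis by (rule frag_extend_length_0) (rule h(1))
  qed (simp add: t_bd)
  have Pt_in: "frag_extend P t \<in> chains_in (chain_lists leq X) (Suc p)"
  proof (rule chains_in_extend[OF t_in])
    show "P ys \<in> chains_in (chain_lists leq X) (Suc p)" if "ys \<in> ?K" "length ys = Suc p" for ys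
      using P(2)[OF that(1)] that(2) by simp
  qed
  define w where "w = frag_map affine_simplex (frag_extend P t)"
  have "singular_chain p ?X w" unfolding w_def by (rule singular_chain_affine[OF Pt_in])
  moreover have "chain_boundary p w = 0"
  proof (cases "1 \<le> p")
    case True
    have "chain_boundary p w = frag_map affine_simplex (boundary (frag_extend P t))"
      unfolding w_def by (rule chain_boundary_lists[OF singular_face_affine_simplex Pt_in True])
    also have "boundary (frag_extend P t) = 0"
      using boundary_extend[OF P(3) t_in] t_bd[OF True] by simp
    finally show ?thesis by simp
  qed (simp add: chain_boundary_def)
  ultimately have w: "singular_relcycle p ?X {} w" by (simp add: singular_cycle)
  have fw: "chain_map p (realization_map f) w = frag_map affine_simplex (frag_map (map f) (frag_extend P t))"
    unfolding w_def chain_map_def frag_extend_extend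
    by (rule frag_extend_eq_chains_in[OF t_in])
      (use P(2) in \<open>auto simp: frag_extend_extend simplex_map_affine_simplex intro!: frag_extend_eq_chains_in\<close>)
  define D where "D = frag_map affine_simplex (frag_extend h t)"
  have ht_in: "frag_extend h t \<in> chains_in ?K (Suc (Suc p))"
  proof (rule chains_in_extend[OF t_in])
    show "h ys \<in> chains_in ?K (Suc (Suc p))" if "ys \<in> ?K" "length ys = Suc p" for ys
      using h(2)[OF that(1)] that(2) by simp
  qed
  have D: "singular_chain (Suc p) ?Y D" unfolding D_def by (rule singular_chain_affine[OF ht_in])
  have "chain_boundary (Suc p) D = frag_map affine_simplex (boundary (frag_extend h t))"
    unfolding D_def by (rule chain_boundary_lists[OF singular_face_affine_simplex ht_in]) auto
  also have "boundary (frag_extend h t) = t - frag_map (map f) (frag_extend P t)"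
    using boundary_homotopy[OF h(3) t_in] h_bd_t by (simp add: frag_map_id frag_extend_extend)
  finally have D_bd: "chain_boundary (Suc p) D = frag_map affine_simplex t - chain_map p (realization_map f) w"
    by (simp add: fw frag_extend_diff)
  define E where "E = frag_extend (PR p) z'"
  have E: "singular_chain (Suc p) ?Y E"
    unfolding E_def singular_chain_def
    using keys_frag_extend[of "PR p" z'] PR_chain[OF z'_small] by (fastforce simp: singular_chain_def)
  have "chain_boundary (Suc p) E = frag_extend (\<lambda>g. chain_boundary (Suc p) (PR p g)) z'"
    by (simp add: E_def chain_boundary_def frag_extend_extend)
  also have "\<dots> = frag_extend (\<lambda>g. frag_of (affine_simplex (?vl p g)) - frag_of g
      - (if p = 0 then 0 else frag_extend (PR (p - 1)) (chain_boundary p (frag_of g)))) z'"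
    by (rule frag_extend_eq) (rule PR_bd[OF z'_small])
  also have "\<dots> = frag_map affine_simplex t - z'"
  proof (cases "p = 0")
    case False
    then have p: "1 \<le> p" by simp
    have "frag_extend (\<lambda>g. frag_extend (PR (p - 1)) (chain_boundary p (frag_of g))) z' =
        frag_extend (PR (p - 1)) (chain_boundary p z')"
      by (simp only: chain_boundary_frag_extend[OF p, of z'] frag_extend_extend)
    with False show ?thesis
      by (simp add: frag_extend_fun_diff frag_map_id t_def frag_extend_extend z'_bd)
  qed (simp add: frag_extend_fun_diff frag_map_id t_def frag_extend_extend)
  \<comment> \<open>Both boundaries contain the affine cycle of \<open>t\<close>, which
    cancels.\<close>
  finally have "chain_boundary (Suc p) (D - E) = z' - chain_map p (realization_map f) w"
    by (simp add: chain_boundary_diff D_bd)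
  then have "homologous_rel p ?Y {} z' (chain_map p (realization_map f) w)"
    unfolding homologous_rel_def singular_boundary using singular_chain_diff[OF D E] by blast
  then have "homologous_rel_set p ?Y {} (chain_map p (realization_map f) w) = c"
    using z(2) z'(2) homologous_rel_set_eq by metis
  moreover have "continuous_map ?X ?Y (realization_map f)"
    by (rule continuous_map_realization_map[OF f(2,1)])
  ultimately show ?thesis
    using w by (intro bexI[of _ "homologous_rel_set p ?X {} w"])
      (auto simp: hom_induced_chain_map carrier_relative_homology_group)
qed

section \<open>Ideals of Dedekind domains are invertible\<close>

lemma module_mult: "Modules.module ((*) :: 'a::comm_ring_1 \<Rightarrow> 'a \<Rightarrow> 'a)"
  by unfold_locales (auto simp: algebra_simps)

lemma is_ideal_iff: "is_ideal I \<longleftrightarrow> 0 \<in> I \<and> (\<forall>x\<in>I. \<forall>y\<in>I. x + y \<in> I) \<and> (\<forall>c. \<forall>x\<in>I. c * x \<in> I)"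
  by (rule module.subspace_def[OF module_mult])

text \<open>Directed so that well-foundedness is the ascending chain condition and induction
  proceeds from larger ideals to smaller ones.\<close>

definition larger_ideal :: "('a::comm_ring_1 set \<times> 'a set) set" where
  "larger_ideal = {(J, I). is_ideal I \<and> is_ideal J \<and> I \<subset> J}"

lemma wf_larger_ideal:
  assumes "noetherian TYPE('a::comm_ring_1)"
  shows "wf (larger_ideal :: ('a set \<times> 'a set) set)"
  unfolding wf_iff_no_infinite_down_chain
proof
  assume "\<exists>f :: nat \<Rightarrow> 'a set. \<forall>i. (f (Suc i), f i) \<in> larger_ideal"
  then obtain f :: "nat \<Rightarrow> 'a set" where "\<forall>i. (f (Suc i), f i) \<in> larger_ideal" by blast
  then have f: "is_ideal (f i)" "f i \<subset> f (Suc i)" for i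
    by (simp_all add: larger_ideal_def)
  have mono: "f i \<subseteq> f k" if "i \<le> k" for i k
    by (rule lift_Suc_mono_le[OF _ that]) (use f(2) in auto)
  have "is_ideal (\<Union>i. f i)"
    unfolding is_ideal_iff
  proof (intro conjI ballI allI)
    fix x y assume "x \<in> (\<Union>i. f i)" "y \<in> (\<Union>i. f i)"
    then obtain i k where "x \<in> f i" "y \<in> f k" by blast
    then have "x \<in> f (max i k)" "y \<in> f (max i k)" using mono[of i "max i k"] mono[of k "max i k"] by auto
    then show "x + y \<in> (\<Union>i. f i)" using f(1)[of "max i k"] by (auto simp: is_ideal_iff)
  next
    fix c x assume "x \<in> (\<Union>i. f i)"
    then obtain i where "x \<in> f i" by blast
    then have "c * x \<in> f i" using f(1)[of i] by (simp add: is_ideal_iff)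
    then show "c * x \<in> (\<Union>i. f i)" by blast
  qed (use f(1) in \<open>auto simp: is_ideal_iff\<close>)
  then obtain B where B: "finite B" "module.span (*) B = (\<Union>i. f i)"
    using assms by (auto simp: noetherian_def finitely_generated_def)
  then have "\<forall>b\<in>B. \<exists>i. b \<in> f i" using module.span_superset[OF module_mult, of B] by blast
  then obtain i where i: "\<And>b. b \<in> B \<Longrightarrow> b \<in> f (i b)" by metis
  have "B \<subseteq> f (Max (insert 0 (i ` B)))"
  proof
    fix b assume b: "b \<in> B"
    then have "i b \<le> Max (insert 0 (i ` B))" using B(1) by (intro Max_ge) auto
    with i[OF b] mono show "b \<in> f (Max (insert 0 (i ` B)))" by blast
  qed
  then have "module.span (*) B \<subseteq> f (Max (insert 0 (i ` B)))"
    using f(1) by (rule module.span_minimal[OF module_mult])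
  with B(2) f(2)[of "Max (insert 0 (i ` B))"] show False by blast
qed

section \<open>Products of prime ideals\<close>

definition adjoin :: "'a::comm_ring_1 set \<Rightarrow> 'a \<Rightarrow> 'a set" where
  "adjoin I a = {x + r * a | x r. x \<in> I}"

lemma adjoin:
  assumes "is_ideal I"
  shows "is_ideal (adjoin I a)" "I \<subseteq> adjoin I a" "a \<in> adjoin I a"
proof -
  show "is_ideal (adjoin I a)"
    unfolding is_ideal_iff
  proof (intro conjI ballI allI)
    show "0 \<in> adjoin I a"
      using assms unfolding adjoin_def is_ideal_iff by (auto intro!: exI[of _ 0])
    fix u v assume "u \<in> adjoin I a" "v \<in> adjoin I a"
    then obtain x r y s where "u = x + r * a" "v = y + s * a" "x \<in> I" "y \<in> I" by (auto simp: adjoin_def)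
    moreover from this have "u + v = (x + y) + (r + s) * a" by (simp add: algebra_simps)
    ultimately show "u + v \<in> adjoin I a" using assms unfolding adjoin_def is_ideal_iff by blast
  next
    fix c u assume "u \<in> adjoin I a"
    then obtain x r where "u = x + r * a" "x \<in> I" by (auto simp: adjoin_def)
    moreover from this have "c * u = c * x + (c * r) * a" by (simp add: algebra_simps)
    ultimately show "c * u \<in> adjoin I a" using assms unfolding adjoin_def is_ideal_iff by blast
  qed
  show "I \<subseteq> adjoin I a"
  proof
    fix x assume "x \<in> I"
    moreover have "x = x + 0 * a" by simp
    ultimately show "x \<in> adjoin I a" unfolding adjoin_def by blast
  qed
  have "a = 0 + 1 * a" by simp
  then show "a \<in> adjoin I a" using assms unfolding adjoin_def is_ideal_iff by blast
qed

text \<open>Only the products of single elements, without the ideal they generate; containment in a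
  given ideal is the same for both.\<close>

primrec products :: "'a::comm_ring_1 set list \<Rightarrow> 'a set" where
  "products [] = {1}"
| "products (P # Ps) = {a * b | a b. a \<in> P \<and> b \<in> products Ps}"

lemma products_append: "x \<in> products (Ps @ Qs) \<Longrightarrow> \<exists>a\<in>products Ps. \<exists>b\<in>products Qs. x = a * b"
proof (induction Ps arbitrary: x)
  case (Cons P Ps)
  then obtain a y where "x = a * y" "a \<in> P" "y \<in> products (Ps @ Qs)" by auto
  moreover from Cons.IH[OF this(3)] obtain c d where "c \<in> products Ps" "d \<in> products Qs" "y = c * d" by blast
  ultimately show ?case by (intro bexI[of _ "a * c"] bexI[of _ d]) (auto simp: mult.assoc)
qed auto

lemma products_insert: "x \<in> Q \<Longrightarrow> c \<in> products (us @ vs) \<Longrightarrow> x * c \<in> products (us @ Q # vs)"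
proof (induction us arbitrary: c)
  case (Cons P us)
  then obtain a y where ay: "c = a * y" "a \<in> P" "y \<in> products (us @ vs)" by auto
  then have "x * y \<in> products (us @ Q # vs)" using Cons by blast
  moreover have "x * c = a * (x * y)" by (simp add: ay(1) algebra_simps)
  ultimately show ?case using ay(2) by auto
qed auto

lemma products_not_in_prime:
  assumes "prime_ideal P" "\<And>Q. Q \<in> set Qs \<Longrightarrow> \<not> Q \<subseteq> P"
  shows "\<exists>x\<in>products Qs. x \<notin> P"
  using assms(2)
proof (induction Qs)
  case Nil
  have "1 \<notin> P"
  proof
    assume "1 \<in> P"
    then have "c * 1 \<in> P" for c using assms(1) unfolding prime_ideal_def is_ideal_iff by blast
    then show False using assms(1) by (auto simp: prime_ideal_def)
  qed
  then show ?case by simp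
next
  case (Cons Q Qs)
  then obtain x where "x \<in> products Qs" "x \<notin> P" by auto
  moreover obtain a where "a \<in> Q" "a \<notin> P" using Cons.prems[of Q] by auto
  moreover have "a * x \<notin> P" using assms(1) calculation unfolding prime_ideal_def by blast
  ultimately show ?case by auto
qed

text \<open>Noetherian induction: if \<open>a * b\<close> lies in \<open>I\<close> but neither
  factor does, the products found for the two ideals obtained by adjoining \<open>a\<close> and
  \<open>b\<close> multiply into \<open>I\<close>.\<close>

lemma ideal_contains_prime_product:
  assumes "noetherian TYPE('a::comm_ring_1)" "is_ideal I" "I \<noteq> {0 :: 'a}"
  shows "\<exists>Ps. (\<forall>P\<in>set Ps. prime_ideal P \<and> P \<noteq> {0}) \<and> products Ps \<subseteq> I"
  using assms(2,3)
proof (induction I rule: wf_induct_rule[OF wf_larger_ideal[OF assms(1)]])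
  case (1 I)
  consider "prime_ideal I" | "I = UNIV" | a b where "a * b \<in> I" "a \<notin> I" "b \<notin> I"
    using 1(2) by (auto simp: prime_ideal_def)
  then show ?case
  proof cases
    case 1
    then show ?thesis using \<open>I \<noteq> {0}\<close> by (intro exI[of _ "[I]"]) auto
  next
    case 2
    then show ?thesis by (intro exI[of _ "[]"]) auto
  next
    case (3 a b)
    have "\<exists>Ps. (\<forall>P\<in>set Ps. prime_ideal P \<and> P \<noteq> {0}) \<and> products Ps \<subseteq> adjoin I c" if "c \<notin> I" for c
    proof (rule 1(1))
      note J = adjoin[OF 1(2), of c]
      show "is_ideal (adjoin I c)" by (rule J)
      show "(adjoin I c, I) \<in> larger_ideal"
        using J 1(2) that by (auto simp: larger_ideal_def)
      show "adjoin I c \<noteq> {0}" using J 1(2) that unfolding is_ideal_iff by auto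
    qed
    from this[OF 3(2)] this[OF 3(3)] obtain Ps Qs where
      PQ: "\<forall>P\<in>set Ps. prime_ideal P \<and> P \<noteq> {0}" "products Ps \<subseteq> adjoin I a"
        "\<forall>P\<in>set Qs. prime_ideal P \<and> P \<noteq> {0}" "products Qs \<subseteq> adjoin I b" by metis
    have "products (Ps @ Qs) \<subseteq> I"
    proof
      fix z assume "z \<in> products (Ps @ Qs)"
      from products_append[OF this] obtain u v where "u \<in> adjoin I a" "v \<in> adjoin I b" "z = u * v"
        using PQ by blast
      then obtain x r y s where z: "z = (x + r * a) * (y + s * b)" and xy: "x \<in> I" "y \<in> I"
        by (auto simp: adjoin_def)
      have "z = (y + s * b) * x + ((r * a) * y + (r * s) * (a * b))" by (simp add: z algebra_simps)
      then show "z \<in> I" using xy 3(1) 1(2) unfolding is_ideal_iff by simp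
    qed
    with PQ show ?thesis by (intro exI[of _ "Ps @ Qs"]) auto
  qed
qed

text \<open>Take a nonzero \<open>b\<close> in \<open>P\<close> and a shortest product of nonzero
  primes inside the principal ideal of \<open>b\<close>. One factor lies in \<open>P\<close>, hence
  equals \<open>P\<close> as nonzero primes are maximal. Omitting it yields some \<open>c\<close>
  outside that ideal with \<open>c P\<close> inside, and \<open>y = c / b\<close>.\<close>

lemma prime_ideal_multiplier:
  fixes P :: "'a::idom set"
  assumes D: "dedekind_domain TYPE('a)" and P: "prime_ideal P" "P \<noteq> {0}"
  obtains y where "y \<notin> range to_fract" "\<And>x. x \<in> P \<Longrightarrow> y * to_fract x \<in> range to_fract"
proof -
  have idP: "is_ideal P" using P(1) by (simp add: prime_ideal_def)
  then obtain b where b: "b \<in> P" "b \<noteq> 0" using P(2) unfolding is_ideal_iff by auto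
  define I where "I = range (\<lambda>r. r * b)"
  have "is_ideal I"
    unfolding is_ideal_iff I_def
    by (auto simp: image_iff simp flip: distrib_right mult.assoc)
  moreover have "b \<in> I" using rangeI[of "\<lambda>r. r * b" 1] by (simp add: I_def)
  then have "I \<noteq> {0}" using b by auto
  ultimately have "\<exists>Ps. (\<forall>P\<in>set Ps. prime_ideal P \<and> P \<noteq> {0}) \<and> products Ps \<subseteq> I"
    using D by (intro ideal_contains_prime_product) (auto simp: dedekind_domain_def)
  then obtain Ps0 where "(\<forall>P\<in>set Ps0. prime_ideal P \<and> P \<noteq> {0}) \<and> products Ps0 \<subseteq> I" by blast
  from ex_has_least_nat[of "\<lambda>Ps. (\<forall>P\<in>set Ps. prime_ideal P \<and> P \<noteq> {0}) \<and> products Ps \<subseteq> I", OF this, of length]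
  obtain Ps where Ps: "\<forall>P\<in>set Ps. prime_ideal P \<and> P \<noteq> {0}" "products Ps \<subseteq> I"
    and min: "\<And>Qs. (\<forall>P\<in>set Qs. prime_ideal P \<and> P \<noteq> {0}) \<and> products Qs \<subseteq> I \<Longrightarrow> length Ps \<le> length Qs"
    by blast
  have least: "\<not> products Qs \<subseteq> I" if "length Qs < length Ps" "\<forall>P\<in>set Qs. prime_ideal P \<and> P \<noteq> {0}" for Qs
    using min[of Qs] that by auto
  have "I \<subseteq> P" using b(1) idP unfolding I_def is_ideal_iff by auto
  then obtain Q where Q: "Q \<in> set Ps" "Q \<subseteq> P"
    using products_not_in_prime[OF P(1), of Ps] Ps(2) by blast
  have "maximal_ideal Q" using Q(1) Ps(1) D by (auto simp: dedekind_domain_def)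
  then have "P = Q"
    using Q(2) idP P(1) by (auto simp: maximal_ideal_def prime_ideal_def)
  obtain us vs where uv: "Ps = us @ Q # vs" using Q(1) by (meson split_list)
  have "\<not> products (us @ vs) \<subseteq> I" using Ps(1) by (intro least) (auto simp: uv)
  then obtain c where c: "c \<in> products (us @ vs)" "c \<notin> I" by blast
  have fb: "to_fract b \<noteq> 0" using b by simp
  show thesis
  proof
    show "to_fract c / to_fract b \<notin> range to_fract"
    proof
      assume "to_fract c / to_fract b \<in> range to_fract"
      then obtain r where "to_fract c / to_fract b = to_fract r" by auto
      then have "to_fract c = to_fract (r * b)" using fb by (simp add: field_simps)
      then have "c = r * b" by (simp only: to_fract_eq_iff)
      with c(2) show False unfolding I_def by blast
    qed
    fix x assume "x \<in> P"
    then have "x * c \<in> I" using products_insert[OF _ c(1), of x Q] Ps(2) uv \<open>P = Q\<close> by auto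
    then obtain r where "x * c = r * b" by (auto simp: I_def)
    then have "to_fract x * to_fract c = to_fract r * to_fract b" by (metis to_fract_mult)
    then have "to_fract c / to_fract b * to_fract x = to_fract r" using fb by (simp add: field_simps)
    then show "to_fract c / to_fract b * to_fract x \<in> range to_fract" by simp
  qed
qed

lemma in_span_image_lessThan:
  fixes m :: nat
  assumes "x \<in> module.span (*) (c ` {..<m})"
  shows "\<exists>r. x = (\<Sum>i<m. r i * (c i :: 'a::comm_ring_1))"
proof -
  let ?S = "{x. \<exists>r. x = (\<Sum>i<m. r i * c i)}"
  have "is_ideal ?S"
    unfolding is_ideal_iff
  proof (intro conjI ballI allI)
    show "0 \<in> ?S" by (auto intro!: exI[of _ "\<lambda>_. 0"])
    fix x y assume "x \<in> ?S" "y \<in> ?S"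
    then obtain r s where "x = (\<Sum>i<m. r i * c i)" "y = (\<Sum>i<m. s i * c i)" by auto
    then have "x + y = (\<Sum>i<m. (r i + s i) * c i)" by (simp add: sum.distrib distrib_right)
    then show "x + y \<in> ?S" by (auto intro!: exI[of _ "\<lambda>i. r i + s i"])
  next
    fix a x assume "x \<in> ?S"
    then obtain r where "x = (\<Sum>i<m. r i * c i)" by auto
    then have "a * x = (\<Sum>i<m. (a * r i) * c i)" by (simp add: sum_distrib_left mult.assoc)
    then show "a * x \<in> ?S" by (auto intro!: exI[of _ "\<lambda>i. a * r i"])
  qed
  moreover have "c k \<in> ?S" if "k < m" for k
  proof -
    have "c k = (\<Sum>i<m. (if i = k then 1 else 0) * c i)"
      using that by (simp add: if_distrib[of "\<lambda>x. x * _"] cong: if_cong)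
    then show ?thesis by (auto intro!: exI[of _ "\<lambda>i. if i = k then 1 else 0"])
  qed
  then have "c ` {..<m} \<subseteq> ?S" by blast
  ultimately have "module.span (*) (c ` {..<m}) \<subseteq> ?S"
    by (rule module.span_minimal[OF module_mult, rotated])
  with assms show ?thesis by blast
qed

text \<open>Since \<open>I\<close> is noetherian, \<open>y\<close> satisfies a monic equation.\<close>

lemma multiplier_integral:
  fixes I :: "'a::idom set"
  assumes D: "dedekind_domain TYPE('a)" and I: "is_ideal I" "I \<noteq> {0}"
    and y: "\<And>x. x \<in> I \<Longrightarrow> \<exists>x'\<in>I. y * to_fract x = to_fract x'"
  shows "y \<in> range to_fract"
proof -
  obtain b where b: "b \<in> I" "b \<noteq> 0" using I unfolding is_ideal_iff by auto
  obtain s where s: "\<And>x. x \<in> I \<Longrightarrow> s x \<in> I" "\<And>x. x \<in> I \<Longrightarrow> y * to_fract x = to_fract (s x)"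
    using y by metis
  \<comment> \<open>These are the elements \<open>y ^ n * b\<close>, all of which stay in
    \<open>I\<close>.\<close>
  define c where "c n = (s ^^ n) b" for n
  have c: "c n \<in> I \<and> to_fract (c n) = y ^ n * to_fract b" for n
    by (induction n) (auto simp: c_def b s(1) simp flip: s(2))
  define J where "J m = module.span (*) (c ` {..<m})" for m
  have "is_ideal (J m)" for m by (simp add: J_def module.subspace_span[OF module_mult])
  moreover have "J m \<subseteq> J (Suc m)" for m
    unfolding J_def by (rule module.span_mono[OF module_mult]) auto
  moreover have "\<not> (\<forall>i. (J (Suc i), J i) \<in> larger_ideal)"
    using wf_larger_ideal[where ?'a='a] D
    unfolding wf_iff_no_infinite_down_chain dedekind_domain_def by blast
  \<comment> \<open>Once the ideals generated by the first elements \<open>c i\<close> become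
    stationary, \<open>y ^ m * b\<close> is a combination of lower ones, and cancelling
    \<open>b\<close> gives the monic equation.\<close>
  ultimately obtain m where "J (Suc m) = J m" unfolding larger_ideal_def by blast
  moreover have "c m \<in> J (Suc m)"
    unfolding J_def by (rule module.span_base[OF module_mult]) auto
  ultimately have "c m \<in> module.span (*) (c ` {..<m})" by (simp add: J_def)
  then obtain r where r: "c m = (\<Sum>i<m. r i * c i)" using in_span_image_lessThan by blast
  have "y ^ m * to_fract b = (\<Sum>i<m. to_fract (r i) * y ^ i) * to_fract b"
  proof -
    have "y ^ m * to_fract b = to_fract (\<Sum>i<m. r i * c i)" using c r by metis
    also have "\<dots> = (\<Sum>i<m. to_fract (r i) * y ^ i * to_fract b)" using c by (simp add: mult.assoc)
    finally show ?thesis by (simp add: sum_distrib_right)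
  qed
  then have ym: "y ^ m = (\<Sum>i<m. to_fract (r i) * y ^ i)" using b by simp
  define p where "p = monom 1 m - (\<Sum>i<m. monom (r i) i)"
  have cf: "coeff p i = (if i = m then 1 else if i < m then - r i else 0)" for i
  proof -
    have "(\<Sum>k<m. coeff (monom (r k) k) i) = (if i < m then r i else 0)"
      by (simp add: sum.delta' eq_commute cong: if_cong)
    then show ?thesis by (auto simp: p_def coeff_sum)
  qed
  have deg: "degree p = m"
  proof (rule antisym)
    show "degree p \<le> m" by (rule degree_le) (simp add: cf)
    show "m \<le> degree p" by (rule le_degree) (simp add: cf)
  qed
  have "poly (map_poly to_fract p) y = (\<Sum>i\<le>m. to_fract (coeff p i) * y ^ i)"
    by (simp add: poly_altdef degree_map_poly coeff_map_poly deg)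
  also have "\<dots> = (\<Sum>i<m. to_fract (coeff p i) * y ^ i) + y ^ m"
    by (simp add: cf flip: lessThan_Suc_atMost)
  also have "(\<Sum>i<m. to_fract (coeff p i) * y ^ i) = - (\<Sum>i<m. to_fract (r i) * y ^ i)"
    by (simp add: cf sum_negf)
  finally have "poly (map_poly to_fract p) y = 0" using ym by simp
  moreover have "lead_coeff p = 1" by (simp add: deg cf)
  ultimately show ?thesis
    using D unfolding dedekind_domain_def integrally_closed_def by blast
qed

text \<open>The second components range over the inverse fractional ideal, and the condition says
  that 1 lies in its product with \<open>I\<close>.\<close>

definition invertible_ideal :: "'a::idom set \<Rightarrow> bool" where
  "invertible_ideal I \<longleftrightarrow> (\<exists>xs. (\<forall>(a, b)\<in>set xs. a \<in> I \<and> (\<forall>x\<in>I. b * to_fract x \<in> range to_fract)) \<and>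
     (\<Sum>(a, b)\<leftarrow>xs. to_fract a * b) = 1)"

text \<open>Induction from larger ideals: for \<open>y\<close> a multiplier of a maximal ideal above
  \<open>I\<close>, the ideal \<open>I + y I\<close> is strictly larger, since otherwise
  \<open>y\<close> would be integral; its inverse relation can be rewritten as one for
  \<open>I\<close>.\<close>

lemma dedekind_ideal_invertible:
  fixes I :: "'a::idom set"
  assumes D: "dedekind_domain TYPE('a)" and "is_ideal I" "I \<noteq> {0}"
  shows "invertible_ideal I"
proof -
  have wf: "wf (larger_ideal :: ('a set \<times> 'a set) set)"
    using D by (intro wf_larger_ideal) (simp add: dedekind_domain_def)
  show ?thesis
    using assms(2,3)
  proof (induction I rule: wf_induct_rule[OF wf])
    case (1 I)
    note I = 1(2,3)
    show ?case
    proof (cases "I = UNIV")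
      case True
      show ?thesis unfolding invertible_ideal_def
        by (rule exI[of _ "[(1, 1)]"]) (auto simp: True)
    next
      case False
      define Q where "Q = {J. is_ideal J \<and> I \<subseteq> J \<and> J \<noteq> UNIV}"
      have "I \<in> Q" using I False by (simp add: Q_def)
      from wfE_min[OF wf this] obtain P where PQ: "P \<in> Q" "\<And>J. (J, P) \<in> larger_ideal \<Longrightarrow> J \<notin> Q"
        by blast
      then have P: "is_ideal P" "I \<subseteq> P" "P \<noteq> UNIV"
        and max: "\<And>J. (J, P) \<in> larger_ideal \<Longrightarrow> \<not> (is_ideal J \<and> I \<subseteq> J \<and> J \<noteq> UNIV)"
        by (simp_all add: Q_def)
      have "prime_ideal P"
        unfolding prime_ideal_def
      proof (intro conjI allI impI)
        fix a b assume ab: "a * b \<in> P"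
        show "a \<in> P \<or> b \<in> P"
        proof (rule disjCI)
          assume "b \<notin> P"
          note J = adjoin[OF P(1), of b]
          have "(adjoin P b, P) \<in> larger_ideal"
            using J P(1) \<open>b \<notin> P\<close> by (auto simp: larger_ideal_def)
          from max[OF this] J P(2) have "adjoin P b = UNIV" by auto
          then have "1 \<in> adjoin P b" by simp
          then obtain x r where x: "1 = x + r * b" "x \<in> P" unfolding adjoin_def by blast
          have "a = a * (x + r * b)" using x(1) by simp
          also have "\<dots> = a * x + r * (a * b)" by (simp add: algebra_simps)
          finally have a: "a = a * x + r * (a * b)" .
          have "a * x + r * (a * b) \<in> P" using ab x(2) P(1) unfolding is_ideal_iff by blast
          with a show "a \<in> P" by simp
        qed
      qed (use P in auto)
      moreover have "P \<noteq> {0}" using P(2) I unfolding is_ideal_iff by auto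
      ultimately obtain y where y: "y \<notin> range to_fract" "\<And>x. x \<in> P \<Longrightarrow> y * to_fract x \<in> range to_fract"
        using prime_ideal_multiplier[OF D] by metis
      \<comment> \<open>This is \<open>I + y I\<close>; it consists of ring elements because
        \<open>y\<close> multiplies \<open>P\<close>, which contains \<open>I\<close>, into the
        ring.\<close>
      define J where "J = {x. \<exists>c\<in>I. \<exists>d\<in>I. to_fract x = to_fract c + y * to_fract d}"
      have "is_ideal J"
        unfolding is_ideal_iff
      proof (intro conjI ballI allI)
        show "0 \<in> J" using I(1) unfolding J_def is_ideal_iff by (auto intro!: bexI[of _ 0])
        fix u v assume "u \<in> J" "v \<in> J"
        then obtain c d c' d' where *: "c \<in> I" "d \<in> I" "c' \<in> I" "d' \<in> I"
          "to_fract u = to_fract c + y * to_fract d" "to_fract v = to_fract c' + y * to_fract d'"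
          unfolding J_def by blast
        then have "to_fract (u + v) = to_fract (c + c') + y * to_fract (d + d')" by (simp add: algebra_simps)
        with * I(1) show "u + v \<in> J" unfolding J_def is_ideal_iff by blast
      next
        fix a u assume "u \<in> J"
        then obtain c d where *: "c \<in> I" "d \<in> I" "to_fract u = to_fract c + y * to_fract d"
          unfolding J_def by blast
        then have "to_fract (a * u) = to_fract (a * c) + y * to_fract (a * d)" by (simp add: algebra_simps)
        with * I(1) show "a * u \<in> J" unfolding J_def is_ideal_iff by blast
      qed
      moreover have IJ: "I \<subseteq> J"
      proof
        fix x assume "x \<in> I"
        moreover have "0 \<in> I" using I(1) by (simp add: is_ideal_iff)
        moreover have "to_fract x = to_fract x + y * to_fract 0" by simp
        ultimately show "x \<in> J" unfolding J_def by blast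
      qed
      moreover have "I \<noteq> J"
      proof
        assume "I = J"
        have "y \<in> range to_fract"
        proof (rule multiplier_integral[OF D I])
          fix x assume x: "x \<in> I"
          then obtain x' where x': "y * to_fract x = to_fract x'" using y(2) P(2) by blast
          have "0 \<in> I" "to_fract x' = to_fract 0 + y * to_fract x" using I(1) x' by (simp_all add: is_ideal_iff)
          with x have "x' \<in> J" unfolding J_def by blast
          with x' \<open>I = J\<close> show "\<exists>x'\<in>I. y * to_fract x = to_fract x'" by blast
        qed
        with y(1) show False by blast
      qed
      moreover have "J \<noteq> {0}" using IJ I unfolding is_ideal_iff by auto
      ultimately have "invertible_ideal J"
        using 1(1)[of J] I(1) by (auto simp: larger_ideal_def)
      then obtain xs where xs: "\<And>a b. (a, b) \<in> set xs \<Longrightarrow> a \<in> J \<and> (\<forall>x\<in>J. b * to_fract x \<in> range to_fract)"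
        and sum: "(\<Sum>(a, b)\<leftarrow>xs. to_fract a * b) = 1"
        unfolding invertible_ideal_def by fast
      have yI: "x' \<in> J" if "x \<in> I" "to_fract x' = y * to_fract x" for x x'
      proof -
        have "0 \<in> I" "to_fract x' = to_fract 0 + y * to_fract x" using I(1) that by (simp_all add: is_ideal_iff)
        with that(1) show ?thesis unfolding J_def by blast
      qed
      have "\<forall>a. \<exists>c d. a \<in> J \<longrightarrow> c \<in> I \<and> d \<in> I \<and> to_fract a = to_fract c + y * to_fract d"
        unfolding J_def by blast
      then obtain c d where cd: "\<And>a. a \<in> J \<Longrightarrow> c a \<in> I \<and> d a \<in> I \<and> to_fract a = to_fract (c a) + y * to_fract (d a)"
        by metis
      \<comment> \<open>Each term \<open>a * b\<close> with \<open>a = c + y * d\<close> is split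
        into \<open>c * b\<close> and \<open>d * (b * y)\<close>, so that the first factors lie in
        \<open>I\<close>.\<close>
      define ys where "ys = concat (map (\<lambda>(a, b). [(c a, b), (d a, b * y)]) xs)"
      have "e \<in> I \<and> (\<forall>x\<in>I. f * to_fract x \<in> range to_fract)" if "(e, f) \<in> set ys" for e f
      proof -
        from that obtain a b where ab: "(a, b) \<in> set xs" "(e, f) = (c a, b) \<or> (e, f) = (d a, b * y)"
          by (auto simp: ys_def)
        note X = xs[OF ab(1)]
        have "b * y * to_fract x \<in> range to_fract" if x: "x \<in> I" for x
        proof -
          obtain x' where "y * to_fract x = to_fract x'" using y(2) P(2) x by blast
          with X yI[OF x, of x'] show ?thesis by (simp add: mult.assoc)
        qed
        moreover have "b * to_fract x \<in> range to_fract" if "x \<in> I" for x using X IJ that by blast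
        ultimately show ?thesis using ab(2) cd X by auto
      qed
      moreover have "(\<Sum>(a, b)\<leftarrow>ys. to_fract a * b) = 1"
      proof -
        have "(\<Sum>(a, b)\<leftarrow>concat (map (\<lambda>(a, b). [(c a, b), (d a, b * y)]) zs). to_fract a * b) = (\<Sum>(a, b)\<leftarrow>zs. to_fract a * b)"
          if "set zs \<subseteq> set xs" for zs
          using that
        proof (induction zs)
          case (Cons z zs)
          obtain a b where z: "z = (a, b)" by (cases z)
          then have "to_fract a = to_fract (c a) + y * to_fract (d a)" using Cons.prems xs cd by auto
          then show ?case using Cons z by (simp add: algebra_simps)
        qed simp
        then show ?thesis using sum by (simp add: ys_def)
      qed
      ultimately show ?thesis unfolding invertible_ideal_def by (intro exI[of _ ys]) auto
    qed
  qed
qed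

section \<open>Dimensions of subspaces of finite dimension\<close>

context vector_space
begin

text \<open>The ambient space, later the finitely supported functions on the module, may have
  infinite dimension; a finite set \<open>F\<close> spanning the relevant part is carried along
  instead.\<close>

lemma finite_basis_exists:
  assumes "finite F" "S \<subseteq> span F"
  obtains B where "B \<subseteq> S" "independent B" "S \<subseteq> span B" "finite B" "card B = dim S"
proof -
  obtain B where B: "B \<subseteq> S" "independent B" "S \<subseteq> span B" "card B = dim S"
    using basis_exists[of S] by blast
  moreover have "finite B" using independent_span_bound[OF assms(1) B(2)] B(1) assms(2) by blast
  ultimately show thesis using that by blast
qed

lemma dim_insert_finite:
  assumes F: "finite F" "S \<subseteq> span F" "x \<notin> span S"
  shows "dim (insert x S) = dim S + 1"
proof -
  obtain B where B: "B \<subseteq> S" "independent B" "S \<subseteq> span B" "finite B" "card B = dim S"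
    using finite_basis_exists[OF F(1,2)] by blast
  have x: "x \<notin> span B" using F(3) span_mono[OF B(1)] by blast
  then have "x \<notin> B" using span_base by blast
  show ?thesis
  proof (rule dim_unique)
    show "insert x B \<subseteq> insert x S" using B(1) by blast
    show "insert x S \<subseteq> span (insert x B)"
      using B(3) span_mono[of B "insert x B"] span_base[of x "insert x B"] by blast
    show "independent (insert x B)" using x B(2) by (rule independent_insertI)
    show "card (insert x B) = dim S + 1" using \<open>x \<notin> B\<close> B by simp
  qed
qed

lemma dim_mono_finite:
  assumes F: "finite F" "T \<subseteq> span F" "S \<subseteq> span T"
  shows "dim S \<le> dim T"
proof -
  have "span T \<subseteq> span F" using F(2) by (rule span_minimal) simp
  with F(3) have "S \<subseteq> span F" by blast
  then obtain B where B: "B \<subseteq> S" "independent B" "card B = dim S"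
    using finite_basis_exists[OF F(1)] by metis
  obtain C where C: "T \<subseteq> span C" "finite C" "card C = dim T"
    using finite_basis_exists[OF F(1,2)] by metis
  have "span T \<subseteq> span C" using C(1) by (rule span_minimal) simp
  then show ?thesis
    using independent_span_bound[OF C(2) B(2)] B F(3) C(3) by auto
qed

lemma dim_less_finite:
  assumes F: "finite F" "T \<subseteq> span F" "S \<subseteq> span T" "x \<in> T" "x \<notin> span S"
  shows "dim S < dim T"
proof -
  have "span T \<subseteq> span F" using F(2) by (rule span_minimal) simp
  then have "dim (insert x S) = dim S + 1" using F by (intro dim_insert_finite[OF F(1)]) auto
  moreover have "dim (insert x S) \<le> dim T"
    using F span_base by (intro dim_mono_finite[OF F(1,2)]) auto
  ultimately show ?thesis by simp
qed

text \<open>A basis \<open>B\<close> of the intersection is extended to a basis \<open>C\<close> of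
  \<open>U\<close>; together with a basis \<open>D\<close> of \<open>W\<close>, the vectors of
  \<open>C - B\<close> form a basis of the sum.\<close>

lemma dim_sums_Int_finite:
  assumes F: "finite F" "U \<subseteq> span F" "W \<subseteq> span F" and U: "subspace U" and W: "subspace W"
  shows "dim {u + w |u w. u \<in> U \<and> w \<in> W} + dim (U \<inter> W) = dim U + dim W"
proof -
  have fin: "finite I" if "independent I" "I \<subseteq> span F" for I
    using independent_span_bound[OF F(1) that] by blast
  obtain B where B: "B \<subseteq> U \<inter> W" "independent B" "U \<inter> W \<subseteq> span B" "finite B" "card B = dim (U \<inter> W)"
    using finite_basis_exists[OF F(1), of "U \<inter> W"] F by blast
  obtain C where C: "B \<subseteq> C" "C \<subseteq> U" "independent C" "U \<subseteq> span C"
    using maximal_independent_subset_extend[of B U] B by blast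
  have finC: "finite C" using fin C F by blast
  have cardC: "card C = dim U" using basis_card_eq_dim C by blast
  obtain D where D: "D \<subseteq> W" "independent D" "W \<subseteq> span D" "finite D" "card D = dim W"
    using finite_basis_exists[OF F(1,3)] by blast
  have spanD: "span D = W" using D W by (intro span_subspace)
  have main: "independent (D \<union> E) \<and> D \<inter> E = {}" if "finite E" "E \<subseteq> C - B" for E
    using that
  proof (induction E)
    case (insert c E)
    \<comment> \<open>Otherwise \<open>c\<close> differs from some element of \<open>span E\<close>
      by a vector of \<open>U\<close> and \<open>W\<close>, hence of \<open>span B\<close>, against
      the independence of \<open>C\<close>.\<close>
    have "c \<notin> span (D \<union> E)"
    proof
      assume "c \<in> span (D \<union> E)"
      then obtain d e where de: "c = d + e" "d \<in> W" "e \<in> span E"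
        by (auto simp: span_Un spanD)
      have "e \<in> U" using de(3) insert.prems C(2) span_minimal[of E U] U by blast
      moreover have "c \<in> U" using insert.prems C(2) by blast
      ultimately have "d \<in> U" using subspace_diff[OF U, of c e] de(1) by simp
      then have "d \<in> span B" using de(2) B(3) by blast
      then have "c \<in> span (B \<union> E)" using de by (auto simp: span_Un)
      moreover have "B \<union> E \<subseteq> C - {c}" using insert.prems insert.hyps C(1) by auto
      ultimately have "c \<in> span (C - {c})" using span_mono by blast
      then show False using C(3) insert.prems by (auto simp: dependent_def)
    qed
    moreover have "independent (D \<union> E)" "D \<inter> E = {}" using insert by auto
    ultimately have "independent (insert c (D \<union> E))" by (intro independent_insertI)
    moreover have "c \<notin> D" using \<open>c \<notin> span (D \<union> E)\<close> span_base[of c "D \<union> E"] by blast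
    ultimately show ?case using \<open>D \<inter> E = {}\<close> by simp
  qed (use D in simp)
  have DC: "independent (D \<union> (C - B))" "D \<inter> (C - B) = {}"
    using main[of "C - B"] finC by auto
  have "dim {u + w |u w. u \<in> U \<and> w \<in> W} = card (D \<union> (C - B))"
  proof (rule dim_unique[OF _ _ DC(1) refl])
    have "u \<in> {u + w |u w. u \<in> U \<and> w \<in> W}" if "u \<in> U" for u
      using that subspace_0[OF W] by force
    moreover have "w \<in> {u + w |u w. u \<in> U \<and> w \<in> W}" if "w \<in> W" for w
      using that subspace_0[OF U] by force
    ultimately show "D \<union> (C - B) \<subseteq> {u + w |u w. u \<in> U \<and> w \<in> W}" using C(2) D(1) by blast
    have "W \<subseteq> span (D \<union> (C - B))" using D(3) span_mono[of D "D \<union> (C - B)"] by blast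
    moreover have "C \<subseteq> span (D \<union> (C - B))"
      using B(1) calculation span_superset[of "D \<union> (C - B)"] by blast
    then have "U \<subseteq> span (D \<union> (C - B))" using C(4) span_minimal[of C "span (D \<union> (C - B))"] by auto
    ultimately show "{u + w |u w. u \<in> U \<and> w \<in> W} \<subseteq> span (D \<union> (C - B))"
      by (auto intro!: span_add)
  qed
  also have "\<dots> = card D + (card C - card B)"
    using DC(2) finC D(4) C(1) B(4) by (simp add: card_Un_disjoint card_Diff_subset)
  finally show ?thesis
    using cardC B(5) D(5) card_mono[OF finC C(1)] by simp
qed

end

section \<open>Saturated submodules\<close>

text \<open>The space stands in for the extension of scalars to the fraction field. Ranks and
  independence are computed there, and it may be larger than the span of the image of
  \<open>j\<close>.\<close>

locale embedded_module = M: Modules.module scl + V: vector_space sV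
  for scl :: "'a::idom \<Rightarrow> 'm::ab_group_add \<Rightarrow> 'm" and sV :: "'a fract \<Rightarrow> 'v::ab_group_add \<Rightarrow> 'v" +
  fixes j :: "'m \<Rightarrow> 'v"
  assumes j_add: "j (x + y) = j x + j y"
    and j_scale: "j (scl c x) = sV (to_fract c) (j x)"
    and j_eq_0: "j x = 0 \<Longrightarrow> x = 0"
    and dedekind: "dedekind_domain TYPE('a)"
    and fg: "finitely_generated scl UNIV"
begin

text \<open>Equivalently the quotient by \<open>P\<close> is torsion-free. Over a Dedekind domain
  these are the summands (\<open>is_summand_iff\<close>), but this condition is easier to
  test.\<close>

definition saturated :: "'m set \<Rightarrow> bool" where
  "saturated P \<longleftrightarrow> M.subspace P \<and> (\<forall>a x. a \<noteq> 0 \<longrightarrow> scl a x \<in> P \<longrightarrow> x \<in> P)"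

definition saturation :: "'m set \<Rightarrow> 'm set" where
  "saturation S = {x. \<exists>a. a \<noteq> 0 \<and> scl a x \<in> S}"

definition msum :: "'m set \<Rightarrow> 'm set \<Rightarrow> 'm set" where
  "msum P Q = {p + q | p q. p \<in> P \<and> q \<in> Q}"

definition rk :: "'m set \<Rightarrow> int" where
  "rk P = int (V.dim (j ` P))"

lemma j_0 [simp]: "j 0 = 0"
  using j_add[of 0 0] by simp

lemma j_diff: "j (x - y) = j x - j y"
  using j_add[of "x - y" y] by (simp add: algebra_simps)

lemma j_inject: "j x = j y \<Longrightarrow> x = y"
  using j_eq_0[of "x - y"] by (simp add: j_diff)

lemma torsion_free: "scl c x = 0 \<Longrightarrow> c \<noteq> 0 \<Longrightarrow> x = 0"
  using j_scale[of c x] j_eq_0[of x] by simp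

lemma saturatedD:
  assumes "saturated P"
  shows "M.subspace P" "0 \<in> P" "\<And>x y. x \<in> P \<Longrightarrow> y \<in> P \<Longrightarrow> x + y \<in> P" "\<And>x y. x \<in> P \<Longrightarrow> y \<in> P \<Longrightarrow> x - y \<in> P"
    "\<And>c x. x \<in> P \<Longrightarrow> scl c x \<in> P" "\<And>a x. a \<noteq> 0 \<Longrightarrow> scl a x \<in> P \<Longrightarrow> x \<in> P"
  using assms unfolding saturated_def
  by (auto intro: M.subspace_0 M.subspace_add M.subspace_diff M.subspace_scale)

lemma saturated_UNIV: "saturated UNIV"
  by (simp add: saturated_def)

lemma saturated_0: "saturated {0}"
  using torsion_free by (auto simp: saturated_def)

lemma saturated_Int: "saturated P \<Longrightarrow> saturated Q \<Longrightarrow> saturated (P \<inter> Q)"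
  by (auto simp: saturated_def M.subspace_inter)

lemma subspace_msum:
  assumes "M.subspace P" "M.subspace Q"
  shows "M.subspace (msum P Q)"
proof -
  have "M.span P = P" "M.span Q = Q" using assms by (simp_all only: M.span_eq_iff)
  then have "msum P Q = M.span (P \<union> Q)" by (simp only: msum_def M.span_Un)
  then show ?thesis by simp
qed

lemma subset_msum: "M.subspace P \<Longrightarrow> M.subspace Q \<Longrightarrow> P \<subseteq> msum P Q" "M.subspace P \<Longrightarrow> M.subspace Q \<Longrightarrow> Q \<subseteq> msum P Q"
  unfolding msum_def using M.subspace_0 by force+

lemma msum_commute: "msum P Q = msum Q P"
  unfolding msum_def by (metis add.commute)

lemma msum_assoc: "msum (msum P Q) R = msum P (msum Q R)"
proof -
  have "x \<in> msum (msum P Q) R \<longleftrightarrow> (\<exists>p\<in>P. \<exists>q\<in>Q. \<exists>r\<in>R. x = p + q + r)" for x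
    by (auto simp: msum_def)
  moreover have "x \<in> msum P (msum Q R) \<longleftrightarrow> (\<exists>p\<in>P. \<exists>q\<in>Q. \<exists>r\<in>R. x = p + q + r)" for x
    by (auto simp: msum_def add.assoc)
  ultimately show ?thesis by blast
qed

lemma saturation_superset: "S \<subseteq> saturation S"
proof
  fix x assume "x \<in> S"
  then have "scl 1 x \<in> S" by simp
  then show "x \<in> saturation S" unfolding saturation_def using one_neq_zero by blast
qed

lemma saturated_saturation:
  assumes S: "M.subspace S"
  shows "saturated (saturation S)"
  unfolding saturated_def M.subspace_def
proof (intro conjI ballI allI impI)
  show "0 \<in> saturation S" using saturation_superset M.subspace_0[OF S] by blast
  fix x y assume "x \<in> saturation S" "y \<in> saturation S"
  then obtain a b where ab: "a \<noteq> 0" "b \<noteq> 0" "scl a x \<in> S" "scl b y \<in> S" by (auto simp: saturation_def)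
  have "scl (a * b) (x + y) = scl b (scl a x) + scl a (scl b y)"
    by (simp add: M.scale_right_distrib mult.commute)
  moreover have "scl b (scl a x) + scl a (scl b y) \<in> S"
    by (intro M.subspace_add[OF S] M.subspace_scale[OF S] ab)
  ultimately have "scl (a * b) (x + y) \<in> S" by simp
  then show "x + y \<in> saturation S" using ab unfolding saturation_def by (auto intro!: exI[of _ "a * b"])
next
  fix c x assume "x \<in> saturation S"
  then obtain a where a: "a \<noteq> 0" "scl a x \<in> S" by (auto simp: saturation_def)
  have "scl a (scl c x) = scl c (scl a x)" by (simp add: mult.commute)
  moreover have "scl c (scl a x) \<in> S" using a(2) by (rule M.subspace_scale[OF S])
  ultimately show "scl c x \<in> saturation S" using a(1) unfolding saturation_def by auto
next
  fix a x assume "a \<noteq> 0" "scl a x \<in> saturation S"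
  then obtain b where "b \<noteq> 0" "scl (b * a) x \<in> S" by (auto simp: saturation_def)
  then show "x \<in> saturation S" using \<open>a \<noteq> 0\<close> unfolding saturation_def by (auto intro!: exI[of _ "b * a"])
qed

lemma saturation_minimal: "saturated P \<Longrightarrow> S \<subseteq> P \<Longrightarrow> saturation S \<subseteq> P"
  by (auto simp: saturation_def saturated_def)

lemma saturation_eq: "saturated P \<Longrightarrow> saturation P = P"
  using saturation_minimal[of P P] saturation_superset[of P] by blast

text \<open>A linear combination over the fraction field can be brought to a common
  denominator.\<close>

lemma in_span_image:
  assumes P: "M.subspace P"
  shows "v \<in> V.span (j ` P) \<longleftrightarrow> (\<exists>a p. a \<noteq> 0 \<and> p \<in> P \<and> sV (to_fract a) v = j p)"
proof
  let ?S = "{v. \<exists>a p. a \<noteq> 0 \<and> p \<in> P \<and> sV (to_fract a) v = j p}"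
  have "V.subspace ?S"
    unfolding V.subspace_def
  proof (intro conjI ballI allI)
    have "sV (to_fract 1) 0 = j 0" by simp
    then show "0 \<in> ?S" using M.subspace_0[OF P] one_neq_zero by blast
    fix v w assume "v \<in> ?S" "w \<in> ?S"
    then obtain a p b q where *: "a \<noteq> 0" "p \<in> P" "sV (to_fract a) v = j p" "b \<noteq> 0" "q \<in> P" "sV (to_fract b) w = j q"
      by blast
    have "sV (to_fract (a * b)) (v + w) = sV (to_fract b) (sV (to_fract a) v) + sV (to_fract a) (sV (to_fract b) w)"
      by (simp add: V.scale_right_distrib mult.commute)
    also have "\<dots> = j (scl b p + scl a q)" by (simp add: * j_add j_scale)
    finally have "sV (to_fract (a * b)) (v + w) = j (scl b p + scl a q)" .
    moreover have "a * b \<noteq> 0" "scl b p + scl a q \<in> P" using * P by (auto intro: M.subspace_add M.subspace_scale)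
    ultimately show "v + w \<in> ?S" by blast
  next
    fix k :: "'a fract" and v assume "v \<in> ?S"
    then obtain a p where *: "a \<noteq> 0" "p \<in> P" "sV (to_fract a) v = j p" by blast
    obtain r s where rs: "k = to_fract r / to_fract s" "s \<noteq> 0"
      by (cases k) (auto simp: Fract_conv_to_fract)
    have "sV (to_fract (s * a)) (sV k v) = sV (to_fract r) (sV (to_fract a) v)"
      using rs(2) by (simp add: rs(1) mult.commute)
    also have "\<dots> = j (scl r p)" by (simp add: * j_scale)
    finally have "sV (to_fract (s * a)) (sV k v) = j (scl r p)" .
    moreover have "s * a \<noteq> 0" "scl r p \<in> P" using * rs P by (auto intro: M.subspace_scale)
    ultimately show "sV k v \<in> ?S" by blast
  qed
  moreover have "j ` P \<subseteq> ?S"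
  proof clarify
    fix x assume "x \<in> P"
    moreover have "sV (to_fract 1) (j x) = j x" by simp
    ultimately show "\<exists>a p. a \<noteq> 0 \<and> p \<in> P \<and> sV (to_fract a) (j x) = j p" using one_neq_zero by blast
  qed
  ultimately have "V.span (j ` P) \<subseteq> ?S" by (rule V.span_minimal[rotated])
  then show "v \<in> V.span (j ` P) \<Longrightarrow> \<exists>a p. a \<noteq> 0 \<and> p \<in> P \<and> sV (to_fract a) v = j p" by blast
next
  assume "\<exists>a p. a \<noteq> 0 \<and> p \<in> P \<and> sV (to_fract a) v = j p"
  then obtain a p where *: "a \<noteq> 0" "p \<in> P" "sV (to_fract a) v = j p" by blast
  have "v = sV (inverse (to_fract a)) (sV (to_fract a) v)" using *(1) by simp
  also have "\<dots> = sV (inverse (to_fract a)) (j p)" by (simp only: *(3))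
  also have "\<dots> \<in> V.span (j ` P)" using *(2) by (intro V.span_scale V.span_base) blast
  finally show "v \<in> V.span (j ` P)" .
qed

lemma saturated_in_span:
  assumes "saturated P"
  shows "j x \<in> V.span (j ` P) \<longleftrightarrow> x \<in> P"
proof
  assume "j x \<in> V.span (j ` P)"
  then obtain a p where *: "a \<noteq> 0" "p \<in> P" "sV (to_fract a) (j x) = j p"
    using in_span_image[OF saturatedD(1)[OF assms]] by blast
  then have "scl a x = p" by (intro j_inject) (simp add: j_scale)
  then show "x \<in> P" using * saturatedD(6)[OF assms] by blast
qed (simp add: V.span_base)

lemma finite_span:
  obtains F where "finite F" "\<And>P. j ` P \<subseteq> V.span F"
proof -
  obtain B where B: "finite B" "M.span B = UNIV" using fg by (auto simp: finitely_generated_def)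
  have "M.subspace {x. j x \<in> V.span (j ` B)}"
    by (auto simp: M.subspace_def j_add j_scale V.span_zero intro: V.span_add V.span_scale)
  moreover have "B \<subseteq> {x. j x \<in> V.span (j ` B)}" by (auto intro: V.span_base)
  ultimately have "M.span B \<subseteq> {x. j x \<in> V.span (j ` B)}" by (rule M.span_minimal[rotated])
  with B show thesis using that[of "j ` B"] by auto
qed

lemma rk_less:
  assumes "saturated P" "saturated Q" "P \<subseteq> Q" "P \<noteq> Q"
  shows "rk P < rk Q"
proof -
  obtain F where F: "finite F" "\<And>P. j ` P \<subseteq> V.span F" using finite_span by blast
  obtain x where x: "x \<in> Q" "x \<notin> P" using assms by blast
  have "V.dim (j ` P) < V.dim (j ` Q)"
  proof (rule V.dim_less_finite[OF F(1) F(2)])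
    show "j ` P \<subseteq> V.span (j ` Q)" using assms(3) V.span_superset[of "j ` Q"] by blast
    show "j x \<in> j ` Q" "j x \<notin> V.span (j ` P)" using x saturated_in_span[OF assms(1)] by auto
  qed
  then show ?thesis by (simp add: rk_def)
qed

text \<open>Over the fraction field the saturated sum spans the sum of the spans, and the
  intersection spans their intersection; what remains is the dimension formula.\<close>

lemma rk_modular:
  assumes P: "M.subspace P" and Q: "M.subspace Q"
  shows "rk (saturation (msum P Q)) + rk (P \<inter> Q) = rk P + rk Q"
proof -
  obtain F where F: "finite F" "\<And>P. j ` P \<subseteq> V.span F" using finite_span by blast
  have sub: "V.span (j ` P) \<subseteq> V.span F" for P by (rule V.span_minimal[OF F(2)]) simp
  let ?U = "V.span (j ` P)" and ?W = "V.span (j ` Q)"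
  have S: "M.subspace (msum P Q)" by (rule subspace_msum[OF P Q])
  have "V.span (j ` saturation (msum P Q)) = {u + w |u w. u \<in> ?U \<and> w \<in> ?W}"
  proof -
    have "j ` saturation (msum P Q) \<subseteq> V.span (j ` msum P Q)"
      unfolding saturation_def in_span_image[OF S] subset_iff using j_scale[symmetric] by blast
    moreover have "j ` msum P Q \<subseteq> V.span (j ` P \<union> j ` Q)"
      unfolding msum_def by (auto simp: j_add) (intro V.span_add V.span_base; blast)
    then have "V.span (j ` msum P Q) \<subseteq> V.span (j ` P \<union> j ` Q)" by (rule V.span_minimal) simp
    moreover have "j ` P \<union> j ` Q \<subseteq> V.span (j ` saturation (msum P Q))"
      using subset_msum[OF P Q] saturation_superset[of "msum P Q"] V.span_superset[of "j ` saturation (msum P Q)"] by blast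
    ultimately have "V.span (j ` saturation (msum P Q)) = V.span (j ` P \<union> j ` Q)"
      unfolding V.span_eq by blast
    then show ?thesis by (simp add: V.span_Un)
  qed
  then have 1: "V.dim {u + w |u w. u \<in> ?U \<and> w \<in> ?W} = V.dim (j ` saturation (msum P Q))"
    by (metis V.dim_span)
  have "?U \<inter> ?W = V.span (j ` (P \<inter> Q))"
  proof (intro equalityI subsetI)
    fix v assume "v \<in> ?U \<inter> ?W"
    then obtain a p b q where *: "a \<noteq> 0" "p \<in> P" "sV (to_fract a) v = j p" "b \<noteq> 0" "q \<in> Q" "sV (to_fract b) v = j q"
      using in_span_image[OF P] in_span_image[OF Q] by blast
    have "j (scl b p) = sV (to_fract (a * b)) v" by (simp add: j_scale mult.commute flip: *(3))
    moreover have "j (scl a q) = sV (to_fract (a * b)) v" by (simp add: j_scale flip: *(6))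
    ultimately have "scl b p = scl a q" by (intro j_inject) simp
    then have "scl b p \<in> P \<inter> Q" using * P Q by (metis IntI M.subspace_scale)
    moreover have "a * b \<noteq> 0" using * by simp
    ultimately show "v \<in> V.span (j ` (P \<inter> Q))"
      using \<open>j (scl b p) = _\<close> in_span_image[OF M.subspace_inter[OF P Q]] by metis
  next
    fix v assume "v \<in> V.span (j ` (P \<inter> Q))"
    then show "v \<in> ?U \<inter> ?W"
      using V.span_mono[of "j ` (P \<inter> Q)" "j ` P"] V.span_mono[of "j ` (P \<inter> Q)" "j ` Q"] by blast
  qed
  then have 2: "V.dim (?U \<inter> ?W) = V.dim (j ` (P \<inter> Q))" by (metis V.dim_span)
  have "V.dim {u + w |u w. u \<in> ?U \<and> w \<in> ?W} + V.dim (?U \<inter> ?W) = V.dim ?U + V.dim ?W"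
    by (rule V.dim_sums_Int_finite[OF F(1) sub sub]) auto
  then show ?thesis by (simp add: 1 2 rk_def)
qed

text \<open>Over the fraction field, \<open>j h\<close> is independent of the span of
  \<open>P\<close>, so a linear functional separates them; multiplied by a common denominator it
  takes values in the ring.\<close>

lemma functional_exists:
  assumes P: "saturated P" and h: "h \<notin> P"
  obtains \<phi> :: "'m \<Rightarrow> 'a" where "\<And>x y. \<phi> (x + y) = \<phi> x + \<phi> y" "\<And>c x. \<phi> (scl c x) = c * \<phi> x"
    "\<And>x. x \<in> P \<Longrightarrow> \<phi> x = 0" "\<phi> h \<noteq> 0"
proof -
  interpret K: vector_space "(*) :: 'a fract \<Rightarrow> 'a fract \<Rightarrow> 'a fract"
    by unfold_locales (auto simp: algebra_simps)
  interpret VK: vector_space_pair sV "(*) :: 'a fract \<Rightarrow> 'a fract \<Rightarrow> 'a fract" ..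
  obtain B where B: "B \<subseteq> j ` P" "V.independent B" "j ` P \<subseteq> V.span B"
    using V.maximal_independent_subset[of "j ` P"] by blast
  have jh: "j h \<notin> V.span B" using saturated_in_span[OF P] h V.span_mono[OF B(1)] by blast
  then have "V.independent (insert (j h) B)" using B(2) by (rule V.independent_insertI)
  from VK.linear_independent_extend[OF this, of "\<lambda>v. if v = j h then 1 else 0"]
  obtain g where g: "Vector_Spaces.linear sV (*) g" "\<And>v. v \<in> insert (j h) B \<Longrightarrow> g v = (if v = j h then 1 else 0)"
    by blast
  interpret g: Vector_Spaces.linear sV "(*)" g by (rule g(1))
  have gB: "g v = 0" if "v \<in> B" for v using g(2)[of v] that jh V.span_base by auto
  have g0: "g (j x) = 0" if "x \<in> P" for x
    using g.eq_0_on_span[of B "j x"] gB B(3) that by blast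
  obtain G where G: "finite G" "M.span G = UNIV" using fg by (auto simp: finitely_generated_def)
  have "\<exists>d. d \<noteq> 0 \<and> to_fract d * k \<in> range to_fract" for k :: "'a fract"
  proof -
    obtain r s where "k = to_fract r / to_fract s" "s \<noteq> 0"
      by (cases k) (auto simp: Fract_conv_to_fract)
    then show ?thesis by (intro exI[of _ s]) auto
  qed
  then have "\<forall>k. \<exists>d. d \<noteq> 0 \<and> to_fract d * k \<in> (range to_fract :: 'a fract set)" by blast
  from choice[OF this] obtain den where den: "\<And>k. den k \<noteq> 0 \<and> to_fract (den k) * k \<in> (range to_fract :: 'a fract set)"
    by blast
  \<comment> \<open>A common denominator for the values on a finite generating set serves for the
    whole module.\<close>
  define d where "d = (\<Prod>x\<in>G. den (g (j x)))"
  have d: "d \<noteq> 0" using G(1) den by (simp add: d_def)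
  have "M.subspace {x. to_fract d * g (j x) \<in> range to_fract}"
    unfolding M.subspace_def
  proof (intro conjI ballI allI)
    show "0 \<in> {x. to_fract d * g (j x) \<in> range to_fract}" by (auto simp: g.zero intro: range_eqI[of _ _ 0])
    fix x y assume "x \<in> {x. to_fract d * g (j x) \<in> range to_fract}" "y \<in> {x. to_fract d * g (j x) \<in> range to_fract}"
    then obtain r s where "to_fract d * g (j x) = to_fract r" "to_fract d * g (j y) = to_fract s" by auto
    then have "to_fract d * g (j (x + y)) = to_fract (r + s)" by (simp add: j_add g.add distrib_left)
    then show "x + y \<in> {x. to_fract d * g (j x) \<in> range to_fract}" by (simp only: mem_Collect_eq rangeI)
  next
    fix c x assume "x \<in> {x. to_fract d * g (j x) \<in> range to_fract}"
    then obtain r where "to_fract d * g (j x) = to_fract r" by auto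
    then have "to_fract d * g (j (scl c x)) = to_fract (c * r)" by (simp add: j_scale g.scale mult.left_commute)
    then show "scl c x \<in> {x. to_fract d * g (j x) \<in> range to_fract}" by (simp only: mem_Collect_eq rangeI)
  qed
  moreover have "G \<subseteq> {x. to_fract d * g (j x) \<in> range to_fract}"
  proof clarify
    fix x assume "x \<in> G"
    then have "den (g (j x)) dvd d" unfolding d_def by (rule dvd_prodI[OF G(1)])
    then obtain k where k: "d = den (g (j x)) * k" by blast
    obtain r where "to_fract (den (g (j x))) * g (j x) = to_fract r" using den[of "g (j x)"] by auto
    then have "to_fract d * g (j x) = to_fract (k * r)" by (simp add: k mult.commute mult.left_commute)
    then show "to_fract d * g (j x) \<in> range to_fract" by (simp only: rangeI)
  qed
  ultimately have "M.span G \<subseteq> {x. to_fract d * g (j x) \<in> range to_fract}" by (rule M.span_minimal[rotated])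
  then have "to_fract d * g (j x) \<in> range to_fract" for x using G(2) by blast
  then have "\<forall>x. \<exists>r. to_fract r = to_fract d * g (j x)" by (metis imageE)
  from choice[OF this] obtain \<phi> where \<phi>: "\<And>x. to_fract (\<phi> x) = to_fract d * g (j x)" by blast
  show thesis
  proof (rule that[of \<phi>])
    fix x y c
    have "to_fract (\<phi> (x + y)) = to_fract (\<phi> x + \<phi> y)" by (simp add: \<phi> j_add g.add distrib_left)
    then show "\<phi> (x + y) = \<phi> x + \<phi> y" by (simp only: to_fract_eq_iff)
    have "to_fract (\<phi> (scl c x)) = to_fract (c * \<phi> x)" by (simp add: \<phi> j_scale g.scale mult.left_commute)
    then show "\<phi> (scl c x) = c * \<phi> x" by (simp only: to_fract_eq_iff)
  next
    fix x assume "x \<in> P"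
    then have "to_fract (\<phi> x) = 0" by (simp add: \<phi> g0)
    then show "\<phi> x = 0" by simp
  next
    have "to_fract (\<phi> h) \<noteq> 0" using d g(2)[of "j h"] by (simp add: \<phi>)
    then show "\<phi> h \<noteq> 0" by simp
  qed
qed

lemma kernel_saturated:
  assumes \<phi>: "\<And>x y. \<phi> (x + y) = \<phi> x + (\<phi> y :: 'a)" "\<And>c x. \<phi> (scl c x) = c * \<phi> x" and H: "saturated H"
  shows "saturated {x \<in> H. \<phi> x = 0}"
proof -
  have "\<phi> 0 = 0" using \<phi>(2)[of 0 0] by simp
  note H' = saturatedD[OF H]
  show ?thesis
    unfolding saturated_def M.subspace_def
  proof (intro conjI ballI allI impI)
    show "0 \<in> {x \<in> H. \<phi> x = 0}" using H'(2) \<open>\<phi> 0 = 0\<close> by blast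
    show "x + y \<in> {x \<in> H. \<phi> x = 0}" if "x \<in> {x \<in> H. \<phi> x = 0}" "y \<in> {x \<in> H. \<phi> x = 0}" for x y
      using that H'(3)[of x y] by (simp add: \<phi>(1))
    show "scl c x \<in> {x \<in> H. \<phi> x = 0}" if "x \<in> {x \<in> H. \<phi> x = 0}" for c x
      using that H'(5)[of x c] by (simp add: \<phi>(2))
    show "x \<in> {x \<in> H. \<phi> x = 0}" if "a \<noteq> 0" "scl a x \<in> {x \<in> H. \<phi> x = 0}" for a x
      using that H'(6)[of a x] by (simp add: \<phi>(2))
  qed
qed

text \<open>A functional vanishing on \<open>P\<close> but not on \<open>H\<close> maps \<open>H\<close> onto an invertible ideal, so its kernel on
  \<open>H\<close> has a complement; the kernel has smaller rank.\<close>

lemma saturated_complement: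
  assumes "saturated H" "saturated P" "P \<subseteq> H"
  shows "\<exists>Q. M.subspace Q \<and> P \<inter> Q = {0} \<and> msum P Q = H"
  using assms(1,3)
proof (induction "nat (rk H)" arbitrary: H rule: less_induct)
  case less
  note H = saturatedD[OF less.prems(1)]
  show ?case
  proof (cases "P = H")
    case True
    have "msum P {0} = P" by (auto simp: msum_def)
    then show ?thesis using True saturatedD(2)[OF assms(2)] by (intro exI[of _ "{0}"]) auto
  next
    case False
    then obtain h where h: "h \<in> H" "h \<notin> P" using less.prems(2) by blast
    obtain \<phi> where \<phi>: "\<And>x y. \<phi> (x + y) = \<phi> x + \<phi> y" "\<And>c x. \<phi> (scl c x) = c * \<phi> x"
      "\<And>x. x \<in> P \<Longrightarrow> \<phi> x = 0" "\<phi> h \<noteq> 0"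
      using functional_exists[OF assms(2) h(2)] by metis
    have \<phi>0: "\<phi> 0 = 0" using \<phi>(2)[of 0 0] by simp
    have \<phi>d: "\<phi> (x - y) = \<phi> x - \<phi> y" for x y using \<phi>(1)[of "x - y" y] by (simp add: algebra_simps)
    define I where "I = \<phi> ` H"
    have idI: "is_ideal I"
      unfolding is_ideal_iff I_def
    proof (intro conjI ballI allI)
      show "0 \<in> \<phi> ` H" using H(2) \<phi>0 by force
      fix x y assume "x \<in> \<phi> ` H" "y \<in> \<phi> ` H"
      then show "x + y \<in> \<phi> ` H" using H(3) by (auto simp flip: \<phi>(1))
    next
      fix c x assume "x \<in> \<phi> ` H"
      then show "c * x \<in> \<phi> ` H" using H(5) by (auto simp flip: \<phi>(2))
    qed
    have "I \<noteq> {0}" using h \<phi>(4) unfolding I_def by blast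
    then obtain xs where xs: "\<And>a b. (a, b) \<in> set xs \<Longrightarrow> a \<in> I \<and> (\<forall>x\<in>I. b * to_fract x \<in> range to_fract)"
      and sum: "(\<Sum>(a, b)\<leftarrow>xs. to_fract a * b) = 1"
      using dedekind_ideal_invertible[OF dedekind idI] unfolding invertible_ideal_def by fast
    define pre where "pre a = (SOME y. y \<in> H \<and> \<phi> y = a)" for a
    have pre: "pre a \<in> H" "\<phi> (pre a) = a" if "a \<in> I" for a
      using someI_ex[of "\<lambda>y. y \<in> H \<and> \<phi> y = a"] that unfolding pre_def I_def by blast+
    define m where "m b x = (SOME r. to_fract r = b * to_fract x)" for b :: "'a fract" and x
    have m: "to_fract (m b x) = b * to_fract x" if "(a, b) \<in> set xs" "x \<in> I" for a b x
    proof -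
      have "\<exists>r. to_fract r = b * to_fract x" using xs[OF that(1)] that(2) by (metis imageE)
      then show ?thesis unfolding m_def by (rule someI_ex)
    qed
    \<comment> \<open>A section of \<phi> over \<open>I\<close>, read off from the relation that the
      products \<open>a * b\<close> sum to 1: \<open>x\<close> goes to the sum of the lifts of
      \<open>a\<close> scaled by \<open>b * x\<close>. The sublists \<open>zs\<close> only serve
      induction.\<close>
    define \<sigma> where "\<sigma> zs x = (\<Sum>(a, b)\<leftarrow>zs. scl (m b x) (pre a))" for zs x
    have \<sigma>H: "\<sigma> zs x \<in> H" if "set zs \<subseteq> set xs" for zs x
      using that by (induction zs) (auto simp: \<sigma>_def H(2) intro!: H(3,5) pre dest!: xs)
    have \<sigma>_add: "\<sigma> zs (x + y) = \<sigma> zs x + \<sigma> zs y" if "set zs \<subseteq> set xs" "x \<in> I" "y \<in> I" for zs x y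
      using that(1)
    proof (induction zs)
      case (Cons z zs)
      obtain a b where z: "z = (a, b)" by (cases z)
      then have ab: "(a, b) \<in> set xs" using Cons.prems by auto
      have "x + y \<in> I" using idI that by (auto simp: is_ideal_iff)
      then have "to_fract (m b (x + y)) = to_fract (m b x + m b y)"
        using m[OF ab] that by (simp add: distrib_left)
      then have "m b (x + y) = m b x + m b y" by (simp only: to_fract_eq_iff)
      then show ?case using Cons by (simp add: \<sigma>_def z M.scale_left_distrib algebra_simps)
    qed (simp add: \<sigma>_def)
    have \<sigma>_scale: "\<sigma> zs (c * x) = scl c (\<sigma> zs x)" if "set zs \<subseteq> set xs" "x \<in> I" for zs c x
      using that(1)
    proof (induction zs)
      case (Cons z zs)
      obtain a b where z: "z = (a, b)" by (cases z)
      then have ab: "(a, b) \<in> set xs" using Cons.prems by auto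
      have "c * x \<in> I" using idI that by (auto simp: is_ideal_iff)
      then have "to_fract (m b (c * x)) = to_fract (c * m b x)"
        using m[OF ab] that by (simp add: mult.left_commute)
      then have "m b (c * x) = c * m b x" by (simp only: to_fract_eq_iff)
      then show ?case using Cons by (simp add: \<sigma>_def z M.scale_right_distrib)
    qed (simp add: \<sigma>_def)
    have "to_fract (\<phi> (\<sigma> zs x)) = to_fract x * (\<Sum>(a, b)\<leftarrow>zs. to_fract a * b)"
      if "set zs \<subseteq> set xs" "x \<in> I" for zs x
      using that(1)
    proof (induction zs)
      case (Cons z zs)
      obtain a b where z: "z = (a, b)" by (cases z)
      then have ab: "(a, b) \<in> set xs" using Cons.prems by auto
      have "\<phi> (\<sigma> (z # zs) x) = m b x * a + \<phi> (\<sigma> zs x)"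
        using xs[OF ab] by (simp add: \<sigma>_def z \<phi> pre)
      then show ?case
        using Cons m[OF ab that(2)] by (simp add: z algebra_simps)
    qed (simp add: \<sigma>_def \<phi>0)
    from this[of xs] have \<phi>\<sigma>: "\<phi> (\<sigma> xs x) = x" if "x \<in> I" for x
      using that sum by simp
    let ?J = "\<sigma> xs ` I"
    have J: "M.subspace ?J"
      unfolding M.subspace_def
    proof (intro conjI ballI allI)
      have "\<sigma> xs 0 = 0" using \<sigma>_add[of xs 0 0] idI by (simp add: is_ideal_iff)
      then show "0 \<in> ?J" using idI unfolding is_ideal_iff by force
      fix u v assume "u \<in> ?J" "v \<in> ?J"
      then obtain x y where xy: "u = \<sigma> xs x" "v = \<sigma> xs y" "x \<in> I" "y \<in> I" by blast
      then have "u + v = \<sigma> xs (x + y)" "x + y \<in> I" using \<sigma>_add[of xs x y] idI by (auto simp: is_ideal_iff)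
      then show "u + v \<in> ?J" by (rule image_eqI)
    next
      fix c u assume "u \<in> ?J"
      then obtain x where "u = \<sigma> xs x" "x \<in> I" by blast
      then have "scl c u = \<sigma> xs (c * x)" "c * x \<in> I" using \<sigma>_scale[of xs x c] idI by (auto simp: is_ideal_iff)
      then show "scl c u \<in> ?J" by (rule image_eqI)
    qed
    let ?H = "{x \<in> H. \<phi> x = 0}"
    have satH: "saturated ?H" by (rule kernel_saturated[OF \<phi>(1,2) less.prems(1)])
    have "rk ?H < rk H" by (rule rk_less[OF satH less.prems(1)]) (use h \<phi>(4) in auto)
    moreover have "0 \<le> rk ?H" by (simp add: rk_def)
    moreover have PH: "P \<subseteq> ?H" using less.prems(2) \<phi>(3) by blast
    ultimately obtain Q where Q: "M.subspace Q" "P \<inter> Q = {0}" "msum P Q = ?H"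
      using less.hyps[of ?H] satH by auto
    \<comment> \<open>The section splits \<open>H\<close> into the kernel of \<phi> and
      \<open>?J\<close>, a copy of \<open>I\<close>; adding \<open>?J\<close> to the complement of
      \<open>P\<close> in the kernel gives one in \<open>H\<close>.\<close>
    have "msum ?H ?J = H"
    proof (intro equalityI subsetI)
      fix y assume "y \<in> msum ?H ?J"
      then show "y \<in> H" using H(3) \<sigma>H[of xs] by (auto simp: msum_def)
    next
      fix y assume y: "y \<in> H"
      then have "\<phi> y \<in> I" by (simp add: I_def)
      then have "\<phi> (y - \<sigma> xs (\<phi> y)) = 0" by (simp add: \<phi>d \<phi>\<sigma>)
      moreover have "y - \<sigma> xs (\<phi> y) \<in> H" using y \<sigma>H[of xs] H(4) by blast
      ultimately have "y - \<sigma> xs (\<phi> y) \<in> ?H" by blast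
      moreover have "y = (y - \<sigma> xs (\<phi> y)) + \<sigma> xs (\<phi> y)" by simp
      ultimately show "y \<in> msum ?H ?J" using \<open>\<phi> y \<in> I\<close> unfolding msum_def by blast
    qed
    then have "msum P (msum Q ?J) = H" using Q(3) by (simp flip: msum_assoc)
    moreover have "P \<inter> msum Q ?J = {0}"
    proof
      show "{0} \<subseteq> P \<inter> msum Q ?J"
        using saturatedD(2)[OF assms(2)] M.subspace_0[OF subspace_msum[OF Q(1) J]] by blast
      show "P \<inter> msum Q ?J \<subseteq> {0}"
      proof
        fix p assume "p \<in> P \<inter> msum Q ?J"
        then obtain q x where p: "p \<in> P" "p = q + \<sigma> xs x" "q \<in> Q" "x \<in> I" by (auto simp: msum_def)
        have "q \<in> ?H" using p(3) Q(3) subset_msum(2)[OF saturatedD(1)[OF assms(2)] Q(1)] by blast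
        then have "\<phi> p = x" using p by (simp add: \<phi>(1) \<phi>\<sigma>)
        then have "x = 0" using \<phi>(3)[OF p(1)] by simp
        moreover have "\<sigma> xs 0 = 0" using \<sigma>_add[of xs 0 0] idI by (simp add: is_ideal_iff)
        ultimately show "p \<in> {0}" using p Q(2) by auto
      qed
    qed
    ultimately show ?thesis using subspace_msum[OF Q(1) J] by blast
  qed
qed

text \<open>If a nonzero multiple of \<open>p + q\<close> lies in \<open>Q\<close>, the same
  multiple of \<open>p\<close> lies in both \<open>P\<close> and \<open>Q\<close>, so
  \<open>p\<close> vanishes by torsion-freeness.\<close>

lemma complement_saturated:
  assumes H: "saturated H" and P: "M.subspace P" and Q: "M.subspace Q" and PQ: "P \<inter> Q = {0}" "msum P Q = H"
  shows "saturated Q"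
  unfolding saturated_def
proof (intro conjI allI impI)
  fix a x assume a: "a \<noteq> 0" "scl a x \<in> Q"
  then have "scl a x \<in> H" using subset_msum(2)[OF P Q] PQ(2) by blast
  then have "x \<in> H" using saturatedD(6)[OF H a(1)] by blast
  then obtain p q where x: "x = p + q" "p \<in> P" "q \<in> Q" using PQ(2) by (auto simp: msum_def)
  have "scl a p = scl a x - scl a q" by (simp add: x M.scale_right_distrib)
  moreover have "scl a x - scl a q \<in> Q"
    by (rule M.subspace_diff[OF Q a(2) M.subspace_scale[OF Q x(3)]])
  moreover have "scl a p \<in> P" using x(2) P by (intro M.subspace_scale)
  ultimately have "scl a p \<in> P \<inter> Q" by simp
  then have "p = 0" using torsion_free[OF _ a(1)] by (simp add: PQ(1))
  then show "x \<in> Q" using x by simp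
qed (rule Q)

lemma internal_direct_sum_iff:
  "internal_direct_sum scl P Q \<longleftrightarrow> saturated P \<and> saturated Q \<and> P \<inter> Q = {0} \<and> msum P Q = UNIV"
proof
  assume "internal_direct_sum scl P Q"
  then have *: "M.subspace P" "M.subspace Q" "P \<inter> Q = {0}" "msum P Q = UNIV"
    by (auto simp: internal_direct_sum_def msum_def)
  have "msum Q P = UNIV" "Q \<inter> P = {0}" using * msum_commute[of P Q] by (auto simp: Int_commute)
  then have "saturated P" using complement_saturated[OF saturated_UNIV *(2,1)] by blast
  moreover have "saturated Q" by (rule complement_saturated[OF saturated_UNIV *])
  ultimately show "saturated P \<and> saturated Q \<and> P \<inter> Q = {0} \<and> msum P Q = UNIV" using * by blast
qed (auto simp: internal_direct_sum_def msum_def saturated_def)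

text \<open>The substantial direction is \<open>saturated_complement\<close>, through which the
  Dedekind property enters.\<close>

lemma is_summand_iff: "is_summand scl P \<longleftrightarrow> saturated P"
proof
  assume P: "saturated P"
  obtain Q where Q: "M.subspace Q" "P \<inter> Q = {0}" "msum P Q = UNIV"
    using saturated_complement[OF saturated_UNIV P] by auto
  then have "internal_direct_sum scl P Q"
    using saturatedD(1)[OF P] by (auto simp: internal_direct_sum_def msum_def)
  then show "is_summand scl P" by (auto simp: is_summand_def)
qed (auto simp: is_summand_def internal_direct_sum_iff)

section \<open>The lattice of saturated submodules\<close>

definition join :: "'m set \<Rightarrow> 'm set \<Rightarrow> 'm set" where
  "join P Q = saturation (msum P Q)"

definition good :: "'m set \<Rightarrow> 'm set \<Rightarrow> bool" where
  "good P Q \<longleftrightarrow> saturated (msum P Q)"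

lemma good_join_eq: "good P Q \<Longrightarrow> join P Q = msum P Q"
  by (simp add: good_def join_def saturation_eq)

lemma saturated_join: "saturated P \<Longrightarrow> saturated Q \<Longrightarrow> saturated (join P Q)"
  unfolding join_def by (intro saturated_saturation subspace_msum saturatedD(1))

lemma join_upper: "saturated P \<Longrightarrow> saturated Q \<Longrightarrow> P \<subseteq> join P Q" "saturated P \<Longrightarrow> saturated Q \<Longrightarrow> Q \<subseteq> join P Q"
  unfolding join_def using subset_msum[of P Q] saturation_superset[of "msum P Q"] saturatedD(1) by blast+

lemma msum_least: "M.subspace R \<Longrightarrow> P \<subseteq> R \<Longrightarrow> Q \<subseteq> R \<Longrightarrow> msum P Q \<subseteq> R"
  by (auto simp: msum_def intro: M.subspace_add)

lemma join_least: "saturated R \<Longrightarrow> P \<subseteq> R \<Longrightarrow> Q \<subseteq> R \<Longrightarrow> join P Q \<subseteq> R"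
  unfolding join_def by (intro saturation_minimal msum_least saturatedD(1))

text \<open>If a multiple of \<open>v\<close> lies in the sum of the meet and \<open>z\<close>, then
  \<open>v = r + q'\<close> by the position of \<open>y\<close> and \<open>z\<close>; the same
  multiple of \<open>r\<close> lies in \<open>x\<close> plus the meet of \<open>y\<close> and
  \<open>z\<close>, so \<open>r\<close> does too. The converse implication follows by
  symmetry.\<close>

lemma good_meet_imp:
  assumes x: "saturated x" and y: "saturated y" and z: "saturated z"
    and xy: "good x y" and yz: "good y z" and g: "good x (y \<inter> z)"
  shows "good (x \<inter> y) z"
  unfolding good_def saturated_def
proof (intro conjI allI impI)
  show "M.subspace (msum (x \<inter> y) z)"
    using x y z by (intro subspace_msum M.subspace_inter saturatedD(1))
  fix a v assume a: "a \<noteq> 0" "scl a v \<in> msum (x \<inter> y) z"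
  then obtain u q where uq: "scl a v = u + q" "u \<in> x" "u \<in> y" "q \<in> z" by (auto simp: msum_def)
  then have "scl a v \<in> msum y z" by (auto simp: msum_def)
  then have "v \<in> msum y z" using yz a(1) saturatedD(6) unfolding good_def by blast
  then obtain r q' where v: "v = r + q'" "r \<in> y" "q' \<in> z" by (auto simp: msum_def)
  have "scl a r - u = q - scl a q'" using uq(1) by (simp add: v(1) M.scale_right_distrib algebra_simps)
  moreover have "scl a r - u \<in> y" using v(2) uq(3) saturatedD(4,5)[OF y] by blast
  moreover have "q - scl a q' \<in> z" using v(3) uq(4) saturatedD(4,5)[OF z] by blast
  ultimately have "scl a r - u \<in> y \<inter> z" by simp
  moreover have "scl a r = u + (scl a r - u)" by simp
  ultimately have "scl a r \<in> msum x (y \<inter> z)" using uq(2) unfolding msum_def by blast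
  then have "r \<in> msum x (y \<inter> z)" using g a(1) saturatedD(6) unfolding good_def by blast
  then obtain p w where r: "r = p + w" "p \<in> x" "w \<in> y" "w \<in> z" by (auto simp: msum_def)
  have "r - w \<in> y" using v(2) r(3) by (rule saturatedD(4)[OF y])
  then have "p \<in> x \<inter> y" using r by simp
  moreover have "w + q' \<in> z" using r(4) v(3) by (rule saturatedD(3)[OF z])
  moreover have "v = p + (w + q')" by (simp add: v(1) r(1) add.assoc)
  ultimately show "v \<in> msum (x \<inter> y) z" unfolding msum_def by blast
qed

lemma good_commute: "good P Q \<longleftrightarrow> good Q P"
  unfolding good_def by (subst msum_commute) (rule refl)

sublocale L: summand_lattice "Collect saturated" "(\<subseteq>)" "(\<inter>)" join rk good
proof unfold_locales
  fix x y z assume "x \<in> Collect saturated" "y \<in> Collect saturated" "z \<in> Collect saturated"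
  then have x: "saturated x" and y: "saturated y" and z: "saturated z" by auto
  show "join x (y \<inter> z) = join x y \<inter> z" if "x \<subseteq> z"
  proof
    show "join x (y \<inter> z) \<subseteq> join x y \<inter> z"
      using join_upper[OF x y] that saturated_join[OF x y] z
      by (intro join_least) (auto intro: saturated_Int)
    show "join x y \<inter> z \<subseteq> join x (y \<inter> z)"
    proof
      fix v assume v: "v \<in> join x y \<inter> z"
      then obtain a p q where a: "a \<noteq> 0" "scl a v = p + q" "p \<in> x" "q \<in> y"
        by (auto simp: join_def saturation_def msum_def)
      have "scl a v - p \<in> z" using v a(3) that saturatedD(4,5)[OF z] by blast
      then have "q \<in> y \<inter> z" using a by simp
      then show "v \<in> join x (y \<inter> z)" using a unfolding join_def saturation_def msum_def by blast
    qed
  qed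
  show "good x (join y z) \<longleftrightarrow> good (join x y) z" if "good x y" "good y z"
    using that by (simp add: good_join_eq) (simp add: good_def msum_assoc)
  show "good x (y \<inter> z) \<longleftrightarrow> good (x \<inter> y) z" if "good x y" "good y z"
    using good_meet_imp[OF x y z that] good_meet_imp[OF z y x] that
    by (auto simp: good_commute Int_commute)
  show "join x y \<subseteq> z" if "x \<subseteq> z" "y \<subseteq> z" using z that by (rule join_least)
next
  fix x y assume "x \<in> Collect saturated" "y \<in> Collect saturated"
  then have x: "saturated x" and y: "saturated y" by auto
  show "x \<inter> y \<in> Collect saturated" "join x y \<in> Collect saturated"
    using saturated_Int[OF x y] saturated_join[OF x y] by auto
  show "x \<subseteq> join x y" "y \<subseteq> join x y" by (rule join_upper[OF x y])+
  show "rk x < rk y" if "x \<subseteq> y" "x \<noteq> y" by (rule rk_less[OF x y that])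
  show "rk (join x y) + rk (x \<inter> y) = rk x + rk y"
    unfolding join_def by (rule rk_modular[OF saturatedD(1)[OF x] saturatedD(1)[OF y]])
  show "good y x" if "good x y" using that by (simp add: good_commute)
  show "good x y" if "x \<subseteq> y"
  proof -
    have "msum x y = y"
      using msum_least[OF saturatedD(1)[OF y] that] subset_msum(2)[OF saturatedD(1)[OF x] saturatedD(1)[OF y]] by blast
    then show ?thesis using y by (simp add: good_def)
  qed
next
  fix a w b assume "a \<in> Collect saturated" "w \<in> Collect saturated" "b \<in> Collect saturated" and le: "a \<subseteq> w" "w \<subseteq> b"
  then have a: "saturated a" and w: "saturated w" and b: "saturated b" by auto
  obtain q where q: "M.subspace q" "w \<inter> q = {0}" "msum w q = b"
    using saturated_complement[OF b w le(2)] by blast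
  have qs: "saturated q" by (rule complement_saturated[OF b saturatedD(1)[OF w] q])
  \<comment> \<open>A complement of \<open>w\<close> in \<open>b\<close>, enlarged by
    \<open>a\<close>, meets \<open>w\<close> exactly in \<open>a\<close>.\<close>
  let ?c = "msum a q"
  have c: "M.subspace ?c" by (rule subspace_msum[OF saturatedD(1)[OF a] q(1)])
  have wc: "w \<inter> ?c = a"
  proof
    show "a \<subseteq> w \<inter> ?c" using le(1) subset_msum(1)[OF saturatedD(1)[OF a] q(1)] by blast
    show "w \<inter> ?c \<subseteq> a"
    proof
      fix x assume "x \<in> w \<inter> ?c"
      then obtain p r where x: "x \<in> w" "x = p + r" "p \<in> a" "r \<in> q" by (auto simp: msum_def)
      then have "x - p \<in> w" using saturatedD(4)[OF w] le(1) by blast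
      then have "r = 0" using x q(2) by auto
      with x show "x \<in> a" by simp
    qed
  qed
  have "msum w ?c = msum (msum w a) q" by (simp add: msum_assoc)
  also have "msum w a = w"
    using msum_least[OF saturatedD(1)[OF w] subset_refl le(1)] subset_msum(1)[OF saturatedD(1)[OF w] saturatedD(1)[OF a]] by blast
  finally have sum: "msum w ?c = b" using q(3) by simp
  have "saturated ?c"
    unfolding saturated_def
  proof (intro conjI allI impI c)
    fix k x assume k: "k \<noteq> 0" "scl k x \<in> ?c"
    then obtain p r where kx: "scl k x = p + r" "p \<in> a" "r \<in> q" by (auto simp: msum_def)
    have "scl k x \<in> b" using k(2) sum subset_msum(2)[OF saturatedD(1)[OF w] c] by blast
    then have "x \<in> msum w q" using saturatedD(6)[OF b k(1)] q(3) by blast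
    then obtain u v where x: "x = u + v" "u \<in> w" "v \<in> q" by (auto simp: msum_def)
    have "scl k u - p = r - scl k v" using kx(1) by (simp add: x(1) M.scale_right_distrib algebra_simps)
    moreover have "scl k u - p \<in> w" using x(2) kx(2) le(1) saturatedD(4,5)[OF w] by blast
    moreover have "r - scl k v \<in> q" using x(3) kx(3) saturatedD(4,5)[OF qs] by blast
    ultimately have "scl k u - p \<in> w \<inter> q" by simp
    then have "scl k u - p = 0" by (simp add: q(2))
    then have "scl k u \<in> a" using kx(2) by simp
    then have "u \<in> a" by (rule saturatedD(6)[OF a k(1)])
    with x show "x \<in> ?c" unfolding msum_def by blast
  qed
  then show "\<exists>c\<in>Collect saturated. w \<inter> c = a \<and> join w c = b \<and> good w c"
    using wc sum b by (intro bexI[of _ ?c]) (auto simp: good_def join_def saturation_eq)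
next
  fix a w assume "a \<in> Collect saturated" "w \<in> Collect saturated" and le: "a \<subseteq> w" "a \<noteq> w"
  then have a: "saturated a" and w: "saturated w" by auto
  obtain h where h: "h \<in> w" "h \<notin> a" using le by blast
  obtain \<phi> where \<phi>: "\<And>x y. \<phi> (x + y) = \<phi> x + \<phi> y" "\<And>c x. \<phi> (scl c x) = c * \<phi> x"
    "\<And>x. x \<in> a \<Longrightarrow> \<phi> x = 0" "\<phi> h \<noteq> 0"
    using functional_exists[OF a h(2)] by metis
  have \<phi>d: "\<phi> (x - y) = \<phi> x - \<phi> y" for x y using \<phi>(1)[of "x - y" y] by (simp add: algebra_simps)
  \<comment> \<open>A functional that vanishes on \<open>a\<close> but not on \<open>w\<close> has a
    kernel of corank 1 in \<open>w\<close>.\<close>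
  let ?c = "{x \<in> w. \<phi> x = 0}"
  have c: "saturated ?c" by (rule kernel_saturated[OF \<phi>(1,2) w])
  obtain F where F: "finite F" "\<And>P. j ` P \<subseteq> V.span F" using finite_span by blast
  have hc: "j h \<notin> V.span (j ` ?c)" using saturated_in_span[OF c] \<phi>(4) by blast
  have "V.dim (insert (j h) (j ` ?c)) = V.dim (j ` ?c) + 1"
    by (rule V.dim_insert_finite[OF F(1) F(2) hc])
  moreover have "V.span (insert (j h) (j ` ?c)) = V.span (j ` w)"
  proof -
    have "insert (j h) (j ` ?c) \<subseteq> V.span (j ` w)" using h(1) by (auto intro: V.span_base)
    moreover have "j x \<in> V.span (insert (j h) (j ` ?c))" if x: "x \<in> w" for x
    proof -
      \<comment> \<open>Cross-multiplication produces an element killed by \<phi>; it expresses a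
        nonzero multiple of \<open>x\<close> through the kernel and \<open>h\<close>.\<close>
      let ?u = "scl (\<phi> h) x - scl (\<phi> x) h"
      have "?u \<in> ?c" using x h(1) saturatedD(4,5)[OF w] by (simp add: \<phi>d \<phi>(2) mult.commute)
      then have "j ?u \<in> V.span (insert (j h) (j ` ?c))" by (intro V.span_base) blast
      moreover have "sV (to_fract (\<phi> x)) (j h) \<in> V.span (insert (j h) (j ` ?c))"
        by (intro V.span_scale V.span_base) blast
      ultimately have "j ?u + sV (to_fract (\<phi> x)) (j h) \<in> V.span (insert (j h) (j ` ?c))" by (rule V.span_add)
      then have *: "sV (to_fract (\<phi> h)) (j x) \<in> V.span (insert (j h) (j ` ?c))" by (simp add: j_diff j_scale)
      have "sV (inverse (to_fract (\<phi> h))) (sV (to_fract (\<phi> h)) (j x)) \<in> V.span (insert (j h) (j ` ?c))"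
        using * by (rule V.span_scale)
      then show ?thesis using \<phi>(4) by simp
    qed
    ultimately show ?thesis unfolding V.span_eq by blast
  qed
  ultimately have "rk ?c = rk w - 1" unfolding rk_def by (metis V.dim_span of_nat_1 of_nat_add add_diff_cancel_right')
  then show "\<exists>c\<in>Collect saturated. a \<subseteq> c \<and> c \<subseteq> w \<and> rk c = rk w - 1"
    using c le(1) \<phi>(3) by (intro bexI[of _ ?c]) auto
qed auto

end

section \<open>From homology to reduced homology\<close>

lemma lookup_map: "f 0 = 0 \<Longrightarrow> Poly_Mapping.lookup (Poly_Mapping.map f p) x = f (Poly_Mapping.lookup p x)"
  by (simp add: Poly_Mapping.map.rep_eq when_def)

text \<open>A projective module embeds in a free module, and extending the coefficients to the
  fraction field places it in a vector space.\<close>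

lemma projective_module_embedding:
  fixes scl :: "'a::idom \<Rightarrow> 'm::ab_group_add \<Rightarrow> 'm"
  assumes "dedekind_domain TYPE('a)" "Modules.module scl" "finitely_generated scl UNIV" "projective_module scl"
  obtains j :: "'m \<Rightarrow> 'm \<Rightarrow>\<^sub>0 'a fract" where "embedded_module scl (\<lambda>k. Poly_Mapping.map ((*) k)) j"
proof -
  obtain \<iota> :: "'m \<Rightarrow> 'm \<Rightarrow>\<^sub>0 'a" and \<pi> where \<iota>: "module_hom scl free_scale \<iota>"
    and \<pi>: "module_hom free_scale scl \<pi>" "\<And>x. \<pi> (\<iota> x) = x"
    using assms(4) unfolding projective_module_def by blast
  interpret \<iota>: module_hom scl free_scale \<iota> by (rule \<iota>)
  interpret \<pi>: module_hom free_scale scl \<pi> by (rule \<pi>(1))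
  have "embedded_module scl (\<lambda>k. Poly_Mapping.map ((*) k)) (\<lambda>x. Poly_Mapping.map to_fract (\<iota> x))"
  proof (intro embedded_module.intro embedded_module_axioms.intro assms)
    show "vector_space (\<lambda>k. Poly_Mapping.map ((*) (k :: 'a fract)))"
      by unfold_locales
        (auto intro!: poly_mapping_eqI simp: lookup_map lookup_add algebra_simps)
    show "Poly_Mapping.map to_fract (\<iota> (x + y)) = Poly_Mapping.map to_fract (\<iota> x) + Poly_Mapping.map to_fract (\<iota> y)" for x y
      by (auto intro!: poly_mapping_eqI simp: lookup_map lookup_add \<iota>.add)
    show "Poly_Mapping.map to_fract (\<iota> (scl c x)) = Poly_Mapping.map ((*) (to_fract c)) (Poly_Mapping.map to_fract (\<iota> x))" for c x
      by (auto intro!: poly_mapping_eqI simp: lookup_map \<iota>.scale)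
    fix x assume *: "Poly_Mapping.map to_fract (\<iota> x) = 0"
    have "Poly_Mapping.lookup (\<iota> x) m = 0" for m
      using arg_cong[OF *, of "\<lambda>p. Poly_Mapping.lookup p m"] by (simp add: lookup_map)
    then have "\<iota> x = 0" by (intro poly_mapping_eqI) simp
    then show "x = 0" using \<pi>(2)[of x] by simp
  qed
  then show thesis by (rule that)
qed

text \<open>A class of \<open>B\<close> is reduced iff its image in the homology of a point vanishes, so every lift of a
  reduced class is reduced.\<close>

lemma reduced_homology_map_epi:
  assumes f: "continuous_map A B f"
    and surj: "\<And>p c. c \<in> carrier (homology_group (int p) B) \<Longrightarrow>
      \<exists>d\<in>carrier (homology_group (int p) A). hom_induced (int p) A {} B {} f d = c"
  shows "reduced_homology_map q A B f \<in> epi (reduced_homology q A) (reduced_homology q B)"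
proof -
  have hom: "reduced_homology_map q A B f \<in> hom (reduced_homology q A) (reduced_homology q B)"
    by (rule reduced_homology_map_hom[OF f])
  have A: "topspace A = {}" if "topspace B = {}"
    using continuous_map_image_subset_topspace[OF f] that by blast
  have "y \<in> reduced_homology_map q A B f ` carrier (reduced_homology q A)"
    if y_in: "y \<in> carrier (reduced_homology q B)" for y
  proof -
    obtain c k where y: "y = (c, k)" and c: "c \<in> carrier (reduced_homology_group q B)"
      and k: "k \<in> carrier (empty_correction q B)"
      using y_in by (auto simp: reduced_homology_def DirProd_def)
    have "\<exists>d\<in>carrier (reduced_homology_group q A). hom_induced q A {} B {} f d = c"
    proof (cases "q < 0")
      case True
      have "carrier (reduced_homology_group q B) = {\<one>\<^bsub>reduced_homology_group q B\<^esub>}"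
        using trivial_reduced_homology_group[OF True, of B] by (simp add: trivial_group_def)
      moreover have "\<one>\<^bsub>reduced_homology_group q A\<^esub> \<in> carrier (reduced_homology_group q A)"
        by (simp add: group.is_monoid monoid.one_closed)
      ultimately show ?thesis using hom_induced_reduced[of _ q A B f] c by blast
    next
      case False
      then obtain p where q: "q = int p" using nonneg_int_cases[of q] by auto
      have "c \<in> carrier (homology_group q B)" using c carrier_reduced_homology_group_subset by blast
      then obtain d where d: "d \<in> carrier (homology_group q A)" "hom_induced q A {} B {} f d = c"
        using surj[of c p] q by blast
      let ?u = "\<lambda>_. ()" and ?pt = "discrete_topology {()}"
      have "continuous_map B ?pt ?u" by simp
      then have "hom_induced q A {} ?pt {} ?u d = hom_induced q B {} ?pt {} ?u c"
        using hom_induced_compose_empty[OF f, of ?pt ?u q] d(2) by (simp add: o_def fun_eq_iff)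
      also have "\<dots> = \<one>\<^bsub>homology_group q ?pt\<^esub>"
        using c by (simp add: carrier_reduced_homology_group kernel_def)
      finally have "d \<in> carrier (reduced_homology_group q A)"
        using d(1) by (simp add: carrier_reduced_homology_group kernel_def)
      with d(2) show ?thesis by blast
    qed
    then obtain d where d: "d \<in> carrier (reduced_homology_group q A)" "hom_induced q A {} B {} f d = c"
      by blast
    \<comment> \<open>If \<open>B\<close> is empty then so is \<open>A\<close>, so a class in degree
      -1 is lifted by itself; otherwise \<open>k\<close> is 0.\<close>
    have "(d, k) \<in> carrier (reduced_homology q A)" "reduced_homology_map q A B f (d, k) = y"
      using d k A by (auto simp: y reduced_homology_def reduced_homology_map_def DirProd_def
          empty_correction_def singleton_group_def split: if_splits)
    then show ?thesis by (metis image_eqI)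
  qed
  moreover have "reduced_homology_map q A B f ` carrier (reduced_homology q A) \<subseteq> carrier (reduced_homology q B)"
    using hom by (auto simp: hom_def)
  ultimately show ?thesis using hom by (auto simp: epi_def)
qed

theorem theorem1p1:
  fixes scl :: "'a::idom \<Rightarrow> 'm::ab_group_add \<Rightarrow> 'm" and n :: nat
  assumes "dedekind_domain TYPE('a)"
    and "Modules.module scl"
    and "finitely_generated scl UNIV"
    and "projective_module scl"
    and "has_rank scl n"
  shows "snd ` split_poset scl \<subseteq> summand_poset scl \<and>
    monotone_on (split_poset scl) split_le (\<lambda>P Q. Q \<subseteq> P) snd \<and>
    op_tits_building scl = tits_building scl \<and>
    reduced_homology_map (int n - 2) (split_tits_building scl) (op_tits_building scl)
      (realization_map snd) \<in> epi (split_steinberg_module scl n) (steinberg_module scl n)"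
proof -
  obtain j :: "'m \<Rightarrow> 'm \<Rightarrow>\<^sub>0 'a fract" where "embedded_module scl (\<lambda>k. Poly_Mapping.map ((*) k)) j"
    using projective_module_embedding[OF assms(1-4)] by blast
  then interpret E: embedded_module scl "\<lambda>k. Poly_Mapping.map ((*) k)" j .
  have im: "snd ` split_poset scl \<subseteq> summand_poset scl" by (rule snd_split_poset)
  have mono: "monotone_on (split_poset scl) split_le (\<lambda>P Q. Q \<subseteq> P) snd"
    by (auto simp: monotone_on_def split_le_def split_less_def)
  have Y: "E.saturated P" "P \<noteq> {0}" "P \<noteq> UNIV" if "P \<in> summand_poset scl" for P
    using that by (auto simp: summand_poset_def E.is_summand_iff)
  have rk0: "0 \<le> E.rk P" for P by (simp add: E.rk_def)
  have fibre: "acyclic_below (\<lambda>x y. split_le x y \<and> x \<noteq> y) {x \<in> split_poset scl. W \<subseteq> snd x}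
      (nat (E.rk UNIV - E.rk W))" if W: "W \<in> summand_poset scl" for W
  proof -
    have "{x \<in> split_poset scl. W \<subseteq> snd x} = E.L.splittings_above {0} UNIV W"
    proof -
      have split: "E.L.compl {0} UNIV P Q \<longleftrightarrow> internal_direct_sum scl P Q" for P Q
        unfolding E.L.compl_def E.internal_direct_sum_iff
        using E.saturated_UNIV E.good_join_eq[of P Q] E.good_def[of P Q] by auto
      \<comment> \<open>Since \<open>Q\<close> contains the nonzero \<open>W\<close>, its complement
        \<open>P\<close> is proper automatically, and \<open>Q\<close> is proper just when
        \<open>P\<close> is nonzero.\<close>
      have proper: "P \<noteq> UNIV \<and> Q \<noteq> UNIV \<longleftrightarrow> P \<noteq> {0}" if "internal_direct_sum scl P Q" "W \<subseteq> Q" for P Q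
      proof -
        have PQ: "P \<inter> Q = {0}" "E.msum P Q = UNIV" and "0 \<in> W"
          using that(1) E.saturatedD(2)[OF Y(1)[OF W]] by (auto simp: E.internal_direct_sum_iff)
        then have "P \<noteq> UNIV" using that(2) Y(2)[OF W] by auto
        moreover have "Q = UNIV \<longleftrightarrow> P = {0}"
        proof
          assume "Q = UNIV"
          with PQ(1) show "P = {0}" by simp
        next
          assume "P = {0}"
          with PQ(2) show "Q = UNIV" by (simp add: E.msum_def)
        qed
        ultimately show ?thesis by blast
      qed
      show ?thesis
        unfolding split_poset_def E.L.splittings_above_def split
      proof (rule Set.set_eqI)
        fix x :: "'m set \<times> 'm set"
        obtain P Q where "x = (P, Q)" by (cases x)
        then show "x \<in> {x \<in> {(P, Q). internal_direct_sum scl P Q \<and> P \<noteq> UNIV \<and> Q \<noteq> UNIV}. W \<subseteq> snd x} \<longleftrightarrow>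
            x \<in> {(P, Q). internal_direct_sum scl P Q \<and> W \<subseteq> Q \<and> P \<noteq> {0}}"
          using proper[of P Q] by simp metis
      qed
    qed
    moreover have "(\<lambda>x y. split_le x y \<and> x \<noteq> y) = E.L.split_lt"
      by (auto simp: fun_eq_iff split_le_def split_less_def E.L.split_lt_def)
    moreover have "acyclic_below E.L.split_lt (E.L.splittings_above {0} UNIV W) (nat (E.rk UNIV - E.rk W))"
      using E.saturated_0 E.saturated_UNIV Y(1)[OF W] E.saturatedD(2)[OF Y(1)[OF W]]
      by (intro acyclic_splittings_above[OF E.L.summand_lattice_axioms]) auto
    ultimately show ?thesis by simp
  qed
  have surj: "\<exists>d\<in>carrier (homology_group (int p) (split_tits_building scl)).
      hom_induced (int p) (split_tits_building scl) {} (op_tits_building scl) {} (realization_map snd) d = c"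
    if "c \<in> carrier (homology_group (int p) (op_tits_building scl))" for p c
    unfolding split_tits_building_def op_tits_building_def
  \<comment> \<open>In the opposite order the rank that grows along the order is the corank of
    \<open>W\<close>, and it is also the range in which the fibre over \<open>W\<close> is
    acyclic.\<close>
  proof (rule hom_induced_surjective[where rk = "\<lambda>W. nat (E.rk UNIV - E.rk W)" and N = "nat (E.rk UNIV)"])
    show "nat (E.rk UNIV - E.rk P) < nat (E.rk UNIV - E.rk Q)"
      if "P \<in> summand_poset scl" "Q \<in> summand_poset scl" "Q \<subseteq> P" "P \<noteq> Q" for P Q
      using E.rk_less[of Q P] E.rk_less[OF Y(1) E.saturated_UNIV, of P] Y that by auto
    show "0 < nat (E.rk UNIV - E.rk P)" if "P \<in> summand_poset scl" for P
      using E.rk_less[OF Y(1) E.saturated_UNIV, of P] Y that by auto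
    show "nat (E.rk UNIV - E.rk P) \<le> nat (E.rk UNIV)" for P
      using rk0[of P] by simp
    show "c \<in> carrier (homology_group (int p) (geometric_realization (summand_poset scl) (\<lambda>P Q. Q \<subseteq> P)))"
      using that by (simp add: op_tits_building_def)
  qed (use im mono fibre in \<open>auto simp: split_le_def\<close>)
  have "continuous_map (split_tits_building scl) (op_tits_building scl) (realization_map snd)"
    unfolding split_tits_building_def op_tits_building_def by (rule continuous_map_realization_map[OF mono im])
  then have "reduced_homology_map (int n - 2) (split_tits_building scl) (op_tits_building scl) (realization_map snd)
      \<in> epi (split_steinberg_module scl n) (steinberg_module scl n)"
    unfolding split_steinberg_module_def steinberg_module_def op_tits_building_eq[symmetric]
    using surj by (rule reduced_homology_map_epi)
  with im mono show ?thesis by (simp add: op_tits_building_eq)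
qed

end
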